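(* Let $(\boldsymbol\psi,\boldsymbol q,\boldsymbol B,\boldsymbol D,\boldsymbol I_{\mathrm{ext}},\boldsymbol E_{\mathrm{ext}},u,y)$ be a sufficiently regular solution (in the sense specified in the context) of the coupled system consisting of (1) the telegrapher's equations $$\tfrac{d}{dt}\boldsymbol\psi(t)=-\boldsymbol R\boldsymbol L^{-1}\boldsymbol\psi(t)-\tfrac{\partial}{\partial\eta}\boldsymbol V(t),\quad \tfrac{d}{dt}\boldsymbol q(t)=-\boldsymbol G\boldsymbol C^{-1}\boldsymbol q(t)-\tfrac{\partial}{\partial\eta}\boldsymbol I(t),\quad \boldsymbol E_{\mathrm{ext}}(t)=\tfrac{\partial}{\partial\eta}\boldsymbol V(t)$$ on $[0,1]$, where $\boldsymbol V(t)=\boldsymbol C^{-1}\boldsymbol q(t)$ and $\boldsymbol I(t)=\boldsymbol L^{-1}\boldsymbol\psi(t)+\boldsymbol I_{\mathrm{ext}}(t)$; (2) the input and output relations $$\begin{pmatrix}u(t)\\0\end{pmatrix}=W_B\begin{pmatrix}\boldsymbol V(t,0)\\ \boldsymbol V(t,1)\\ \boldsymbol I(t,0)\\-\boldsymbol I(t,1)\end{pmatrix},\qquad y(t)=W_{C,\mathrm{out}}\begin{pmatrix}\boldsymbol V(t,0)\\ \boldsymbol V(t,1)\\ \boldsymbol I(t,0)\\-\boldsymbol I(t,1)\end{pmatrix},$$ where the output is co-located to $u$; (3) Maxwell's equations $$\tfrac{\partial}{\partial t}\boldsymbol B(t)=-\operatorname{rot}\boldsymbol E(t),\quad \tfrac{\partial}{\partial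 t}\boldsymbol D(t)=\operatorname{rot}\boldsymbol H(t)-\boldsymbol\sigma\boldsymbol E(t)$$ on $\Omega$, where $\boldsymbol H(t)=\boldsymbol\mu^{-1}\boldsymbol B(t)$ and $\boldsymbol E(t)=\boldsymbol\epsilon^{-1}\boldsymbol D(t)$; (4) the boundary conditions: on $\partial\Omega_0$ either $\pi_\tau\boldsymbol E(t)=0$ for all $t\ge0$ or $\nu\times\boldsymbol H(t)=0$ for all $t\ge 0$; and $\pi_\tau\boldsymbol E(t)=0$ on $\Gamma_{\mathrm{end}}$ for all $t\ge0$; (5) the coupling conditions on the lateral surfaces $\Gamma_{\mathrm{lat}}$, $$-\boldsymbol I_{\mathrm{ext}}(t)=P_{\mathrm{mag}}\big((\nu\times\boldsymbol H(t))|_{\Gamma_{\mathrm{lat}}}\big),\qquad (\pi_\tau\boldsymbol E(t))|_{\Gamma_{\mathrm{lat}}}=P_{\mathrm{el}}\boldsymbol E_{\mathrm{ext}}(t).$$ Define the total energy $$\mathcal E(t)=\tfrac12\int_0^1\boldsymbol\psi(t,\eta)^*\boldsymbol L(\eta)^{-1}\boldsymbol\psi(t,\eta)+\boldsymbol q(t,\eta)^*\boldsymbol C(\eta)^{-1}\boldsymbol q(t,\eta)\,d\eta+\tfrac12\int_\Omega\boldsymbol B(t,\xi)^*\boldsymbol\mu(\xi)^{-1}\boldsymbol B(t,\xi)+\boldsymbol D(t,\xi)^*\boldsymbol\epsilon(\xi)^{-1}\boldsymbol D(t,\xi)\,d\xi.$$ Then for all $t\ge0$ $$\tfrac{d}{dt}\mathcal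 E(t)\le\operatorname{Re}\big(u(t)^*y(t)\big).$$
   Context: Notation: $A^*$ is the conjugate transpose; $P\ge0$, $P>0$ (resp. $P\le 0$) means Hermitian positive semidefinite, positive definite (resp. negative semidefinite). $A^\dagger$ is the Moore-Penrose inverse. $\mathrm{id}_n$ is the $n\times n$ identity matrix. Transmission line parameters: $k\in\mathbb N$; $\boldsymbol C,\boldsymbol L,\boldsymbol R,\boldsymbol G:[0,1]\to\mathbb C^{k\times k}$ are measurable and essentially bounded, with $\boldsymbol C(\eta)>0$, $\boldsymbol L(\eta)>0$, $\boldsymbol R(\eta)+\boldsymbol R(\eta)^*\ge0$, $\boldsymbol G(\eta)+\boldsymbol G(\eta)^*\ge0$ for a.e. $\eta$, and the pointwise inverses $\boldsymbol C^{-1},\boldsymbol L^{-1}$ are essentially bounded. Input/output matrices: $m\le 2k$, $W_{B,\mathrm{inp}}\in\mathbb C^{m\times4k}$, $W_{B,0}\in\mathbb C^{(2k-m)\times 4k}$, and $W_B=\begin{bmatrix}W_{B,\mathrm{inp}}\\ W_{B,0}\end{bmatrix}\in\mathbb C^{2k\times4k}$ has full row rank and satisfies $W_BJW_B^*\ge0$, where $J=\begin{bmatrix}0&\mathrm{id}_{2k}\\\mathrm{id}_{2k}&0\end{bmatrix}$. The output is co-located to $u$ if $W_{C,\mathrm{out}}=[\mathrm{id}_m,\,0_{m\times(2k-m)}]\,W_C$ for some $W_C\in\mathbb C^{2k\times4k}$ with $$J-\begin{bmatrix}W_B\\ W_C\end{bmatrix}^*J\begin{bmatrix}W_B\\ W_C\end{bmatrix}\le0.$$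 Maxwell parameters: $\boldsymbol\epsilon,\boldsymbol\mu,\boldsymbol\sigma:\Omega\to\mathbb C^{3\times3}$ are measurable and essentially bounded, $\boldsymbol\epsilon(\xi)>0$, $\boldsymbol\mu(\xi)>0$, $\boldsymbol\sigma(\xi)+\boldsymbol\sigma(\xi)^*\ge0$ for a.e. $\xi$, and $\boldsymbol\epsilon^{-1},\boldsymbol\mu^{-1}$ are essentially bounded. Geometry: $\Omega=\Omega_0\setminus\bigcup_{i=1}^k\overline{\Omega_i}\subseteq\mathbb R^3$ is a Lipschitz domain, where $\Omega_0\subseteq\mathbb R^3$ is a (possibly unbounded) Lipschitz domain, $\overline{\Omega_i}\subseteq\Omega_0$, and the $\overline{\Omega_i}$ are pairwise disjoint. Cable $i$ has radius $r_i>0$, length $l_i>0$, center curve $\alpha_i\in C^2([0,1];\mathbb R^3)$ with $\|\alpha_i'(\eta)\|=l_i$ and $\|\alpha_i''(\eta)\|<l_i^2/r_i$ for all $\eta\in[0,1]$. Fix $\kappa_{i1},\kappa_{i2}\in C^1([0,1];\mathbb R^3)$ such that $(\tfrac1{l_i}\alpha_i'(\eta),\kappa_{i1}(\eta),\kappa_{i2}(\eta))$ is an orthonormal basis of $\mathbb R^3$ with $\det[\alpha_i'(\eta),\kappa_{i1}(\eta),\kappa_{i2}(\eta)]=l_i$ for all $\eta$. Put $\beta_{i\eta}(\theta)=r_i(\kappa_{i1}(\eta)\sin\theta+\kappa_{i2}(\eta)\cos\theta)$ and $\Phi_i(\eta,\theta)=\alpha_i(\eta)+\beta_{i\eta}(\theta)$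 for $(\eta,\theta)\in[0,1]\times(-\pi,\pi]$; $\beta_{i\eta}'$ is the derivative in $\theta$. The map $\Phi_i$ is assumed injective. The cable is $\Omega_i=\{\alpha_i(\eta)+\delta\beta_{i\eta}(\theta):\delta,\eta\in[0,1],\theta\in(-\pi,\pi]\}$, and its boundary is the disjoint union of the lateral surface $\Gamma_{i,\mathrm{lat}}=\Phi_i((0,1)\times(-\pi,\pi])$ and $\Gamma_{i,\mathrm{end}}=\{\alpha_i(\eta)+\delta\beta_{i\eta}(\theta):\eta\in\{0,1\},\delta\in[0,1],\theta\in(-\pi,\pi]\}$ (the two end discs). $\Gamma_{\mathrm{lat}}=\bigcup_i\Gamma_{i,\mathrm{lat}}$, $\Gamma_{\mathrm{end}}=\bigcup_i\Gamma_{i,\mathrm{end}}$, so that $\partial\Omega$ is the disjoint union of $\partial\Omega_0,\Gamma_{\mathrm{end}},\Gamma_{\mathrm{lat}}$. $\nu(\xi)$ is the unit normal on $\partial\Omega$ pointing out of $\Omega$ (so on $\Gamma_{i,\mathrm{lat}}$ it points into the cable: $\nu(\Phi_i(\eta,\theta))=-\beta_{i\eta}(\theta)/r_i$), and $\pi_\tau(\xi)w=(\nu(\xi)\times w)\times\nu(\xi)$ is the orthogonal projection onto the tangent space of $\partial\Omega$ at $\xi$. Coupling operators: let $\nabla\Phi_i$ be the transpose of the Jacobian $d\Phi_i\in\mathbb R^{3\times2}$, $\Psi_i:\Gamma_{i,\mathrm{lat}}\to(0,1)\times(-\pi,\pi]$ the inverse of $\Phi_i$, and $\Psi_{i1}$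 its first component. Then $P_{\mathrm{mag}}:L^2(\Gamma_{\mathrm{lat}};\mathbb C^3)\to L^2((0,1);\mathbb C^k)$ has $i$-th component $$(P_{\mathrm{mag}}g)_i(\eta)=\int_{-\pi}^{\pi}\big(g\times\nu\big)(\Phi_i(\eta,\theta))\cdot\beta_{i\eta}'(\theta)\,d\theta,$$ and $P_{\mathrm{el}}:L^2((0,1);\mathbb C^k)\to L^2(\Gamma_{\mathrm{lat}};\mathbb C^3)$ is given by $$(P_{\mathrm{el}}f)|_{\Gamma_{i,\mathrm{lat}}}=(\nabla\Phi_i\circ\Psi_i)^\dagger\begin{pmatrix}f_i\circ\Psi_{i1}\\0\end{pmatrix}.$$ Sufficient regularity means: $\boldsymbol\psi,\boldsymbol q\in C^1([0,\infty);L^2((0,1);\mathbb C^k))$, $\boldsymbol B,\boldsymbol D\in C^1([0,\infty);L^2(\Omega;\mathbb C^3))$; for each $t\ge0$, $\boldsymbol I_{\mathrm{ext}}(t)\in L^2((0,1);\mathbb C^k)$, $\boldsymbol V(t),\boldsymbol I(t)\in H^1((0,1);\mathbb C^k)$, $\operatorname{rot}\boldsymbol E(t),\operatorname{rot}\boldsymbol H(t)\in L^2(\Omega;\mathbb C^3)$, and the tangential traces $\pi_\tau\boldsymbol E(t)$ and $\nu\times\boldsymbol H(t)$ exist in $L^2(\partial\Omega;\mathbb C^3)$ and satisfy the integration by parts formula $$\int_\Omega-(\operatorname{rot}\boldsymbol E)^*\boldsymbol H+\boldsymbol E^*\operatorname{rot}\boldsymbol H\,d\xi=\int_{\partial\Omega}(\pi_\tau\boldsymbol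 E)^*(\nu\times\boldsymbol H)\,d\xi$$ (valid for all sufficiently smooth fields), the right-hand side being a surface integral. *)

theory Defs
  imports
    "Jordan_Normal_Form.Schur_Decomposition"
    "Jordan_Normal_Form.DL_Rank"
    "HOL-Analysis.Analysis"
begin

no_notation Matrix.vec_index (infixl \<open>$\<close> 100)
unbundle no cross3_syntax
unbundle set_product_syntax

section \<open>Complex vectors and matrices\<close>

definition cdot :: "complex^'n \<Rightarrow> complex^'n \<Rightarrow> complex" where
  "cdot v w = (\<Sum>i\<in>UNIV. cnj (v $ i) * w $ i)"

definition adj :: "complex^'n^'m \<Rightarrow> complex^'m^'n" where
  "adj A = (\<chi> i j. cnj (A $ j $ i))"

definition psd :: "complex^'n^'n \<Rightarrow> bool" where
  "psd A \<longleftrightarrow> adj A = A \<and> (\<forall>x. 0 \<le> Re (cdot x (A *v x)))"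

definition pd :: "complex^'n^'n \<Rightarrow> bool" where
  "pd A \<longleftrightarrow> adj A = A \<and> (\<forall>x. x \<noteq> 0 \<longrightarrow> 0 < Re (cdot x (A *v x)))"

text \<open>The Moore--Penrose inverse, through the four Penrose equations.\<close>

definition pinv :: "complex^'n^'m \<Rightarrow> complex^'m^'n" where
  "pinv A = (THE X. A ** X ** A = A \<and> X ** A ** X = X \<and>
                    adj (A ** X) = A ** X \<and> adj (X ** A) = X ** A)"

definition cvec :: "real^'n \<Rightarrow> complex^'n" where
  "cvec v = (\<chi> i. of_real (v $ i))"

definition cmat :: "real^'n^'m \<Rightarrow> complex^'n^'m" where
  "cmat A = (\<chi> i j. of_real (A $ i $ j))"

definition ccross :: "complex^3 \<Rightarrow> complex^3 \<Rightarrow> complex^3" where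
  "ccross a b = vector [a$2 * b$3 - a$3 * b$2, a$3 * b$1 - a$1 * b$3, a$1 * b$2 - a$2 * b$1]"

text \<open>
  Matrices whose number of rows depends on \<open>m\<close> (where \<open>m = 0\<close> and \<open>m = 2 * k\<close> are allowed) are
  matrices of \<open>Jordan_Normal_Form\<close> with explicit dimensions.
\<close>

definition mat_psd :: "nat \<Rightarrow> complex mat \<Rightarrow> bool" where
  "mat_psd n A \<longleftrightarrow> A \<in> carrier_mat n n \<and> mat_adjoint A = A \<and>
     (\<forall>v \<in> carrier_vec n. 0 \<le> Re (scalar_prod (conjugate v) (A *\<^sub>v v)))"

definition mat_nsd :: "nat \<Rightarrow> complex mat \<Rightarrow> bool" where
  "mat_nsd n A \<longleftrightarrow> mat_psd n (- A)"

definition Jmat :: "nat \<Rightarrow> complex mat" where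
  "Jmat n = four_block_mat (0\<^sub>m n n) (1\<^sub>m n) (1\<^sub>m n) (0\<^sub>m n n)"

definition passive_input :: "nat \<Rightarrow> nat \<Rightarrow> complex mat \<Rightarrow> complex mat \<Rightarrow> bool" where
  "passive_input k m Winp W0 \<longleftrightarrow>
     m \<le> 2 * k \<and> Winp \<in> carrier_mat m (4 * k) \<and> W0 \<in> carrier_mat (2 * k - m) (4 * k) \<and>
     (let WB = Winp @\<^sub>r W0 in
        vec_space.rank (2 * k) WB = 2 * k \<and>
        mat_psd (2 * k) (WB * Jmat (2 * k) * mat_adjoint WB))"

definition co_located :: "nat \<Rightarrow> nat \<Rightarrow> complex mat \<Rightarrow> complex mat \<Rightarrow> bool" where
  "co_located k m WB Wout \<longleftrightarrow>
     (\<exists>WC \<in> carrier_mat (2 * k) (4 * k).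
        Wout = Matrix.mat m (2 * k) (\<lambda>(i, j). if i = j then 1 else 0) * WC \<and>
        mat_nsd (4 * k)
          (Jmat (2 * k) - mat_adjoint (WB @\<^sub>r WC) * Jmat (2 * k) * (WB @\<^sub>r WC)))"

text \<open>
  Coordinates of a vector indexed by the finite type of cables, with respect to the fixed
  enumeration \<^const>\<open>from_nat_into\<close> of that type (the numbering of the cables by \<open>0, \<dots>, k - 1\<close>).
\<close>

definition coords :: "complex^'k \<Rightarrow> complex Matrix.vec" where
  "coords v = Matrix.vec CARD('k) (\<lambda>j. v $ (from_nat_into (UNIV :: 'k set) j))"

section \<open>Function spaces\<close>

definition L2 :: "'a measure \<Rightarrow> ('a \<Rightarrow> 'b::real_normed_vector) set" where
  "L2 M = {f \<in> borel_measurable M. integrable M (\<lambda>x. (norm (f x))\<^sup>2)}"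

definition L2norm :: "'a measure \<Rightarrow> ('a \<Rightarrow> 'b::real_normed_vector) \<Rightarrow> real" where
  "L2norm M f = sqrt (\<integral>x. (norm (f x))\<^sup>2 \<partial>M)"

definition ess_bounded :: "'a measure \<Rightarrow> ('a \<Rightarrow> 'b::real_normed_vector) \<Rightarrow> bool" where
  "ess_bounded M f \<longleftrightarrow> f \<in> borel_measurable M \<and> (\<exists>K. AE x in M. norm (f x) \<le> K)"

text \<open>The derivative in \<open>L\<^sup>2\<close> of a curve defined on \<open>[0, \<infinity>)\<close>; it is one-sided at \<open>0\<close>.\<close>

definition has_L2_derivative ::
  "'a measure \<Rightarrow> (real \<Rightarrow> 'a \<Rightarrow> 'b::real_normed_vector) \<Rightarrow> ('a \<Rightarrow> 'b) \<Rightarrow> real \<Rightarrow> bool" where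
  "has_L2_derivative M f g t \<longleftrightarrow> g \<in> L2 M \<and>
     ((\<lambda>s. L2norm M (\<lambda>x. (f s x - f t x) /\<^sub>R (s - t) - g x)) \<longlongrightarrow> 0) (at t within {0..})"

definition C1_L2 :: "'a measure \<Rightarrow> (real \<Rightarrow> 'a \<Rightarrow> 'b::real_normed_vector) \<Rightarrow> bool" where
  "C1_L2 M f \<longleftrightarrow> (\<forall>t\<ge>0. f t \<in> L2 M) \<and>
     (\<exists>g. \<forall>t\<ge>0. has_L2_derivative M f (g t) t \<and>
        ((\<lambda>s. L2norm M (\<lambda>x. g s x - g t x)) \<longlongrightarrow> 0) (at t within {0..}))"

text \<open>Test functions: continuously differentiable with compact support in \<open>U\<close>.\<close>

definition C1c :: "'a::euclidean_space set \<Rightarrow> ('a \<Rightarrow> 'b::real_normed_vector) set" where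
  "C1c U = {\<phi>. (\<forall>x. \<phi> differentiable (at x)) \<and>
               (\<forall>v. continuous_on UNIV (\<lambda>x. frechet_derivative \<phi> (at x) v)) \<and>
               (\<exists>K. compact K \<and> K \<subseteq> U \<and> (\<forall>x. x \<notin> K \<longrightarrow> \<phi> x = 0))}"

abbreviation unit_int :: "real measure" where
  "unit_int \<equiv> lebesgue_on {0<..<1}"

definition is_weak_deriv :: "(real \<Rightarrow> complex^'k) \<Rightarrow> (real \<Rightarrow> complex^'k) \<Rightarrow> bool" where
  "is_weak_deriv f g \<longleftrightarrow> (\<forall>\<phi> \<in> C1c {0<..<1}.
     (\<integral>x. deriv \<phi> x *\<^sub>R f x \<partial>unit_int) = - (\<integral>x. \<phi> x *\<^sub>R g x \<partial>unit_int))"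

definition H1 :: "(real \<Rightarrow> complex^'k) set" where
  "H1 = {f \<in> L2 unit_int. \<exists>g \<in> L2 unit_int. is_weak_deriv f g}"

definition wderiv :: "(real \<Rightarrow> complex^'k) \<Rightarrow> real \<Rightarrow> complex^'k" where
  "wderiv f = (SOME g. g \<in> L2 unit_int \<and> is_weak_deriv f g)"

text \<open>Point values of an \<open>H\<^sup>1\<close> function on \<open>[0, 1]\<close> are those of its continuous representative.\<close>

definition cont_rep :: "(real \<Rightarrow> complex^'k) \<Rightarrow> real \<Rightarrow> complex^'k" where
  "cont_rep f = (SOME g. continuous_on {0..1} g \<and> (AE x in unit_int. g x = f x))"

definition pderiv3 :: "3 \<Rightarrow> (real^3 \<Rightarrow> complex^3) \<Rightarrow> real^3 \<Rightarrow> complex^3" where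
  "pderiv3 j \<phi> x = frechet_derivative \<phi> (at x) (axis j 1)"

definition rot :: "(real^3 \<Rightarrow> complex^3) \<Rightarrow> real^3 \<Rightarrow> complex^3" where
  "rot \<phi> x = vector [pderiv3 2 \<phi> x $ 3 - pderiv3 3 \<phi> x $ 2,
                     pderiv3 3 \<phi> x $ 1 - pderiv3 1 \<phi> x $ 3,
                     pderiv3 1 \<phi> x $ 2 - pderiv3 2 \<phi> x $ 1]"

definition is_weak_rot ::
  "(real^3) set \<Rightarrow> (real^3 \<Rightarrow> complex^3) \<Rightarrow> (real^3 \<Rightarrow> complex^3) \<Rightarrow> bool" where
  "is_weak_rot \<Omega> F G \<longleftrightarrow> (\<forall>\<phi> \<in> C1c \<Omega>.
     (\<integral>x. cdot (F x) (rot \<phi> x) \<partial>lebesgue_on \<Omega>) = (\<integral>x. cdot (G x) (\<phi> x) \<partial>lebesgue_on \<Omega>))"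

definition Hrot :: "(real^3) set \<Rightarrow> (real^3 \<Rightarrow> complex^3) set" where
  "Hrot \<Omega> = {F \<in> L2 (lebesgue_on \<Omega>). \<exists>G \<in> L2 (lebesgue_on \<Omega>). is_weak_rot \<Omega> F G}"

definition wrot :: "(real^3) set \<Rightarrow> (real^3 \<Rightarrow> complex^3) \<Rightarrow> real^3 \<Rightarrow> complex^3" where
  "wrot \<Omega> F = (SOME G. G \<in> L2 (lebesgue_on \<Omega>) \<and> is_weak_rot \<Omega> F G)"

section \<open>Lipschitz domains, surface measure, tangential traces\<close>

definition lipschitz_domain :: "(real^3) set \<Rightarrow> bool" where
  "lipschitz_domain \<Omega> \<longleftrightarrow> open \<Omega> \<and> connected \<Omega> \<and> \<Omega> \<noteq> {} \<and>
     (\<forall>p \<in> frontier \<Omega>. \<exists>U (Q :: real^3 \<Rightarrow> real^3) (\<gamma> :: real \<times> real \<Rightarrow> real) K.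
        open U \<and> p \<in> U \<and> orthogonal_transformation Q \<and> K-lipschitz_on UNIV \<gamma> \<and>
        \<Omega> \<inter> U = {x \<in> U. Q x $ 3 < \<gamma> (Q x $ 1, Q x $ 2)})"

text \<open>
  \<open>n\<close> is the outer unit normal of \<open>\<Omega>\<close> at \<open>\<xi>\<close>: outside every double cone around the plane through
  \<open>\<xi>\<close> orthogonal to \<open>n\<close>, the set \<open>\<Omega>\<close> coincides near \<open>\<xi>\<close> with the half-space opposite to \<open>n\<close>. For a
  Lipschitz domain this is the usual normal at every point where the graph is differentiable.
\<close>

definition is_outer_normal :: "(real^3) set \<Rightarrow> real^3 \<Rightarrow> real^3 \<Rightarrow> bool" where
  "is_outer_normal \<Omega> \<xi> n \<longleftrightarrow> norm n = 1 \<and>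
     (\<forall>\<epsilon>>0. \<exists>\<delta>>0. \<forall>x \<in> ball \<xi> \<delta>.
        (inner (x - \<xi>) n < - \<epsilon> * norm (x - \<xi>) \<longrightarrow> x \<in> \<Omega>) \<and>
        (inner (x - \<xi>) n > \<epsilon> * norm (x - \<xi>) \<longrightarrow> x \<notin> \<Omega>))"

definition outer_normal :: "(real^3) set \<Rightarrow> real^3 \<Rightarrow> real^3" where
  "outer_normal \<Omega> \<xi> = (THE n. is_outer_normal \<Omega> \<xi> n)"

text \<open>
  Surface measure of a (Lipschitz) surface \<open>S\<close>, extended by \<open>0\<close> to the Borel sets of space: in every
  injective Lipschitz parametrization \<open>\<phi>\<close> of a part of \<open>S\<close>, area is the integral of
  \<open>\<parallel>\<partial>\<^sub>1\<phi> \<times> \<partial>\<^sub>2\<phi>\<parallel>\<close>. If \<open>S\<close> is covered by such parametrizations, as the frontier of a Lipschitz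
  domain is, then exactly one measure has this property, the two-dimensional Hausdorff measure on \<open>S\<close>.
\<close>

definition area_elem :: "(real \<times> real \<Rightarrow> real^3) \<Rightarrow> real \<times> real \<Rightarrow> real" where
  "area_elem \<phi> x = norm (cross3 (frechet_derivative \<phi> (at x) (1, 0))
                               (frechet_derivative \<phi> (at x) (0, 1)))"

definition surface_measure :: "(real^3) set \<Rightarrow> (real^3) measure \<Rightarrow> bool" where
  "surface_measure S M \<longleftrightarrow> sets M = sets borel \<and> emeasure M (- S) = 0 \<and>
     (\<forall>U \<phi> K. open U \<and> inj_on \<phi> U \<and> K-lipschitz_on U \<phi> \<and> \<phi> ` U \<subseteq> S \<longrightarrow>
        (\<forall>A \<in> sets borel. A \<subseteq> U \<longrightarrow>
           emeasure M (\<phi> ` A) = (\<integral>\<^sup>+ x. ennreal (area_elem \<phi> x) * indicator A x \<partial>lborel)))"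

definition tan_proj :: "(real^3) set \<Rightarrow> real^3 \<Rightarrow> complex^3 \<Rightarrow> complex^3" where
  "tan_proj \<Omega> \<xi> w =
     ccross (ccross (cvec (outer_normal \<Omega> \<xi>)) w) (cvec (outer_normal \<Omega> \<xi>))"

text \<open>
  The \<open>L\<^sup>2\<close> tangential traces \<open>\<pi>\<^sub>\<tau> F\<close> and \<open>\<nu> \<times> F\<close> of a field with weak rotation in \<open>L\<^sup>2\<close>: the
  tangential fields for which the integration by parts formula holds against smooth fields. Here
  \<open>M\<close> is the surface measure on the boundary of \<open>\<Omega>\<close>.
\<close>

definition tangential :: "(real^3) set \<Rightarrow> (real^3) measure \<Rightarrow> (real^3 \<Rightarrow> complex^3) \<Rightarrow> bool" where
  "tangential \<Omega> M g \<longleftrightarrow> (AE \<xi> in M. cdot (cvec (outer_normal \<Omega> \<xi>)) (g \<xi>) = 0)"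

definition is_proj_trace ::
  "(real^3) set \<Rightarrow> (real^3) measure \<Rightarrow> (real^3 \<Rightarrow> complex^3) \<Rightarrow> (real^3 \<Rightarrow> complex^3) \<Rightarrow> bool" where
  "is_proj_trace \<Omega> M F g \<longleftrightarrow> g \<in> L2 M \<and> tangential \<Omega> M g \<and> (\<forall>\<phi> \<in> C1c UNIV.
     (\<integral>x. - cdot (wrot \<Omega> F x) (\<phi> x) + cdot (F x) (rot \<phi> x) \<partial>lebesgue_on \<Omega>) =
     (\<integral>\<xi>. cdot (g \<xi>) (ccross (cvec (outer_normal \<Omega> \<xi>)) (\<phi> \<xi>)) \<partial>M))"

definition is_cross_trace ::
  "(real^3) set \<Rightarrow> (real^3) measure \<Rightarrow> (real^3 \<Rightarrow> complex^3) \<Rightarrow> (real^3 \<Rightarrow> complex^3) \<Rightarrow> bool" where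
  "is_cross_trace \<Omega> M F h \<longleftrightarrow> h \<in> L2 M \<and> tangential \<Omega> M h \<and> (\<forall>\<phi> \<in> C1c UNIV.
     (\<integral>x. - cdot (rot \<phi> x) (F x) + cdot (\<phi> x) (wrot \<Omega> F x) \<partial>lebesgue_on \<Omega>) =
     (\<integral>\<xi>. cdot (tan_proj \<Omega> \<xi> (\<phi> \<xi>)) (h \<xi>) \<partial>M))"

definition proj_trace ::
  "(real^3) set \<Rightarrow> (real^3) measure \<Rightarrow> (real^3 \<Rightarrow> complex^3) \<Rightarrow> real^3 \<Rightarrow> complex^3" where
  "proj_trace \<Omega> M F = (SOME g. is_proj_trace \<Omega> M F g)"

definition cross_trace ::
  "(real^3) set \<Rightarrow> (real^3) measure \<Rightarrow> (real^3 \<Rightarrow> complex^3) \<Rightarrow> real^3 \<Rightarrow> complex^3" where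
  "cross_trace \<Omega> M F = (SOME h. is_cross_trace \<Omega> M F h)"

section \<open>Cables\<close>

record cable =
  radius :: real
  len :: real
  curve :: "real \<Rightarrow> real^3"
  kap1 :: "real \<Rightarrow> real^3"
  kap2 :: "real \<Rightarrow> real^3"

text \<open>Derivatives on \<open>[0, 1]\<close> are one-sided at the end points.\<close>

definition deriv01 :: "(real \<Rightarrow> real^3) \<Rightarrow> real \<Rightarrow> real^3" where
  "deriv01 f \<eta> = vector_derivative f (at \<eta> within {0..1})"

definition C1_on01 :: "(real \<Rightarrow> real^3) \<Rightarrow> bool" where
  "C1_on01 f \<longleftrightarrow> (\<forall>\<eta> \<in> {0..1}. f differentiable (at \<eta> within {0..1})) \<and>
                 continuous_on {0..1} (deriv01 f)"

definition beta :: "cable \<Rightarrow> real \<Rightarrow> real \<Rightarrow> real^3" where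
  "beta c \<eta> \<theta> = radius c *\<^sub>R (sin \<theta> *\<^sub>R kap1 c \<eta> + cos \<theta> *\<^sub>R kap2 c \<eta>)"

definition Phi :: "cable \<Rightarrow> real \<times> real \<Rightarrow> real^3" where
  "Phi c = (\<lambda>(\<eta>, \<theta>). curve c \<eta> + beta c \<eta> \<theta>)"

definition body :: "cable \<Rightarrow> (real^3) set" where
  "body c = {curve c \<eta> + \<delta> *\<^sub>R beta c \<eta> \<theta> | \<delta> \<eta> \<theta>.
               \<delta> \<in> {0..1} \<and> \<eta> \<in> {0..1} \<and> \<theta> \<in> {-pi<..pi}}"

definition lat_surface :: "cable \<Rightarrow> (real^3) set" where
  "lat_surface c = Phi c ` ({0<..<1} \<times> {-pi<..pi})"

definition end_surface :: "cable \<Rightarrow> (real^3) set" where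
  "end_surface c = {curve c \<eta> + \<delta> *\<^sub>R beta c \<eta> \<theta> | \<delta> \<eta> \<theta>.
               \<delta> \<in> {0..1} \<and> \<eta> \<in> {0, 1} \<and> \<theta> \<in> {-pi<..pi}}"

definition cable_ok :: "cable \<Rightarrow> bool" where
  "cable_ok c \<longleftrightarrow>
     radius c > 0 \<and> len c > 0 \<and>
     C1_on01 (curve c) \<and> C1_on01 (deriv01 (curve c)) \<and>
     C1_on01 (kap1 c) \<and> C1_on01 (kap2 c) \<and>
     (\<forall>\<eta> \<in> {0..1}.
        norm (deriv01 (curve c) \<eta>) = len c \<and>
        norm (deriv01 (deriv01 (curve c)) \<eta>) < (len c)\<^sup>2 / radius c \<and>
        norm (kap1 c \<eta>) = 1 \<and> norm (kap2 c \<eta>) = 1 \<and>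
        inner (deriv01 (curve c) \<eta>) (kap1 c \<eta>) = 0 \<and>
        inner (deriv01 (curve c) \<eta>) (kap2 c \<eta>) = 0 \<and>
        inner (kap1 c \<eta>) (kap2 c \<eta>) = 0 \<and>
        Determinants.det (Finite_Cartesian_Product.transpose
          (vector [deriv01 (curve c) \<eta>, kap1 c \<eta>, kap2 c \<eta>] :: real^3^3)) = len c) \<and>
     inj_on (Phi c) ({0..1} \<times> {-pi<..pi}) \<and>
     frontier (body c) = lat_surface c \<union> end_surface c \<and>
     lat_surface c \<inter> end_surface c = {}"

definition outer_region :: "(real^3) set \<Rightarrow> ('k \<Rightarrow> cable) \<Rightarrow> (real^3) set" where
  "outer_region \<Omega>0 c = \<Omega>0 - (\<Union>i. closure (body (c i)))"

definition geometry :: "(real^3) set \<Rightarrow> ('k::finite \<Rightarrow> cable) \<Rightarrow> bool" where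
  "geometry \<Omega>0 c \<longleftrightarrow>
     (\<forall>i. cable_ok (c i)) \<and>
     lipschitz_domain \<Omega>0 \<and> lipschitz_domain (outer_region \<Omega>0 c) \<and>
     (\<forall>i. closure (body (c i)) \<subseteq> \<Omega>0) \<and>
     (\<forall>i j. i \<noteq> j \<longrightarrow> closure (body (c i)) \<inter> closure (body (c j)) = {})"

section \<open>Coupling operators\<close>

definition beta' :: "cable \<Rightarrow> real \<Rightarrow> real \<Rightarrow> real^3" where
  "beta' c \<eta> \<theta> = vector_derivative (beta c \<eta>) (at \<theta>)"

definition P_mag ::
  "(real^3) set \<Rightarrow> ('k::finite \<Rightarrow> cable) \<Rightarrow> (real^3 \<Rightarrow> complex^3) \<Rightarrow> real \<Rightarrow> complex^'k" where
  "P_mag \<Omega> c g \<eta> = (\<chi> i. LINT \<theta>:{-pi..pi}|lborel.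
     (let \<xi> = Phi (c i) (\<eta>, \<theta>)
      in \<Sum>j\<in>UNIV. ccross (g \<xi>) (cvec (outer_normal \<Omega> \<xi>)) $ j * of_real (beta' (c i) \<eta> \<theta> $ j)))"

definition grad_Phi :: "cable \<Rightarrow> real \<times> real \<Rightarrow> real^3^2" where
  "grad_Phi c = (\<lambda>(\<eta>, \<theta>). vector [vector_derivative (\<lambda>s. Phi c (s, \<theta>)) (at \<eta>),
                                   vector_derivative (\<lambda>s. Phi c (\<eta>, s)) (at \<theta>)])"

definition Psi :: "cable \<Rightarrow> real^3 \<Rightarrow> real \<times> real" where
  "Psi c = inv_into ({0<..<1} \<times> {-pi<..pi}) (Phi c)"

text \<open>The value is only relevant on the (pairwise disjoint) lateral surfaces.\<close>

definition P_el :: "('k::finite \<Rightarrow> cable) \<Rightarrow> (real \<Rightarrow> complex^'k) \<Rightarrow> real^3 \<Rightarrow> complex^3" where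
  "P_el c f \<xi> = (let i = (THE i. \<xi> \<in> lat_surface (c i)) in
     pinv (cmat (grad_Phi (c i) (Psi (c i) \<xi>))) *v vector [f (fst (Psi (c i) \<xi>)) $ i, 0])"

section \<open>Parameters and energy\<close>

definition line_params ::
  "(real \<Rightarrow> complex^'k^'k) \<Rightarrow> (real \<Rightarrow> complex^'k^'k) \<Rightarrow>
   (real \<Rightarrow> complex^'k^'k) \<Rightarrow> (real \<Rightarrow> complex^'k^'k) \<Rightarrow> bool" where
  "line_params C L R G \<longleftrightarrow>
     ess_bounded unit_int C \<and> ess_bounded unit_int L \<and>
     ess_bounded unit_int R \<and> ess_bounded unit_int G \<and>
     (AE \<eta> in unit_int. pd (C \<eta>) \<and> pd (L \<eta>) \<and>
        psd (R \<eta> + adj (R \<eta>)) \<and> psd (G \<eta> + adj (G \<eta>))) \<and>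
     ess_bounded unit_int (\<lambda>\<eta>. matrix_inv (C \<eta>)) \<and>
     ess_bounded unit_int (\<lambda>\<eta>. matrix_inv (L \<eta>))"

definition maxwell_params ::
  "(real^3) set \<Rightarrow> (real^3 \<Rightarrow> complex^3^3) \<Rightarrow> (real^3 \<Rightarrow> complex^3^3) \<Rightarrow>
   (real^3 \<Rightarrow> complex^3^3) \<Rightarrow> bool" where
  "maxwell_params \<Omega> eps mu sig \<longleftrightarrow>
     ess_bounded (lebesgue_on \<Omega>) eps \<and> ess_bounded (lebesgue_on \<Omega>) mu \<and>
     ess_bounded (lebesgue_on \<Omega>) sig \<and>
     (AE \<xi> in lebesgue_on \<Omega>. pd (eps \<xi>) \<and> pd (mu \<xi>) \<and> psd (sig \<xi> + adj (sig \<xi>))) \<and>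
     ess_bounded (lebesgue_on \<Omega>) (\<lambda>\<xi>. matrix_inv (eps \<xi>)) \<and>
     ess_bounded (lebesgue_on \<Omega>) (\<lambda>\<xi>. matrix_inv (mu \<xi>))"

text \<open>The boundary data \<open>(V(0), V(1), I(0), - I(1))\<close>.\<close>

definition port_vec :: "(real \<Rightarrow> complex^'k) \<Rightarrow> (real \<Rightarrow> complex^'k) \<Rightarrow> complex Matrix.vec" where
  "port_vec V I = coords (cont_rep V 0) @\<^sub>v coords (cont_rep V 1) @\<^sub>v
                  coords (cont_rep I 0) @\<^sub>v coords (- cont_rep I 1)"

text \<open>The integrands are real because the weights are Hermitian; \<^const>\<open>Re\<close> only adjusts the type.\<close>

definition energy ::
  "(real^3) set \<Rightarrow> (real \<Rightarrow> complex^'k^'k) \<Rightarrow> (real \<Rightarrow> complex^'k^'k) \<Rightarrow>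
   (real^3 \<Rightarrow> complex^3^3) \<Rightarrow> (real^3 \<Rightarrow> complex^3^3) \<Rightarrow>
   (real \<Rightarrow> complex^'k) \<Rightarrow> (real \<Rightarrow> complex^'k) \<Rightarrow>
   (real^3 \<Rightarrow> complex^3) \<Rightarrow> (real^3 \<Rightarrow> complex^3) \<Rightarrow> real" where
  "energy \<Omega> C L eps mu \<psi> q B D =
     1/2 * (\<integral>\<eta>. Re (cdot (\<psi> \<eta>) (matrix_inv (L \<eta>) *v \<psi> \<eta>) +
                     cdot (q \<eta>) (matrix_inv (C \<eta>) *v q \<eta>)) \<partial>unit_int) +
     1/2 * (\<integral>\<xi>. Re (cdot (B \<xi>) (matrix_inv (mu \<xi>) *v B \<xi>) +
                     cdot (D \<xi>) (matrix_inv (eps \<xi>) *v D \<xi>)) \<partial>lebesgue_on \<Omega>)"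

end

theory Submission
  imports Defs
begin

text \<open>
  The time derivative of the energy is the power that the effort fields \<open>I - I\<^sub>e\<^sub>x\<^sub>t\<close>, \<open>V\<close>, \<open>H\<close>, \<open>E\<close> supply to the
  right-hand sides of the four evolution equations: the weights are Hermitian and bounded, so the
  quadratic form may be differentiated in \<open>L\<^sup>2\<close> (\<open>L2_energy_derivative\<close>). The terms with \<open>R\<close>, \<open>G\<close> and
  \<open>\<sigma>\<close> have a sign. What remains consists of three exchanges of power.

  Along the line, \<open>- \<integral> I \<bullet> V' + V \<bullet> I'\<close> is a boundary term at the ends of the unit interval
  (\<open>H1_integration_by_parts\<close>), and the matrix inequality behind co-location bounds it by
  \<open>Re (u\<^sup>* y)\<close> (\<open>port_vec_passive\<close>). It comes with the extra term \<open>\<integral> I\<^sub>e\<^sub>x\<^sub>t \<bullet> V'\<close>, because the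
  effort of the inductances is \<open>I - I\<^sub>e\<^sub>x\<^sub>t\<close> and not \<open>I\<close>.

  In the field, the assumed integration by parts formula turns \<open>\<integral> E \<bullet> rot H - H \<bullet> rot E\<close> into the
  surface integral of \<open>(\<pi>\<^sub>\<tau> E)\<^sup>* (\<nu> \<times> H)\<close>. The boundary conditions leave only the lateral surfaces of
  the cables, where \<open>\<pi>\<^sub>\<tau> E = P\<^sub>e\<^sub>l V'\<close>.

  The two coupling operators are adjoint: the surface integral of \<open>(P\<^sub>e\<^sub>l f)\<^sup>* h\<close> equals
  \<open>\<integral> f\<^sup>* P\<^sub>m\<^sub>a\<^sub>g h\<close> (\<open>boundary_power\<close>). As \<open>P\<^sub>m\<^sub>a\<^sub>g (\<nu> \<times> H) = - I\<^sub>e\<^sub>x\<^sub>t\<close>, the surface integral has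
  real part \<open>- \<integral> I\<^sub>e\<^sub>x\<^sub>t \<bullet> V'\<close> and cancels the extra term of the line.

  The adjointness is a pointwise identity. Let \<open>T\<close> and \<open>b\<close> be the derivatives of \<open>\<Phi>\<close> in \<open>\<eta>\<close> and \<open>\<theta>\<close>,
  let \<open>\<nu> = - \<beta> / r\<close>, and let \<open>J = \<parallel>T \<times> b\<parallel>\<close>. Then \<open>T \<times> b = - J \<nu>\<close>, the pseudoinverse gives
  \<open>P\<^sub>e\<^sub>l f = (f / J) (\<nu> \<times> b)\<close>, and hence \<open>J (P\<^sub>e\<^sub>l f) \<bullet> h = f (h \<times> \<nu>) \<bullet> b\<close>, the integrand of \<open>P\<^sub>m\<^sub>a\<^sub>g\<close>
  (\<open>coupling_pointwise\<close>). Two facts make it usable: the normal that is defined by cones really is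
  \<open>- \<beta> / r\<close> (\<open>outer_normal_lat\<close>), and the surface measure really has the density \<open>J\<close>
  in the chart \<open>\<Phi>\<close> (\<open>surface_distr\<close>).
\<close>

section \<open>Real inner products and matrices\<close>

text \<open>
  Energies and powers are real parts of \<^const>\<open>cdot\<close>, so the balance can be computed with the
  real inner product, and its library applies.
\<close>

lemma Re_cdot: "Re (cdot v w) = inner v w"
  by (simp add: cdot_def inner_vec_def inner_complex_def)

lemma bounded_bilinear_cdot: "bounded_bilinear (cdot :: complex^'n \<Rightarrow> complex^'n \<Rightarrow> complex)"
proof -
  have "bilinear (cdot :: complex^'n \<Rightarrow> complex^'n \<Rightarrow> complex)"
    unfolding bilinear_def cdot_def
    by (auto intro!: linearI simp: sum.distrib algebra_simps scaleR_sum_right)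
  then show ?thesis by (simp add: bilinear_conv_bounded_bilinear)
qed

interpretation cdot: bounded_bilinear cdot by (rule bounded_bilinear_cdot)

lemma bounded_bilinear_matvec:
  "bounded_bilinear ((*v) :: complex^'n^'m \<Rightarrow> complex^'n \<Rightarrow> complex^'m)"
proof -
  have "bilinear ((*v) :: complex^'n^'m \<Rightarrow> complex^'n \<Rightarrow> complex^'m)"
    unfolding bilinear_def
    by (auto intro!: linearI simp: vec_eq_iff matrix_vector_mult_def sum.distrib algebra_simps scaleR_sum_right)
  then show ?thesis by (simp add: bilinear_conv_bounded_bilinear)
qed

interpretation matvec: bounded_bilinear "(*v) :: complex^'n^'m \<Rightarrow> complex^'n \<Rightarrow> complex^'m"
  by (rule bounded_bilinear_matvec)

lemma cdot_adj: "cdot (adj A *v v) w = cdot v (A *v w)"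
  unfolding cdot_def adj_def matrix_vector_mult_def
  by (simp add: sum_distrib_left sum_distrib_right cnj_sum, subst sum.swap) (simp add: algebra_simps)

lemma inner_adj: "inner (adj A *v v) w = inner v (A *v w)"
  by (metis Re_cdot cdot_adj)

lemma adj_matrix_mult: "adj (A ** B) = adj B ** adj A"
  by (simp add: adj_def matrix_matrix_mult_def vec_eq_iff cnj_sum mult.commute)

lemma adj_mat_1: "adj (mat 1) = (mat 1 :: complex^'n^'n)"
  by (simp add: adj_def mat_def vec_eq_iff)

lemma pd_invertible:
  fixes A :: "complex^'n^'n"
  assumes "pd A" shows "invertible A"
proof -
  have "x = 0" if "A *v x = 0" for x
  proof (rule ccontr)
    assume "x \<noteq> 0"
    then have "0 < Re (cdot x (A *v x))" using assms by (auto simp: pd_def)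
    then show False using that by (simp add: cdot.zero_right)
  qed
  then show ?thesis
    by (simp add: invertible_left_inverse matrix_left_invertible_ker)
qed

lemma adj_matrix_inv:
  fixes A :: "complex^'n^'n"
  assumes "pd A" shows "adj (matrix_inv A) = matrix_inv A"
proof -
  have h: "adj A = A" using assms by (simp add: pd_def)
  have inv: "A ** matrix_inv A = mat 1" "matrix_inv A ** A = mat 1"
    using someI_ex[OF pd_invertible[OF assms, unfolded invertible_def]] by (auto simp: matrix_inv_def)
  have "adj (matrix_inv A) ** A = mat 1"
    by (metis inv(1) adj_matrix_mult adj_mat_1 h)
  then show ?thesis
    by (metis inv(1) matrix_mul_assoc matrix_mul_lid matrix_mul_rid)
qed

lemma psd_add_adj_nonneg:
  assumes "psd (A + adj A)" shows "0 \<le> inner x (A *v x)"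
proof -
  have "0 \<le> inner x ((A + adj A) *v x)" using assms by (simp add: psd_def Re_cdot)
  moreover have "inner x (adj A *v x) = inner x (A *v x)"
    by (metis inner_adj inner_commute)
  ultimately show ?thesis by (simp add: matvec.add_left inner_add_right)
qed

section \<open>Square-integrable functions\<close>

lemma L2_measurable: "f \<in> L2 M \<Longrightarrow> f \<in> borel_measurable M"
  and L2_integrable: "f \<in> L2 M \<Longrightarrow> integrable M (\<lambda>x. (norm (f x))\<^sup>2)"
  by (auto simp: L2_def)

lemma L2_bound:
  fixes f :: "'a \<Rightarrow> 'b::{real_normed_vector, second_countable_topology}" 
  assumes "f \<in> borel_measurable M" "integrable M h" "AE x in M. (norm (f x))\<^sup>2 \<le> h x"
  shows "f \<in> L2 M"
proof -
  have "integrable M (\<lambda>x. (norm (f x))\<^sup>2)"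
    by (rule Bochner_Integration.integrable_bound[OF assms(2)])
       (use assms in \<open>auto elim!: eventually_mono\<close>)
  then show ?thesis using assms(1) by (simp add: L2_def)
qed

lemma norm_add_square_le:
  fixes a b :: "'b::real_normed_vector"
  shows "(norm (a + b))\<^sup>2 \<le> 2 * (norm a)\<^sup>2 + 2 * (norm b)\<^sup>2"
proof -
  have "(norm (a + b))\<^sup>2 \<le> (norm a + norm b)\<^sup>2"
    by (intro power_mono norm_triangle_ineq norm_ge_zero)
  also have "\<dots> \<le> 2 * (norm a)\<^sup>2 + 2 * (norm b)\<^sup>2"
    using sum_squares_bound[of "norm a" "norm b"] by (simp add: power2_sum)
  finally show ?thesis .
qed

lemma L2_add:
  fixes f g :: "'a \<Rightarrow> 'b::{real_normed_vector, second_countable_topology}"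
  assumes "f \<in> L2 M" "g \<in> L2 M" shows "(\<lambda>x. f x + g x) \<in> L2 M"
  by (rule L2_bound[where h="\<lambda>x. 2 * (norm (f x))\<^sup>2 + 2 * (norm (g x))\<^sup>2"])
     (use assms in \<open>auto simp: L2_def norm_add_square_le\<close>)

lemma L2_scaleR:
  fixes f :: "'a \<Rightarrow> 'b::{real_normed_vector, second_countable_topology}"
  assumes "f \<in> L2 M" shows "(\<lambda>x. c *\<^sub>R f x) \<in> L2 M"
  using assms by (auto simp: L2_def power_mult_distrib)

lemma L2_uminus:
  fixes f :: "'a \<Rightarrow> 'b::{real_normed_vector, second_countable_topology}"
  assumes "f \<in> L2 M" shows "(\<lambda>x. - f x) \<in> L2 M"
  using assms by (auto simp: L2_def)

lemma L2_diff:
  fixes f g :: "'a \<Rightarrow> 'b::{real_normed_vector, second_countable_topology}"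
  assumes "f \<in> L2 M" "g \<in> L2 M" shows "(\<lambda>x. f x - g x) \<in> L2 M"
  using L2_add[OF assms(1) L2_uminus[OF assms(2)]] by simp

lemma L2_matvec:
  fixes A :: "'a \<Rightarrow> complex^'n^'m"
  assumes "ess_bounded M A" "f \<in> L2 M" shows "(\<lambda>x. A x *v f x) \<in> L2 M"
proof -
  from assms(1) obtain K where A: "A \<in> borel_measurable M" and K: "AE x in M. norm (A x) \<le> K"
    by (auto simp: ess_bounded_def)
  obtain c where c: "\<And>(B :: complex^'n^'m) v. norm (B *v v) \<le> norm B * norm v * c" "c > 0"
    using matvec.pos_bounded by blast
  have f: "f \<in> borel_measurable M" using assms(2) by (rule L2_measurable)
  show ?thesis
  proof (rule L2_bound[where h="\<lambda>x. (K * c)\<^sup>2 * (norm (f x))\<^sup>2"])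
    show "(\<lambda>x. A x *v f x) \<in> borel_measurable M"
      by (rule borel_measurable_continuous_Pair[OF A f])
         (intro matvec.continuous_on continuous_intros)
    show "AE x in M. (norm (A x *v f x))\<^sup>2 \<le> (K * c)\<^sup>2 * (norm (f x))\<^sup>2"
      using K
    proof eventually_elim
      case (elim x)
      have "norm (A x *v f x) \<le> norm (A x) * norm (f x) * c" by (rule c)
      also have "\<dots> \<le> K * norm (f x) * c"
        using elim c(2) by (intro mult_right_mono) auto
      finally have "norm (A x *v f x) \<le> (K * c) * norm (f x)" by (simp add: mult_ac)
      then have "(norm (A x *v f x))\<^sup>2 \<le> ((K * c) * norm (f x))\<^sup>2"
        by (intro power_mono) auto
      then show ?case by (simp add: power_mult_distrib)
    qed
  qed (use assms(2) in \<open>simp add: L2_integrable\<close>)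
qed

lemma integrable_L2_product:
  fixes f :: "'a \<Rightarrow> 'b::{real_normed_vector, second_countable_topology}"
    and g :: "'a \<Rightarrow> 'c::{real_normed_vector, second_countable_topology}"
    and p :: "'b \<Rightarrow> 'c \<Rightarrow> 'd::{banach, second_countable_topology}"
  assumes "bounded_bilinear p" and f: "f \<in> L2 M" and g: "g \<in> L2 M"
  shows "integrable M (\<lambda>x. p (f x) (g x))"
proof -
  interpret p: bounded_bilinear p by fact
  obtain c where c: "\<And>a b. norm (p a b) \<le> norm a * norm b * c" "c > 0"
    using p.pos_bounded by blast
  show ?thesis
  proof (rule Bochner_Integration.integrable_bound)
    show "integrable M (\<lambda>x. c * ((norm (f x))\<^sup>2 + (norm (g x))\<^sup>2))"
      using f g by (simp add: L2_integrable)
    show "(\<lambda>x. p (f x) (g x)) \<in> borel_measurable M"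
      by (rule borel_measurable_continuous_Pair[OF L2_measurable[OF f] L2_measurable[OF g]])
         (intro p.continuous_on continuous_intros)
    show "AE x in M. norm (p (f x) (g x)) \<le> norm (c * ((norm (f x))\<^sup>2 + (norm (g x))\<^sup>2))"
    proof (rule AE_I2)
      fix x
      have "norm (p (f x) (g x)) \<le> c * (norm (f x) * norm (g x))" using c(1) by (simp add: mult_ac)
      also have "\<dots> \<le> c * ((norm (f x))\<^sup>2 + (norm (g x))\<^sup>2)"
        using c(2) sum_squares_bound[of "norm (f x)" "norm (g x)"]
        by (intro mult_left_mono) (auto intro: order_trans[rotated])
      finally show "norm (p (f x) (g x)) \<le> norm (c * ((norm (f x))\<^sup>2 + (norm (g x))\<^sup>2))"
        using c(2) by simp
    qed
  qed
qed

lemma integrable_inner_L2: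
  fixes f g :: "'a \<Rightarrow> 'b::euclidean_space"
  assumes "f \<in> L2 M" "g \<in> L2 M" shows "integrable M (\<lambda>x. inner (f x) (g x))"
  by (rule integrable_L2_product[OF bounded_bilinear_inner assms])

lemma L2norm_nonneg: "0 \<le> L2norm M f"
  by (simp add: L2norm_def)

lemma L2norm_square: "(L2norm M f)\<^sup>2 = (\<integral>x. (norm (f x))\<^sup>2 \<partial>M)"
  by (simp add: L2norm_def)

text \<open>
  The free weight \<open>c\<close> does the work of the Cauchy--Schwarz inequality: if the norm of \<open>g\<close> tends to \<open>0\<close>
  and \<open>c\<close> is a larger null function, then both terms tend to \<open>0\<close>.
\<close>

lemma L2_inner_bound:
  fixes f g :: "'a \<Rightarrow> 'b::euclidean_space"
  assumes f: "f \<in> L2 M" and g: "g \<in> L2 M" and c: "c > 0"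
  shows "2 * \<bar>\<integral>x. inner (f x) (g x) \<partial>M\<bar> \<le> c * (L2norm M f)\<^sup>2 + (L2norm M g)\<^sup>2 / c"
proof -
  have "\<bar>\<integral>x. inner (f x) (g x) \<partial>M\<bar> \<le> (\<integral>x. (c * (norm (f x))\<^sup>2 + (norm (g x))\<^sup>2 / c) / 2 \<partial>M)"
  proof (rule order_trans[OF integral_abs_bound], rule integral_mono)
    show "integrable M (\<lambda>x. \<bar>inner (f x) (g x)\<bar>)" using integrable_inner_L2[OF f g] by simp
    show "integrable M (\<lambda>x. (c * (norm (f x))\<^sup>2 + (norm (g x))\<^sup>2 / c) / 2)"
      using f g by (simp add: L2_integrable)
    fix x
    have "\<bar>inner (f x) (g x)\<bar> \<le> norm (f x) * norm (g x)" by (rule Cauchy_Schwarz_ineq2)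
    also have "\<dots> \<le> (c * (norm (f x))\<^sup>2 + (norm (g x))\<^sup>2 / c) / 2"
      using sum_squares_bound[of "sqrt c * norm (f x)" "norm (g x) / sqrt c"] c
      by (simp add: power_mult_distrib power_divide)
    finally show "\<bar>inner (f x) (g x)\<bar> \<le> (c * (norm (f x))\<^sup>2 + (norm (g x))\<^sup>2 / c) / 2" .
  qed
  also have "\<dots> = (c * (L2norm M f)\<^sup>2 + (L2norm M g)\<^sup>2 / c) / 2"
    using f g by (simp add: L2norm_square L2_integrable)
  finally show ?thesis by simp
qed

lemma L2_quadratic_bound:
  fixes A :: "'a \<Rightarrow> complex^'n^'n"
  assumes "ess_bounded M A"
  obtains K where "K \<ge> 0" "\<And>f. f \<in> L2 M \<Longrightarrow> \<bar>\<integral>x. inner (f x) (A x *v f x) \<partial>M\<bar> \<le> K * (L2norm M f)\<^sup>2"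
proof -
  from assms obtain K where A: "A \<in> borel_measurable M" and K: "AE x in M. norm (A x) \<le> K"
    by (auto simp: ess_bounded_def)
  obtain c where c: "\<And>(B :: complex^'n^'n) v. norm (B *v v) \<le> norm B * norm v * c" "c > 0"
    using matvec.pos_bounded by blast
  show ?thesis
  proof (rule that[of "\<bar>K\<bar> * c"])
    fix f :: "'a \<Rightarrow> complex^'n" assume f: "f \<in> L2 M"
    have "\<bar>\<integral>x. inner (f x) (A x *v f x) \<partial>M\<bar> \<le> (\<integral>x. (\<bar>K\<bar> * c) * (norm (f x))\<^sup>2 \<partial>M)"
    proof (rule order_trans[OF integral_abs_bound], rule integral_mono_AE)
      show "integrable M (\<lambda>x. \<bar>inner (f x) (A x *v f x)\<bar>)"
        using integrable_inner_L2[OF f L2_matvec[OF assms f]] by simp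
      show "integrable M (\<lambda>x. (\<bar>K\<bar> * c) * (norm (f x))\<^sup>2)" using f by (simp add: L2_integrable)
      show "AE x in M. \<bar>inner (f x) (A x *v f x)\<bar> \<le> (\<bar>K\<bar> * c) * (norm (f x))\<^sup>2"
        using K
      proof eventually_elim
        case (elim x)
        have "\<bar>inner (f x) (A x *v f x)\<bar> \<le> norm (f x) * norm (A x *v f x)"
          by (rule Cauchy_Schwarz_ineq2)
        also have "\<dots> \<le> norm (f x) * (norm (A x) * norm (f x) * c)"
          by (intro mult_left_mono c) auto
        also have "\<dots> \<le> norm (f x) * (\<bar>K\<bar> * norm (f x) * c)"
          using elim c(2) by (intro mult_left_mono mult_right_mono) auto
        finally show ?case by (simp add: power2_eq_square mult_ac)
      qed
    qed
    then show "\<bar>\<integral>x. inner (f x) (A x *v f x) \<partial>M\<bar> \<le> \<bar>K\<bar> * c * (L2norm M f)\<^sup>2"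
      by (simp add: L2norm_square)
  qed (use c in simp)
qed

text \<open>
  With the difference quotient \<open>d = (f s - f t) / (s - t)\<close>, symmetry of \<open>A\<close> makes the difference
  quotient of the quadratic form equal to \<open>2 (A f t) \<bullet> d + (s - t) d \<bullet> A d\<close> under the integral.
  Here \<open>d\<close> converges to \<open>g\<close> in \<open>L\<^sup>2\<close>, and the last term carries the factor \<open>s - t\<close>.
\<close>

lemma L2_energy_derivative:
  fixes A :: "'a \<Rightarrow> complex^'n^'n" and f :: "real \<Rightarrow> 'a \<Rightarrow> complex^'n"
  assumes A: "ess_bounded M A" and herm: "AE x in M. adj (A x) = A x"
    and f: "\<And>s. s \<ge> 0 \<Longrightarrow> f s \<in> L2 M" and deriv: "has_L2_derivative M f g t" and t: "t \<ge> 0"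
  shows "((\<lambda>s. \<integral>x. inner (f s x) (A x *v f s x) \<partial>M) has_real_derivative
          2 * (\<integral>x. inner (A x *v f t x) (g x) \<partial>M)) (at t within {0..})"
proof -
  let ?Q = "\<lambda>s. \<integral>x. inner (f s x) (A x *v f s x) \<partial>M"
  let ?D = "2 * (\<integral>x. inner (A x *v f t x) (g x) \<partial>M)"
  define e where "e = (\<lambda>s x. (f s x - f t x) /\<^sub>R (s - t) - g x)"
  let ?n = "\<lambda>s. L2norm M (e s)"
  have g: "g \<in> L2 M" and lim: "(?n \<longlongrightarrow> 0) (at t within {0..})"
    using deriv by (auto simp: has_L2_derivative_def e_def)
  have ft: "f t \<in> L2 M" using f t by blast
  obtain K where K: "K \<ge> 0"
    "\<And>f. f \<in> L2 M \<Longrightarrow> \<bar>\<integral>x. inner (f x) (A x *v f x) \<partial>M\<bar> \<le> K * (L2norm M f)\<^sup>2"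
    using L2_quadratic_bound[OF A] by blast
  let ?a = "L2norm M (\<lambda>x. A x *v f t x)"
  let ?b = "\<lambda>s. (?n s + \<bar>s - t\<bar>) * (?a\<^sup>2 + 1) + \<bar>s - t\<bar> * (K * (2 * (?n s)\<^sup>2 + 2 * (L2norm M g)\<^sup>2))"
  have est: "\<bar>(?Q s - ?Q t) / (s - t) - ?D\<bar> \<le> ?b s" if s: "s \<ge> 0" "s \<noteq> t" for s
  proof -
    have fs: "f s \<in> L2 M" using f s by blast
    have e: "e s \<in> L2 M" unfolding e_def
      by (intro L2_diff L2_scaleR fs ft g)
    define d where "d = (\<lambda>x. e s x + g x)"
    have d: "d \<in> L2 M" unfolding d_def by (intro L2_add e g)
    have fsd: "f s x = f t x + (s - t) *\<^sub>R d x" for x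
      using s by (simp add: d_def e_def)
    have i: "integrable M (\<lambda>x. inner (f t x) (A x *v f t x))"
      "integrable M (\<lambda>x. inner (A x *v f t x) (d x))"
      "integrable M (\<lambda>x. inner (d x) (A x *v d x))"
      "integrable M (\<lambda>x. inner (A x *v f t x) (e s x))" "integrable M (\<lambda>x. inner (A x *v f t x) (g x))"
      by (intro integrable_inner_L2 L2_matvec A ft d g e)+
    have "?Q s = (\<integral>x. inner (f t x) (A x *v f t x) + 2 * (s - t) * inner (A x *v f t x) (d x)
              + (s - t)\<^sup>2 * inner (d x) (A x *v d x) \<partial>M)"
    proof (rule integral_cong_AE)
      show "(\<lambda>x. inner (f s x) (A x *v f s x)) \<in> borel_measurable M"
        by (intro borel_measurable_integrable integrable_inner_L2 L2_matvec A fs)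
      show "(\<lambda>x. inner (f t x) (A x *v f t x) + 2 * (s - t) * inner (A x *v f t x) (d x)
              + (s - t)\<^sup>2 * inner (d x) (A x *v d x)) \<in> borel_measurable M"
        using i by (intro borel_measurable_add borel_measurable_times borel_measurable_const)
          (auto intro: borel_measurable_integrable)
      show "AE x in M. inner (f s x) (A x *v f s x) =
          inner (f t x) (A x *v f t x) + 2 * (s - t) * inner (A x *v f t x) (d x)
              + (s - t)\<^sup>2 * inner (d x) (A x *v d x)"
        using herm
      proof eventually_elim
        case (elim x)
        have "inner (f t x) (A x *v d x) = inner (A x *v f t x) (d x)"
          by (metis elim inner_adj)
        then show ?case
          by (simp add: fsd matvec.add_right matvec.scaleR_right inner_add_left inner_add_right
              inner_commute[of "d x" "A x *v f t x"] power2_eq_square algebra_simps)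
      qed
    qed
    also have "\<dots> = ?Q t + 2 * (s - t) * (\<integral>x. inner (A x *v f t x) (d x) \<partial>M)
        + (s - t)\<^sup>2 * (\<integral>x. inner (d x) (A x *v d x) \<partial>M)"
      using i by simp
    finally have "(?Q s - ?Q t) / (s - t) = 2 * (\<integral>x. inner (A x *v f t x) (d x) \<partial>M)
        + (s - t) * (\<integral>x. inner (d x) (A x *v d x) \<partial>M)"
      using s(2) by (simp add: field_simps power2_eq_square)
    also have "(\<integral>x. inner (A x *v f t x) (d x) \<partial>M) = (\<integral>x. inner (A x *v f t x) (e s x) \<partial>M)
         + (\<integral>x. inner (A x *v f t x) (g x) \<partial>M)"
      using i by (simp add: d_def inner_add_right)
    finally have "\<bar>(?Q s - ?Q t) / (s - t) - ?D\<bar> \<le> 2 * \<bar>\<integral>x. inner (A x *v f t x) (e s x) \<partial>M\<bar>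
         + \<bar>s - t\<bar> * \<bar>\<integral>x. inner (d x) (A x *v d x) \<partial>M\<bar>"
      by (simp add: abs_mult[symmetric])
    also have "\<dots> \<le> (?n s + \<bar>s - t\<bar>) * (?a\<^sup>2 + 1) + \<bar>s - t\<bar> * (K * (L2norm M d)\<^sup>2)"
    proof (intro add_mono mult_left_mono K d)
      let ?c = "?n s + \<bar>s - t\<bar>"
      have n: "0 \<le> ?n s" by (rule L2norm_nonneg)
      then have c: "?c > 0" using s(2) by simp
      have "(?n s)\<^sup>2 \<le> ?c * ?c" using n by (simp add: power2_eq_square mult_mono)
      then have "(?n s)\<^sup>2 / ?c \<le> ?c" using c by (simp add: divide_le_eq)
      then show "2 * \<bar>\<integral>x. inner (A x *v f t x) (e s x) \<partial>M\<bar> \<le> ?c * (?a\<^sup>2 + 1)"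
        using L2_inner_bound[OF L2_matvec[OF A ft] e c] by (simp add: distrib_left)
    qed simp
    also have "\<dots> \<le> ?b s"
    proof -
      have "(L2norm M d)\<^sup>2 \<le> (\<integral>x. 2 * (norm (e s x))\<^sup>2 + 2 * (norm (g x))\<^sup>2 \<partial>M)"
        unfolding L2norm_square using d e g
        by (intro integral_mono) (auto simp: d_def norm_add_square_le L2_integrable)
      also have "\<dots> = 2 * (?n s)\<^sup>2 + 2 * (L2norm M g)\<^sup>2"
        using e g by (simp add: L2norm_square L2_integrable)
      finally have "\<bar>s - t\<bar> * (K * (L2norm M d)\<^sup>2) \<le> \<bar>s - t\<bar> * (K * (2 * (?n s)\<^sup>2 + 2 * (L2norm M g)\<^sup>2))"
        using K(1) by (intro mult_left_mono) auto
      then show ?thesis by simp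
    qed
    finally show ?thesis .
  qed
  have "(?b \<longlongrightarrow> (0 + \<bar>t - t\<bar>) * (?a\<^sup>2 + 1) + \<bar>t - t\<bar> * (K * (2 * 0\<^sup>2 + 2 * (L2norm M g)\<^sup>2))) (at t within {0..})"
    by (intro tendsto_intros lim)
  then have b: "(?b \<longlongrightarrow> 0) (at t within {0..})" by simp
  have "((\<lambda>s. (?Q s - ?Q t) / (s - t) - ?D) \<longlongrightarrow> 0) (at t within {0..})"
    by (rule Lim_null_comparison[OF _ b])
       (use est in \<open>auto simp: eventually_at intro!: exI[of _ 1]\<close>)
  then show ?thesis
    by (simp add: has_field_derivative_iff Lim_null[symmetric])
qed

section \<open>Sobolev functions on the unit interval\<close>

interpretation unit_int: finite_measure unit_int
  by (rule finite_measureI) (simp add: emeasure_restrict_space)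

interpretation unit_pair: pair_sigma_finite unit_int unit_int ..

lemma AE_unit_intI:
  assumes "AE x in lborel. P x" shows "AE x in unit_int. P x"
proof -
  have "AE x in lebesgue. P x" using assms by (rule AE_completion)
  then show ?thesis by (subst AE_restrict_space_iff) (auto elim: eventually_mono)
qed

lemma AE_unit_int_neq: "AE s in unit_int. s \<noteq> x"
  by (rule AE_unit_intI) (rule AE_lborel_singleton)

lemma borel_measurable_unit_int: "f \<in> borel_measurable borel \<Longrightarrow> f \<in> borel_measurable unit_int"
  by (intro measurable_restrict_space1 measurable_completion) simp

text \<open>
  The primitive that vanishes at \<open>0\<close>. The indicator keeps the domain of integration fixed, as
  Fubini's theorem on the unit square requires.
\<close>

definition prim :: "(real \<Rightarrow> 'b::{banach, second_countable_topology}) \<Rightarrow> real \<Rightarrow> 'b" where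
  "prim f x = (\<integral>s. indicator {..x} s *\<^sub>R f s \<partial>unit_int)"

lemma prim_integrable:
  fixes f :: "real \<Rightarrow> 'b::{banach, second_countable_topology}"
  assumes "integrable unit_int f" "A \<in> sets borel"
  shows "integrable unit_int (\<lambda>s. indicator A s *\<^sub>R f s)"
proof -
  have "A \<inter> {0<..<1} \<in> sets unit_int" using assms(2) by (auto simp: sets_restrict_space)
  from integrable_mult_indicator[OF this assms(1)] show ?thesis
    by (rule Bochner_Integration.integrable_cong[THEN iffD1, rotated -1])
       (auto simp: indicator_def)
qed

lemma prim_less: "prim f x = (\<integral>s. indicator {..<x} s *\<^sub>R f s \<partial>unit_int)"
  if "integrable unit_int f" for f :: "real \<Rightarrow> 'b::{banach, second_countable_topology}"
  unfolding prim_def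
proof (rule integral_cong_AE)
  show "AE s in unit_int. indicator {..x} s *\<^sub>R f s = indicator {..<x} s *\<^sub>R f s"
    using AE_unit_int_neq[of x] by eventually_elim (auto simp: indicator_def)
qed (intro borel_measurable_integrable prim_integrable that, simp)+

lemma prim_0: "prim f 0 = 0"
  unfolding prim_def by (rule integral_eq_zero_AE) (auto simp: indicator_def intro!: AE_I2)

lemma prim_1: "prim f 1 = (\<integral>s. f s \<partial>unit_int)"
  unfolding prim_def by (rule Bochner_Integration.integral_cong) (auto simp: indicator_def)

lemma continuous_on_prim:
  fixes f :: "real \<Rightarrow> 'b::{banach, second_countable_topology}"
  assumes f: "integrable unit_int f"
  shows "continuous_on S (prim f)"
proof (rule continuous_on_subset[of UNIV])
  show "continuous_on UNIV (prim f)"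
    unfolding continuous_on_sequentially comp_def
  proof safe
    fix X and x :: real assume X: "X \<longlonglongrightarrow> x"
    show "(\<lambda>n. prim f (X n)) \<longlonglongrightarrow> prim f x"
      unfolding prim_def
    proof (rule integral_dominated_convergence[where w="\<lambda>s. norm (f s)"])
      show "AE s in unit_int. (\<lambda>n. indicator {..X n} s *\<^sub>R f s) \<longlonglongrightarrow> indicator {..x} s *\<^sub>R f s"
        using AE_unit_int_neq[of x]
      proof eventually_elim
        case (elim s)
        have "eventually (\<lambda>n. indicator {..X n} s = (indicator {..x} s :: real)) sequentially"
        proof (cases "s < x")
          case True
          show ?thesis using order_tendstoD(1)[OF X True] by eventually_elim (use True in auto)
        next
          case False
          with elim have "x < s" by simp
          show ?thesis using order_tendstoD(2)[OF X \<open>x < s\<close>] by eventually_elim (use \<open>x < s\<close> in auto)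
        qed
        then show ?case
          by (intro tendsto_eventually) (auto elim: eventually_mono)
      qed
      show "integrable unit_int (\<lambda>s. norm (f s))" using f by simp
      show "AE s in unit_int. norm (indicator {..X n} s *\<^sub>R f s) \<le> norm (f s)" for n
        by (rule AE_I2) (simp add: indicator_def)
    qed (intro borel_measurable_integrable prim_integrable f, simp)+
  qed
qed simp

text \<open>
  Both summands are integrals of \<open>p (f s) (g x)\<close> over a triangle, one above and one below the diagonal of
  the unit square, and the right-hand side is the integral over the square. No regularity beyond
  integrability is involved, so the lemma serves test functions and Sobolev functions alike.
\<close>

lemma prim_by_parts:
  fixes f :: "real \<Rightarrow> 'b::{banach, second_countable_topology}"
    and g :: "real \<Rightarrow> 'c::{banach, second_countable_topology}"
    and p :: "'b \<Rightarrow> 'c \<Rightarrow> 'd::{banach, second_countable_topology}"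
  assumes p: "bounded_bilinear p" and f: "integrable unit_int f" and g: "integrable unit_int g"
  shows "(\<integral>x. p (prim f x) (g x) \<partial>unit_int) + (\<integral>x. p (f x) (prim g x) \<partial>unit_int)
      = p (\<integral>x. f x \<partial>unit_int) (\<integral>x. g x \<partial>unit_int)"
proof -
  interpret p: bounded_bilinear p by fact
  obtain c where c: "\<And>a b. norm (p a b) \<le> norm a * norm b * c" "c > 0"
    using p.pos_bounded by blast
  note [measurable] = borel_measurable_integrable[OF f] borel_measurable_integrable[OF g]
  have id[measurable]: "(\<lambda>x. x) \<in> borel_measurable unit_int" by (rule borel_measurable_unit_int) simp
  have meas: "(\<lambda>(s, x). p (f s) (g x)) \<in> borel_measurable (unit_int \<Otimes>\<^sub>M unit_int)"
    unfolding split_beta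
    by (rule borel_measurable_continuous_Pair[where H=p]) (measurable, intro p.continuous_on continuous_intros)
  have int: "integrable (unit_int \<Otimes>\<^sub>M unit_int) (\<lambda>(s, x). p (f s) (g x))"
  proof (rule Bochner_Integration.integrable_bound)
    show "integrable (unit_int \<Otimes>\<^sub>M unit_int) (\<lambda>(s, x). c * (norm (f s) * norm (g x)))"
    proof (rule unit_pair.Fubini_integrable)
      show "(\<lambda>(s, x). c * (norm (f s) * norm (g x))) \<in> borel_measurable (unit_int \<Otimes>\<^sub>M unit_int)"
        by measurable
      show "integrable unit_int (\<lambda>s. LINT x|unit_int. norm (case (s, x) of (s, x) \<Rightarrow> c * (norm (f s) * norm (g x))))"
        using f g c(2) by (simp add: abs_mult)
      show "AE s in unit_int. integrable unit_int (\<lambda>x. case (s, x) of (s, x) \<Rightarrow> c * (norm (f s) * norm (g x)))"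
        using g by simp
    qed
    show "AE z in unit_int \<Otimes>\<^sub>M unit_int. norm (case z of (s, x) \<Rightarrow> p (f s) (g x))
        \<le> norm (case z of (s, x) \<Rightarrow> c * (norm (f s) * norm (g x)))"
      by (rule AE_I2) (use c in \<open>auto simp: abs_mult mult_ac\<close>)
  qed (rule meas)
  have A[measurable]: "{z \<in> space (unit_int \<Otimes>\<^sub>M unit_int). fst z < snd z} \<in> sets (unit_int \<Otimes>\<^sub>M unit_int)"
    "{z \<in> space (unit_int \<Otimes>\<^sub>M unit_int). snd z \<le> fst z} \<in> sets (unit_int \<Otimes>\<^sub>M unit_int)"
    by measurable
  have i1: "integrable (unit_int \<Otimes>\<^sub>M unit_int) (\<lambda>(s, x). indicator {..<x} s *\<^sub>R p (f s) (g x))"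
    using integrable_mult_indicator[OF A(1) int]
    by (rule Bochner_Integration.integrable_cong[THEN iffD1, rotated -1])
       (auto simp: indicator_def)
  have i2: "integrable (unit_int \<Otimes>\<^sub>M unit_int) (\<lambda>(s, x). indicator {..s} x *\<^sub>R p (f s) (g x))"
    using integrable_mult_indicator[OF A(2) int]
    by (rule Bochner_Integration.integrable_cong[THEN iffD1, rotated -1])
       (auto simp: indicator_def)
  have pl: "(\<integral>s. p (h s) b \<partial>unit_int) = p (\<integral>s. h s \<partial>unit_int) b" if "integrable unit_int h" for h b
    by (rule integral_bounded_linear[OF p.bounded_linear_left that])
  have pr: "(\<integral>s. p a (h s) \<partial>unit_int) = p a (\<integral>s. h s \<partial>unit_int)" if "integrable unit_int h" for h a
    by (rule integral_bounded_linear[OF p.bounded_linear_right that])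
  have "(\<integral>x. p (prim f x) (g x) \<partial>unit_int) = (\<integral>x. (\<integral>s. indicator {..<x} s *\<^sub>R p (f s) (g x) \<partial>unit_int) \<partial>unit_int)"
    by (simp add: prim_less[OF f] pl[OF prim_integrable[OF f], symmetric] p.scaleR_left)
  also have "\<dots> = (\<integral>z. (case z of (s, x) \<Rightarrow> indicator {..<x} s *\<^sub>R p (f s) (g x)) \<partial>(unit_int \<Otimes>\<^sub>M unit_int))"
    using unit_pair.integral_snd[OF i1] by simp
  finally have 1: "(\<integral>x. p (prim f x) (g x) \<partial>unit_int) =
    (\<integral>z. (case z of (s, x) \<Rightarrow> indicator {..<x} s *\<^sub>R p (f s) (g x)) \<partial>(unit_int \<Otimes>\<^sub>M unit_int))" .
  have "(\<integral>s. p (f s) (prim g s) \<partial>unit_int) = (\<integral>s. (\<integral>x. indicator {..s} x *\<^sub>R p (f s) (g x) \<partial>unit_int) \<partial>unit_int)"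
    by (simp add: prim_def pr[OF prim_integrable[OF g], symmetric] p.scaleR_right)
  also have "\<dots> = (\<integral>z. (case z of (s, x) \<Rightarrow> indicator {..s} x *\<^sub>R p (f s) (g x)) \<partial>(unit_int \<Otimes>\<^sub>M unit_int))"
    using unit_pair.integral_fst[OF i2] by simp
  finally have 2: "(\<integral>s. p (f s) (prim g s) \<partial>unit_int) =
    (\<integral>z. (case z of (s, x) \<Rightarrow> indicator {..s} x *\<^sub>R p (f s) (g x)) \<partial>(unit_int \<Otimes>\<^sub>M unit_int))" .
  have "p (\<integral>x. f x \<partial>unit_int) (\<integral>x. g x \<partial>unit_int) = (\<integral>s. (\<integral>x. p (f s) (g x) \<partial>unit_int) \<partial>unit_int)"
    by (simp add: pr[OF g] pl[OF f])
  also have "\<dots> = (\<integral>z. (case z of (s, x) \<Rightarrow> p (f s) (g x)) \<partial>(unit_int \<Otimes>\<^sub>M unit_int))"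
    using unit_pair.integral_fst[OF int] by simp
  also have "\<dots> = (\<integral>z. (case z of (s, x) \<Rightarrow> indicator {..<x} s *\<^sub>R p (f s) (g x)) +
      (case z of (s, x) \<Rightarrow> indicator {..s} x *\<^sub>R p (f s) (g x)) \<partial>(unit_int \<Otimes>\<^sub>M unit_int))"
    by (rule Bochner_Integration.integral_cong) (auto simp: indicator_def)
  finally show ?thesis
    unfolding 1 2 Bochner_Integration.integral_add[OF i1 i2] by simp
qed

lemma integrable_unit_int_continuous:
  fixes h :: "real \<Rightarrow> 'b::euclidean_space"
  assumes "continuous_on {0..1} h"
  shows "integrable unit_int h" "(\<integral>x. h x \<partial>unit_int) = integral {0..1} h"
proof -
  have "h absolutely_integrable_on {0..1}"
    using assms by (rule absolutely_integrable_continuous_real)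
  then have "h absolutely_integrable_on {0<..<1}"
    by (rule set_integrable_subset) auto
  then show i: "integrable unit_int h"
    by (simp add: integrable_restrict_space set_integrable_def)
  show "(\<integral>x. h x \<partial>unit_int) = integral {0..1} h"
    by (simp add: lebesgue_integral_eq_integral[OF i] integral_open_interval_real)
qed

lemma integrable_unit_int_mult:
  fixes w :: "real \<Rightarrow> 'b::euclidean_space"
  assumes w: "integrable unit_int w" and h: "continuous_on {0..1} h"
  shows "integrable unit_int (\<lambda>x. h x *\<^sub>R w x)"
proof -
  obtain B where B: "\<And>x. x \<in> {0..1} \<Longrightarrow> norm (h x) \<le> B"
    using compact_imp_bounded[OF compact_continuous_image[OF h compact_Icc]]
    unfolding bounded_iff by blast
  have "0 \<le> B" using B[of 0] by (simp add: order_trans[OF norm_ge_zero])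
  show ?thesis
  proof (rule Bochner_Integration.integrable_bound)
    show "integrable unit_int (\<lambda>x. B * norm (w x))" using w by simp
    show "(\<lambda>x. h x *\<^sub>R w x) \<in> borel_measurable unit_int"
      by (intro borel_measurable_scaleR borel_measurable_integrable integrable_unit_int_continuous h w)
    show "AE x in unit_int. norm (h x *\<^sub>R w x) \<le> norm (B * norm (w x))"
      using B \<open>0 \<le> B\<close> by (intro AE_I2) (auto simp: abs_mult intro!: mult_right_mono)
  qed
qed

text \<open>
  The vanishing mean is what makes the primitive vanish again to the right of the support of \<open>h\<close>.
\<close>

lemma C1c_antiderivative:
  fixes h :: "real \<Rightarrow> real"
  assumes h: "continuous_on UNIV h" and ab: "0 < a" "b < 1" "\<And>x. x \<notin> {a..b} \<Longrightarrow> h x = 0"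
    and 0: "(\<integral>x. h x \<partial>unit_int) = 0"
  obtains \<phi> where "\<phi> \<in> C1c {0<..<1}" "deriv \<phi> = h"
proof -
  define \<phi> where "\<phi> x = integral {0..x} h" for x
  have h': "continuous_on S h" for S using h by (rule continuous_on_subset) simp
  have zero: "integral {0..1} h = 0"
    using integrable_unit_int_continuous[OF h'] 0 by simp
  have outside: "\<phi> x = 0" if "x \<notin> {a..b}" for x
  proof (cases "x < a")
    case True
    have "\<phi> x = integral {0..x} (\<lambda>x. 0)"
      unfolding \<phi>_def by (rule Henstock_Kurzweil_Integration.integral_cong) (use True ab(3) in auto)
    then show ?thesis by simp
  next
    case False
    with that have x: "b < x" "0 < x" using ab by auto
    define m where "m = max x 1"
    have "integral {0..y} h = integral {0..m} h" if y: "y \<in> {x, 1}" for y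
    proof -
      have "(h has_integral integral {0..y} h) {0..y}"
        by (intro integrable_integral integrable_continuous_real h')
      then have "(h has_integral integral {0..y} h) {0..m}"
        by (rule has_integral_on_superset) (use y x ab in \<open>auto simp: m_def\<close>)
      then show ?thesis by (simp add: integral_unique)
    qed
    then show ?thesis using zero by (simp add: \<phi>_def)
  qed
  have deriv: "(\<phi> has_real_derivative h x) (at x)" for x
  proof (cases "x < a")
    case True
    have "((\<lambda>_. 0) has_real_derivative h x) (at x)" using True ab(3)[of x] by simp
    then show ?thesis
      by (rule has_field_derivative_transform_within_open[of _ _ _ "{..<a}"]) (use True outside in auto)
  next
    case False
    then have x: "x \<in> {0<..<x+1}" using ab by auto
    have "(\<phi> has_real_derivative h x) (at x within {0..x+1})"
      unfolding \<phi>_def using x by (intro integral_has_real_derivative h') auto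
    then have "(\<phi> has_real_derivative h x) (at x within {0<..<x+1})"
      by (rule DERIV_subset) auto
    then show ?thesis unfolding at_within_open[OF x open_greaterThanLessThan] .
  qed
  have 1: "deriv \<phi> = h" by (intro ext DERIV_imp_deriv deriv)
  have frechet: "frechet_derivative \<phi> (at x) = (\<lambda>v. h x * v)" for x
    using frechet_derivative_at[OF deriv[of x, unfolded has_field_derivative_def]] by simp
  have "\<phi> \<in> C1c {0<..<1}"
    unfolding C1c_def mem_Collect_eq frechet
  proof (intro conjI allI exI[of _ "{a..b}"] impI)
    show "\<phi> differentiable at x" for x
      using deriv[of x] by (auto simp: has_field_derivative_def differentiable_def)
  qed (use ab outside in \<open>auto intro!: continuous_intros h\<close>)
  then show ?thesis using 1 by (rule that)
qed

text \<open>
  The indicator of an open set is the pointwise limit of cut-off multiples of the distance to its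
  complement; open sets are stable under intersection and generate the Borel sets.
\<close>

lemma zero_if_orthogonal_to_continuous:
  fixes w :: "real \<Rightarrow> 'b::euclidean_space"
  assumes w: "integrable unit_int w"
    and orth: "\<And>h a b. continuous_on UNIV h \<Longrightarrow> 0 < a \<Longrightarrow> b < 1 \<Longrightarrow> (\<And>x. x \<notin> {a..b} \<Longrightarrow> h x = 0) \<Longrightarrow>
      (\<integral>x. h x *\<^sub>R w x \<partial>unit_int) = 0"
  shows "AE x in unit_int. w x = 0"
proof -
  have opens: "(\<integral>x. indicator U x *\<^sub>R w x \<partial>unit_int) = 0" if U: "open U" for U
  proof -
    define F where "F = - (U \<inter> {0<..<1})"
    have F: "closed F" "F \<noteq> {}" "0 \<in> F" "1 \<in> F"
      unfolding F_def by (intro closed_Compl open_Int U open_greaterThanLessThan) auto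
    define \<psi> where "\<psi> n x = max 0 (min 1 (real n * infdist x F - 1))" for n x
    have cont: "continuous_on S (\<psi> n)" for n S
      unfolding \<psi>_def by (intro continuous_intros)
    have range: "\<bar>\<psi> n x\<bar> \<le> 1" for n x by (simp add: \<psi>_def)
    have "(\<lambda>n. \<integral>x. \<psi> n x *\<^sub>R w x \<partial>unit_int) \<longlonglongrightarrow> (\<integral>x. indicator U x *\<^sub>R w x \<partial>unit_int)"
    proof (rule integral_dominated_convergence[where w="\<lambda>s. norm (w s)"])
      show "(\<lambda>x. indicator U x *\<^sub>R w x) \<in> borel_measurable unit_int"
        by (intro borel_measurable_integrable prim_integrable w) (simp add: U)
      show "(\<lambda>x. \<psi> n x *\<^sub>R w x) \<in> borel_measurable unit_int" for n
        by (intro borel_measurable_integrable integrable_unit_int_mult w cont)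
      show "integrable unit_int (\<lambda>s. norm (w s))" using w by simp
      show "AE x in unit_int. norm (\<psi> n x *\<^sub>R w x) \<le> norm (w x)" for n
        using range by (intro AE_I2) (auto intro!: mult_left_le_one_le)
      show "AE x in unit_int. (\<lambda>n. \<psi> n x *\<^sub>R w x) \<longlonglongrightarrow> indicator U x *\<^sub>R w x"
      proof (rule AE_I2)
        fix x assume "x \<in> space unit_int"
        then have x: "x \<in> {0<..<1}" by simp
        have "eventually (\<lambda>n. \<psi> n x = indicator U x) sequentially"
        proof (cases "x \<in> U")
          case True
          then have "x \<notin> F" using x by (simp add: F_def)
          then have "infdist x F \<noteq> 0" using in_closed_iff_infdist_zero[OF F(1,2)] by simp
          then have d: "infdist x F > 0" using infdist_nonneg[of x F] by simp
          have "eventually (\<lambda>n. real n \<ge> 2 / infdist x F) sequentially"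
            using eventually_ge_at_top[of "nat \<lceil>2 / infdist x F\<rceil>"] by eventually_elim linarith
          then show ?thesis
          proof eventually_elim
            case (elim n)
            then have "real n * infdist x F \<ge> 2" using d by (simp add: field_simps)
            then show ?case using True by (simp add: \<psi>_def)
          qed
        next
          case False
          then have "x \<in> F" by (simp add: F_def)
          then show ?thesis using False by (simp add: \<psi>_def)
        qed
        then show "(\<lambda>n. \<psi> n x *\<^sub>R w x) \<longlonglongrightarrow> indicator U x *\<^sub>R w x"
          by (intro tendsto_eventually) (auto elim: eventually_mono)
      qed
    qed
    moreover have "(\<integral>x. \<psi> n x *\<^sub>R w x \<partial>unit_int) = 0" for n
    proof (rule orth[where a="1 / (real n + 1)" and b="1 - 1 / (real n + 1)"])
      fix x assume x: "x \<notin> {1 / (real n + 1)..1 - 1 / (real n + 1)}"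
      show "\<psi> n x = 0"
      proof (cases "x \<in> F")
        case False
        then have x01: "0 < x" "x < 1" by (auto simp: F_def)
        have "infdist x F \<le> x" "infdist x F \<le> 1 - x"
          using infdist_le[OF F(3), of x] infdist_le[OF F(4), of x] x01 by (auto simp: dist_real_def)
        then have "infdist x F \<le> 1 / (real n + 1)" using x by auto
        then have "(real n + 1) * infdist x F \<le> 1" by (simp add: field_simps)
        then have "real n * infdist x F \<le> 1" using infdist_nonneg[of x F] by (simp add: algebra_simps)
        then show ?thesis by (simp add: \<psi>_def)
      qed (simp add: \<psi>_def)
    qed (use cont in auto)
    ultimately show ?thesis by (simp add: LIMSEQ_const_iff)
  qed
  have borel: "(\<integral>x. indicator A x *\<^sub>R w x \<partial>unit_int) = 0" if A: "A \<in> sets borel" for A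
  proof -
    have "Int_stable {S :: real set. open S}" "{S :: real set. open S} \<subseteq> Pow UNIV"
      "A \<in> sigma_sets UNIV {S. open S}"
      using A by (auto simp: Int_stable_def borel_def)
    then show ?thesis
    proof (induction rule: sigma_sets_induct_disjoint)
      case (basic A) then show ?case using opens by simp
    next
      case (compl A)
      then have A: "A \<in> sets borel" by (simp add: borel_def)
      have "(\<integral>x. indicator (UNIV - A) x *\<^sub>R w x \<partial>unit_int) = (\<integral>x. indicator UNIV x *\<^sub>R w x - indicator A x *\<^sub>R w x \<partial>unit_int)"
        by (rule Bochner_Integration.integral_cong) (auto simp: indicator_def)
      also have "\<dots> = 0"
      proof -
        have "integrable unit_int (\<lambda>x. indicator UNIV x *\<^sub>R w x)" by (rule prim_integrable[OF w]) simp
        from Bochner_Integration.integral_diff[OF this prim_integrable[OF w A]] show ?thesis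
          using opens[of UNIV] compl(2) by simp
      qed
      finally show ?case .
    next
      case (union A)
      then have A: "A i \<in> sets borel" for i by (auto simp: borel_def)
      let ?A = "\<lambda>i. A i \<inter> {0<..<1}"
      have A': "?A i \<in> sets unit_int" for i using A by (auto simp: sets_restrict_space)
      have eq: "set_lebesgue_integral unit_int (B \<inter> {0<..<1}) w = (\<integral>x. indicator B x *\<^sub>R w x \<partial>unit_int)" for B
        unfolding set_lebesgue_integral_def
        by (rule Bochner_Integration.integral_cong) (auto simp: indicator_def)
      have "set_lebesgue_integral unit_int (\<Union>i. ?A i) w = (\<Sum>i. set_lebesgue_integral unit_int (?A i) w)"
      proof (rule lebesgue_integral_countable_add)
        show "set_integrable unit_int (\<Union>i. ?A i) w"
          unfolding set_integrable_def by (intro integrable_mult_indicator w sets.countable_UN) (use A' in auto)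
      qed (use A' union(1) in \<open>auto simp: disjoint_family_on_def\<close>)
      also have "\<dots> = 0" unfolding eq using union by simp
      also have "(\<Union>i. ?A i) = (\<Union>i. A i) \<inter> {0<..<1}" by auto
      finally show ?case unfolding eq .
    qed auto
  qed
  show ?thesis
  proof (rule unit_int.density_zero[OF w])
    fix A assume "A \<in> sets unit_int"
    then have A: "A \<in> sets lebesgue" "A \<subseteq> {0<..<1}" by (auto simp: sets_restrict_space)
    obtain S N N' where S: "A = S \<union> N" "N \<subseteq> N'" "N' \<in> null_sets lborel" "S \<in> sets lborel"
      using A(1) by (rule sets_completionE)
    have ae: "AE x in unit_int. indicator A x *\<^sub>R w x = indicator S x *\<^sub>R w x"
      by (rule AE_unit_intI)
         (use AE_not_in[OF S(3)] S(1,2) in \<open>auto simp: indicator_def elim!: eventually_mono\<close>)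
    have "set_lebesgue_integral unit_int A w = (\<integral>x. indicator S x *\<^sub>R w x \<partial>unit_int)"
      unfolding set_lebesgue_integral_def
    proof (rule integral_cong_AE)
      show "(\<lambda>x. indicator A x *\<^sub>R w x) \<in> borel_measurable unit_int"
        by (intro borel_measurable_integrable integrable_mult_indicator w) fact
    qed (use S ae in \<open>auto intro!: borel_measurable_integrable prim_integrable w\<close>)
    then show "set_lebesgue_integral unit_int A w = 0" using borel S(4) by simp
  qed
qed

text \<open>
  Any \<open>h\<close> becomes a derivative of a test function after subtracting the multiple of a fixed \<open>\<rho>\<close> that
  has the same mean, so \<open>w\<close> minus its \<open>\<rho>\<close>-average is orthogonal to every \<open>h\<close>. A \<open>\<rho>\<close> of nonzero mean
  exists, since otherwise the constant \<open>1\<close> would be orthogonal to every \<open>h\<close>.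
\<close>

lemma du_Bois_Reymond:
  fixes w :: "real \<Rightarrow> 'b::euclidean_space"
  assumes w: "integrable unit_int w"
    and orth: "\<And>\<phi>. \<phi> \<in> C1c {0<..<1} \<Longrightarrow> (\<integral>x. deriv \<phi> x *\<^sub>R w x \<partial>unit_int) = 0"
  obtains c where "AE x in unit_int. w x = c"
proof -
  have "\<exists>h a b. continuous_on UNIV h \<and> 0 < a \<and> b < 1 \<and> (\<forall>x. x \<notin> {a..b} \<longrightarrow> h x = 0) \<and>
     (\<integral>x. h x *\<^sub>R (1::real) \<partial>unit_int) \<noteq> 0"
  proof (rule ccontr)
    assume "\<not> ?thesis"
    then have "AE x in unit_int. (1::real) = 0"
      by (intro zero_if_orthogonal_to_continuous) auto
    then have "emeasure unit_int {0<..<1} = 0"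
      by (subst (asm) AE_iff_measurable[of "{0<..<1}"]) (auto simp: sets_restrict_space)
    then show False by (simp add: emeasure_restrict_space)
  qed
  then obtain \<rho> a b where \<rho>: "continuous_on UNIV \<rho>" "0 < a" "b < 1" "\<forall>x. x \<notin> {a..b} \<longrightarrow> \<rho> x = 0"
    "(\<integral>x. \<rho> x *\<^sub>R (1::real) \<partial>unit_int) \<noteq> 0" by blast
  define R where "R = (\<integral>x. \<rho> x \<partial>unit_int)"
  define c where "c = (\<integral>x. \<rho> x *\<^sub>R w x \<partial>unit_int) /\<^sub>R R"
  have "AE x in unit_int. w x - c = 0"
  proof (rule zero_if_orthogonal_to_continuous)
    show "integrable unit_int (\<lambda>x. w x - c)" using w by simp
    fix h :: "real \<Rightarrow> real" and a' b'
    assume h: "continuous_on UNIV h" "0 < a'" "b' < 1" "\<And>x. x \<notin> {a'..b'} \<Longrightarrow> h x = 0"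
    have hc: "continuous_on {0..1} h" "continuous_on {0..1} \<rho>"
      using h(1) \<rho>(1) continuous_on_subset by blast+
    define I where "I = (\<integral>x. h x \<partial>unit_int)"
    let ?\<chi> = "\<lambda>x. h x - (I / R) * \<rho> x"
    have i: "integrable unit_int h" "integrable unit_int \<rho>"
      by (intro integrable_unit_int_continuous hc)+
    have iw: "integrable unit_int (\<lambda>x. h x *\<^sub>R w x)" "integrable unit_int (\<lambda>x. \<rho> x *\<^sub>R w x)"
      by (intro integrable_unit_int_mult hc w)+
    have "(\<integral>x. ?\<chi> x \<partial>unit_int) = 0"
      using i \<rho>(5) by (simp add: I_def R_def)
    moreover have "continuous_on UNIV ?\<chi>" by (intro continuous_intros h \<rho>)
    moreover have "0 < min a a'" "max b b' < 1" using h \<rho> by auto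
    moreover have "?\<chi> x = 0" if "x \<notin> {min a a'..max b b'}" for x
    proof -
      have "x \<notin> {a..b}" "x \<notin> {a'..b'}" using that by auto
      then show ?thesis using h(4) \<rho>(4) by simp
    qed
    ultimately obtain \<phi> where "\<phi> \<in> C1c {0<..<1}" "deriv \<phi> = ?\<chi>"
      using C1c_antiderivative[of ?\<chi> "min a a'" "max b b'"] by metis
    with orth[of \<phi>] have "(\<integral>x. ?\<chi> x *\<^sub>R w x \<partial>unit_int) = 0" by simp
    also have "(\<integral>x. ?\<chi> x *\<^sub>R w x \<partial>unit_int) = (\<integral>x. h x *\<^sub>R w x - (I / R) *\<^sub>R (\<rho> x *\<^sub>R w x) \<partial>unit_int)"
      by (simp add: algebra_simps)
    also have "\<dots> = (\<integral>x. h x *\<^sub>R w x \<partial>unit_int) - I *\<^sub>R c"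
      by (subst Bochner_Integration.integral_diff[OF iw(1) integrable_scaleR_right[OF iw(2)]])
         (simp only: integral_scaleR_right c_def, simp add: divide_inverse)
    finally have "(\<integral>x. h x *\<^sub>R w x \<partial>unit_int) = I *\<^sub>R c" by simp
    moreover have "(\<integral>x. h x *\<^sub>R (w x - c) \<partial>unit_int) = (\<integral>x. h x *\<^sub>R w x \<partial>unit_int) - I *\<^sub>R c"
      using iw i by (simp add: scaleR_diff_right I_def)
    ultimately show "(\<integral>x. h x *\<^sub>R (w x - c) \<partial>unit_int) = 0" by simp
  qed
  then show ?thesis by (intro that[of c]) simp
qed

lemma C1c_unit_props:
  fixes \<phi> :: "real \<Rightarrow> real"
  assumes "\<phi> \<in> C1c {0<..<1}"
  shows "continuous_on S (deriv \<phi>)"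
    "x \<in> {0..1} \<Longrightarrow> \<phi> x = prim (deriv \<phi>) x" "\<phi> 1 = 0"
proof -
  have diff: "\<phi> differentiable (at x)" for x using assms by (auto simp: C1c_def)
  then have d: "(\<phi> has_real_derivative deriv \<phi> x) (at x)" for x
    by (simp add: DERIV_deriv_iff_real_differentiable)
  have "frechet_derivative \<phi> (at x) 1 = deriv \<phi> x" for x
    using frechet_derivative_at[OF d[of x, unfolded has_field_derivative_def]] by (metis mult.right_neutral)
  moreover have "continuous_on UNIV (\<lambda>x. frechet_derivative \<phi> (at x) 1)"
    using assms by (auto simp: C1c_def)
  ultimately have c: "continuous_on UNIV (deriv \<phi>)" by simp
  then show c': "continuous_on S (deriv \<phi>)" for S by (rule continuous_on_subset) simp
  have ends: "\<phi> 0 = 0" "\<phi> 1 = 0" using assms by (fastforce simp: C1c_def)+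
  then show "\<phi> 1 = 0" by simp
  assume x: "x \<in> {0..1}"
  have "prim (deriv \<phi>) x = integral {0<..<1} (\<lambda>s. indicator {..x} s *\<^sub>R deriv \<phi> s)"
    unfolding prim_def by (intro lebesgue_integral_eq_integral prim_integrable integrable_unit_int_continuous c') auto
  also have "\<dots> = integral {0..1} (\<lambda>s. if s \<in> {..x} then deriv \<phi> s else 0)"
    unfolding integral_open_interval_real[symmetric]
    by (rule Henstock_Kurzweil_Integration.integral_cong) (simp add: indicator_def)
  also have "\<dots> = integral {0..x} (deriv \<phi>)"
    using x by (subst integral_restrict_Int) (auto intro!: arg_cong[where f="\<lambda>S. integral S _"])
  also have "\<dots> = \<phi> x - \<phi> 0"
    using x by (intro integral_unique fundamental_theorem_of_calculus)
      (auto simp: has_real_derivative_iff_has_vector_derivative[symmetric] intro: has_field_derivative_at_within d)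
  finally show "\<phi> x = prim (deriv \<phi>) x" using ends by simp
qed


lemma L2_unit_int_integrable:
  fixes f :: "real \<Rightarrow> 'b::euclidean_space"
  assumes "f \<in> L2 unit_int" shows "integrable unit_int f"
proof (rule Bochner_Integration.integrable_bound)
  show "integrable unit_int (\<lambda>x. 1 + (norm (f x))\<^sup>2)" using assms by (simp add: L2_def)
  show "AE x in unit_int. norm (f x) \<le> norm (1 + (norm (f x))\<^sup>2)"
  proof (rule AE_I2)
    fix x
    have "2 * norm (f x) \<le> 1 + (norm (f x))\<^sup>2"
      using sum_squares_bound[of 1 "norm (f x)"] by simp
    then show "norm (f x) \<le> norm (1 + (norm (f x))\<^sup>2)"
      using norm_ge_zero[of "f x"] by (simp add: abs_if)
  qed
qed (use assms in \<open>simp add: L2_def\<close>)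

text \<open>
  Integration by parts against a test function shows that \<open>f - prim g\<close> has weak derivative zero.
\<close>

lemma weak_derivative_primitive:
  fixes f g :: "real \<Rightarrow> complex^'k"
  assumes f: "integrable unit_int f" and g: "integrable unit_int g" and "is_weak_deriv f g"
  obtains c where "AE x in unit_int. f x = c + prim g x"
proof -
  have pg: "integrable unit_int (prim g)"
    by (intro integrable_unit_int_continuous continuous_on_prim g)
  obtain c where "AE x in unit_int. f x - prim g x = c"
  proof (rule du_Bois_Reymond[of "\<lambda>x. f x - prim g x"])
    show "integrable unit_int (\<lambda>x. f x - prim g x)" using f pg by simp
    fix \<phi> :: "real \<Rightarrow> real" assume \<phi>: "\<phi> \<in> C1c {0<..<1}"
    note p = C1c_unit_props[OF \<phi>]
    have i: "integrable unit_int (deriv \<phi>)" by (intro integrable_unit_int_continuous p)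
    have "(\<integral>x. prim (deriv \<phi>) x *\<^sub>R g x \<partial>unit_int) + (\<integral>x. deriv \<phi> x *\<^sub>R prim g x \<partial>unit_int)
        = (\<integral>x. deriv \<phi> x \<partial>unit_int) *\<^sub>R (\<integral>x. g x \<partial>unit_int)"
      by (rule prim_by_parts[OF bounded_bilinear_scaleR i g])
    also have "(\<integral>x. deriv \<phi> x \<partial>unit_int) = 0"
      using p(2)[of 1] p(3) by (simp add: prim_1)
    also have "(\<integral>x. prim (deriv \<phi>) x *\<^sub>R g x \<partial>unit_int) = (\<integral>x. \<phi> x *\<^sub>R g x \<partial>unit_int)"
      by (rule Bochner_Integration.integral_cong) (auto simp: p(2))
    also have "\<dots> = - (\<integral>x. deriv \<phi> x *\<^sub>R f x \<partial>unit_int)"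
      using assms(3) \<phi> by (simp add: is_weak_deriv_def)
    finally have "(\<integral>x. deriv \<phi> x *\<^sub>R f x \<partial>unit_int) = (\<integral>x. deriv \<phi> x *\<^sub>R prim g x \<partial>unit_int)" by simp
    then show "(\<integral>x. deriv \<phi> x *\<^sub>R (f x - prim g x) \<partial>unit_int) = 0"
      using integrable_unit_int_mult[OF f p(1)] integrable_unit_int_mult[OF pg p(1)]
      by (simp add: scaleR_diff_right)
  qed
  then show ?thesis by (intro that[of c]) (auto elim!: eventually_mono simp: algebra_simps)
qed

text \<open>
  The complement of a null set is dense.
\<close>

lemma continuous_AE_eq_unit_int:
  fixes f g :: "real \<Rightarrow> 'b::real_normed_vector"
  assumes f: "continuous_on {0..1} f" and g: "continuous_on {0..1} g"
    and ae: "AE x in unit_int. f x = g x" and x: "x \<in> {0..1}"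
  shows "f x = g x"
proof -
  define Z where "Z = {x \<in> {0<..<1}. f x = g x}"
  have "AE x in lebesgue. x \<in> {0<..<1} \<longrightarrow> f x = g x"
    using ae by (subst (asm) AE_restrict_space_iff) (auto elim: eventually_mono)
  then obtain N where N: "N \<in> null_sets lebesgue"
      "{x \<in> space lebesgue. \<not> (x \<in> {0<..<1} \<longrightarrow> f x = g x)} \<subseteq> N"
    unfolding eventually_ae_filter by blast
  have "{0<..<1} - Z \<subseteq> N" using N(2) by (auto simp: Z_def)
  with N(1) have neg: "negligible ({0<..<1} - Z)"
    by (meson negligible_iff_null_sets negligible_subset)
  have "y \<in> closure Z" if "y \<in> closure {0<..<1}" for y
    unfolding closure_approachable
  proof (intro allI impI)
    fix e :: real assume "e > 0"
    with that obtain z where "z \<in> {0<..<1}" "dist z y < e"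
      unfolding closure_approachable by blast
    then have "z \<in> ball y e \<inter> {0<..<1}" by (simp add: dist_commute)
    then have "\<not> negligible (ball y e \<inter> {0<..<1})"
      by (intro open_not_negligible open_Int) auto
    then have "\<not> ball y e \<inter> {0<..<1} \<subseteq> {0<..<1} - Z"
      using neg negligible_subset by blast
    then show "\<exists>z\<in>Z. dist z y < e" by (auto simp: dist_commute)
  qed
  then have "{0..1} \<subseteq> closure Z" by auto
  moreover have "closure Z \<subseteq> {0..1}"
    by (rule closure_minimal) (auto simp: Z_def)
  ultimately have "closure Z = {0..1}" by blast
  have "(\<lambda>x. f x - g x) x = 0"
    by (rule continuous_constant_on_closure[of Z]) (use f g x \<open>closure Z = {0..1}\<close> in \<open>auto simp: Z_def[symmetric] intro!: continuous_intros\<close>,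
        simp add: Z_def)
  then show ?thesis by simp
qed

lemma H1_representation:
  fixes f :: "real \<Rightarrow> complex^'k"
  assumes "f \<in> H1"
  shows "wderiv f \<in> L2 unit_int"
    and "AE x in unit_int. f x = cont_rep f x"
    and "x \<in> {0..1} \<Longrightarrow> cont_rep f x = cont_rep f 0 + prim (wderiv f) x"
proof -
  have fL: "f \<in> L2 unit_int" using assms by (simp add: H1_def)
  have "\<exists>g. g \<in> L2 unit_int \<and> is_weak_deriv f g" using assms by (auto simp: H1_def)
  then have "wderiv f \<in> L2 unit_int \<and> is_weak_deriv f (wderiv f)"
    unfolding wderiv_def by (rule someI_ex)
  then have w: "wderiv f \<in> L2 unit_int" and d: "is_weak_deriv f (wderiv f)" by auto
  show "wderiv f \<in> L2 unit_int" by (rule w)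
  note wi = L2_unit_int_integrable[OF w]
  obtain c where c: "AE x in unit_int. f x = c + prim (wderiv f) x"
    by (rule weak_derivative_primitive[OF L2_unit_int_integrable[OF fL] wi d])
  have cont: "continuous_on {0..1} (\<lambda>x. c + prim (wderiv f) x)"
    by (intro continuous_intros continuous_on_prim wi)
  have "continuous_on {0..1} (cont_rep f) \<and> (AE x in unit_int. cont_rep f x = f x)"
    unfolding cont_rep_def
    by (rule someI[of _ "\<lambda>x. c + prim (wderiv f) x"])
       (use cont c in \<open>auto elim!: eventually_mono simp del: some_eq_ex\<close>)
  then have rep: "continuous_on {0..1} (cont_rep f)" "AE x in unit_int. cont_rep f x = f x" by auto
  show "AE x in unit_int. f x = cont_rep f x" using rep(2) by (auto elim!: eventually_mono)
  have *: "cont_rep f x = c + prim (wderiv f) x" if "x \<in> {0..1}" for x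
    by (rule continuous_AE_eq_unit_int[OF rep(1) cont _ that])
       (use rep(2) c in eventually_elim, simp)
  show "cont_rep f x = cont_rep f 0 + prim (wderiv f) x" if "x \<in> {0..1}"
    using *[OF that] *[of 0] by (simp add: prim_0)
qed

lemma H1_integration_by_parts:
  fixes f g :: "real \<Rightarrow> complex^'k"
  assumes f: "f \<in> H1" and g: "g \<in> H1"
  shows "(\<integral>x. inner (f x) (wderiv g x) \<partial>unit_int) + (\<integral>x. inner (wderiv f x) (g x) \<partial>unit_int)
    = inner (cont_rep f 1) (cont_rep g 1) - inner (cont_rep f 0) (cont_rep g 0)"
proof -
  note F = H1_representation[OF f] and G = H1_representation[OF g]
  let ?f' = "wderiv f" and ?g' = "wderiv g" and ?a = "cont_rep f 0" and ?b = "cont_rep g 0"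
  have fi: "integrable unit_int ?f'" and gi: "integrable unit_int ?g'"
    using F(1) G(1) by (auto intro: L2_unit_int_integrable)
  have fL: "f \<in> L2 unit_int" "g \<in> L2 unit_int" using f g by (auto simp: H1_def)
  have aef: "AE x in unit_int. f x = ?a + prim ?f' x"
    using F(2) AE_space
  proof eventually_elim
    case (elim x)
    then show ?case using F(3)[of x] by auto
  qed
  have aeg: "AE x in unit_int. g x = ?b + prim ?g' x"
    using G(2) AE_space
  proof eventually_elim
    case (elim x)
    then show ?case using G(3)[of x] by auto
  qed
  note m [measurable] = L2_measurable[OF fL(1)] L2_measurable[OF fL(2)]
    L2_measurable[OF F(1)] L2_measurable[OF G(1)]
    borel_measurable_integrable[OF integrable_unit_int_continuous(1)[OF continuous_on_prim[OF fi]]]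
    borel_measurable_integrable[OF integrable_unit_int_continuous(1)[OF continuous_on_prim[OF gi]]]
  have i1: "integrable unit_int (\<lambda>x. inner (f x) (?g' x))" "integrable unit_int (\<lambda>x. inner (?f' x) (g x))"
    by (intro integrable_inner_L2 fL F(1) G(1))+
  have i2: "integrable unit_int (\<lambda>x. inner ?a (?g' x))" "integrable unit_int (\<lambda>x. inner (?f' x) ?b)"
    using fi gi by auto
  have e1: "AE x in unit_int. inner (f x) (?g' x) = inner ?a (?g' x) + inner (prim ?f' x) (?g' x)"
    using aef by eventually_elim (simp add: inner_add_left)
  have e2: "AE x in unit_int. inner (?f' x) (g x) = inner (?f' x) ?b + inner (?f' x) (prim ?g' x)"
    using aeg by eventually_elim (simp add: inner_add_right)
  have i3: "integrable unit_int (\<lambda>x. inner (prim ?f' x) (?g' x))"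
    using Bochner_Integration.integrable_diff[OF i1(1) i2(1)]
    by (rule Bochner_Integration.integrable_cong_AE[THEN iffD1, rotated -1])
       (use e1 in \<open>auto elim!: eventually_mono\<close>)
  have i4: "integrable unit_int (\<lambda>x. inner (?f' x) (prim ?g' x))"
    using Bochner_Integration.integrable_diff[OF i1(2) i2(2)]
    by (rule Bochner_Integration.integrable_cong_AE[THEN iffD1, rotated -1])
       (use e2 in \<open>auto elim!: eventually_mono\<close>)
  have 1: "(\<integral>x. inner (f x) (?g' x) \<partial>unit_int) =
      (\<integral>x. inner ?a (?g' x) + inner (prim ?f' x) (?g' x) \<partial>unit_int)"
    by (rule integral_cong_AE) (use e1 in auto)
  have 2: "(\<integral>x. inner (?f' x) (g x) \<partial>unit_int) =
      (\<integral>x. inner (?f' x) ?b + inner (?f' x) (prim ?g' x) \<partial>unit_int)"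
    by (rule integral_cong_AE) (use e2 in auto)
  have f1: "cont_rep f 1 = ?a + (\<integral>x. ?f' x \<partial>unit_int)" using F(3)[of 1] by (simp add: prim_1)
  have g1: "cont_rep g 1 = ?b + (\<integral>x. ?g' x \<partial>unit_int)" using G(3)[of 1] by (simp add: prim_1)
  show ?thesis
    unfolding 1 2 f1 g1
    using i2 i3 i4 fi gi prim_by_parts[OF bounded_bilinear_inner fi gi]
    by (simp add: inner_add_left inner_add_right)
qed

section \<open>The frame of a cable\<close>

lemma inner_deriv_const:
  fixes f g :: "real \<Rightarrow> real^3"
  assumes "(f has_vector_derivative f') (at x)" "(g has_vector_derivative g') (at x)"
    and const: "\<And>y. y \<in> {0..1} \<Longrightarrow> inner (f y) (g y) = k" and x: "x \<in> {0<..<1}"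
  shows "inner f' (g x) + inner (f x) g' = 0"
proof -
  have "((\<lambda>y. inner (f y) (g y)) has_vector_derivative (inner (f x) g' + inner f' (g x))) (at x)"
    by (rule bounded_bilinear.has_vector_derivative[OF bounded_bilinear_inner assms(1,2)])
  moreover have "((\<lambda>y. inner (f y) (g y)) has_vector_derivative 0) (at x)"
    by (rule has_vector_derivative_transform_within_open[of "\<lambda>_. k" _ _ "{0<..<1}"])
       (use const x in \<open>auto intro!: has_vector_derivative_const\<close>)
  ultimately show ?thesis
    using vector_derivative_unique_at by (metis add.commute)
qed

lemma C1_on01_D:
  assumes "C1_on01 f"
  shows "continuous_on {0..1} f" "continuous_on {0..1} (deriv01 f)"
    "\<eta> \<in> {0<..<1} \<Longrightarrow> (f has_vector_derivative deriv01 f \<eta>) (at \<eta>)"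
proof -
  have d: "f differentiable (at \<eta> within {0..1})" if "\<eta> \<in> {0..1}" for \<eta>
    using assms that by (auto simp: C1_on01_def)
  then show "continuous_on {0..1} f"
    by (auto simp: continuous_on_eq_continuous_within intro: differentiable_imp_continuous_within)
  show "continuous_on {0..1} (deriv01 f)" using assms by (simp add: C1_on01_def)
  assume \<eta>: "\<eta> \<in> {0<..<1}"
  then have "(f has_vector_derivative deriv01 f \<eta>) (at \<eta> within {0..1})"
    unfolding deriv01_def using d[of \<eta>] by (simp add: vector_derivative_works[symmetric])
  moreover have "at \<eta> within {0..1} = at \<eta>"
    using \<eta> by (intro at_within_interior) auto
  ultimately show "(f has_vector_derivative deriv01 f \<eta>) (at \<eta>)" by simp
qed

text \<open>
  A matrix with orthonormal rows is invertible from both sides.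
\<close>

lemma orthonormal_triple:
  fixes e1 e2 e3 v :: "real^3"
  assumes o: "inner e1 e1 = 1" "inner e2 e2 = 1" "inner e3 e3 = 1"
    "inner e1 e2 = 0" "inner e1 e3 = 0" "inner e2 e3 = 0"
  shows "v = inner v e1 *\<^sub>R e1 + inner v e2 *\<^sub>R e2 + inner v e3 *\<^sub>R e3"
proof -
  define A :: "real^3^3" where "A = vector [e1, e2, e3]"
  have "A ** Finite_Cartesian_Product.transpose A = mat 1"
    using o inner_commute[of e1 e2] inner_commute[of e1 e3] inner_commute[of e2 e3]
    by (simp add: A_def vec_eq_iff matrix_matrix_mult_def transpose_def mat_def forall_3 sum_3
        inner_vec_def vector_3)
  then have "Finite_Cartesian_Product.transpose A ** A = mat 1"
    by (simp add: matrix_left_right_inverse)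
  then have "v = Finite_Cartesian_Product.transpose A *v (A *v v)"
    by (simp add: matrix_vector_mul_assoc)
  also have "\<dots> = inner v e1 *\<^sub>R e1 + inner v e2 *\<^sub>R e2 + inner v e3 *\<^sub>R e3"
    by (simp add: A_def vec_eq_iff matrix_vector_mult_def transpose_def forall_3 sum_3
        inner_vec_def vector_3 algebra_simps)
  finally show ?thesis .
qed

lemma oriented_triple:
  fixes e1 e2 e3 :: "real^3"
  assumes o: "inner e1 e1 = 1" "inner e2 e2 = 1" "inner e3 e3 = 1"
    "inner e1 e2 = 0" "inner e1 e3 = 0" "inner e2 e3 = 0"
    and d: "inner e1 (cross3 e2 e3) = 1"
  shows "cross3 e2 e3 = e1" "cross3 e1 e2 = e3" "cross3 e1 e3 = - e2"
proof -
  note e = orthonormal_triple[OF o]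
  have d2: "inner (cross3 e1 e2) e3 = 1" "inner (cross3 e1 e3) e2 = - 1" "inner (cross3 e2 e3) e1 = 1"
    using d by (simp_all add: cross3_def inner_vec_def sum_3 vector_3 algebra_simps)
  show "cross3 e2 e3 = e1" "cross3 e1 e2 = e3" "cross3 e1 e3 = - e2"
    by (rule trans[OF e], use d2 in \<open>simp add: dot_cross_self\<close>)+
qed

text \<open>
  Cartesian coordinates on the cross-sections. Unlike the polar ones of \<^const>\<open>beta\<close> they are regular on
  the centre curve, so that one map covers the whole body.
\<close>

definition tube :: "cable \<Rightarrow> real \<times> real \<times> real \<Rightarrow> real^3" where
  "tube c = (\<lambda>(\<eta>, a, b). curve c \<eta> + a *\<^sub>R kap1 c \<eta> + b *\<^sub>R kap2 c \<eta>)"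

text \<open>
  The derivative of \<^const>\<open>tube\<close> in the direction of the cable.
\<close>

definition axial :: "cable \<Rightarrow> real \<times> real \<times> real \<Rightarrow> real^3" where
  "axial c = (\<lambda>(\<eta>, a, b). deriv01 (curve c) \<eta> + a *\<^sub>R deriv01 (kap1 c) \<eta> + b *\<^sub>R deriv01 (kap2 c) \<eta>)"

definition disc :: "cable \<Rightarrow> (real \<times> real) set" where
  "disc c = {(a, b). a\<^sup>2 + b\<^sup>2 \<le> (radius c)\<^sup>2}"

lemma Phi_tube: "Phi c (\<eta>, \<theta>) = tube c (\<eta>, radius c * sin \<theta>, radius c * cos \<theta>)"
  by (simp add: Phi_def tube_def beta_def scaleR_add_right add.assoc)

lemma cable_okD:
  assumes "cable_ok c"
  shows "radius c > 0" "len c > 0"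
    "C1_on01 (curve c)" "C1_on01 (deriv01 (curve c))" "C1_on01 (kap1 c)" "C1_on01 (kap2 c)"
    "inj_on (Phi c) ({0..1} \<times> {-pi<..pi})"
    "frontier (body c) = lat_surface c \<union> end_surface c"
    "lat_surface c \<inter> end_surface c = {}"
  using assms by (auto simp: cable_ok_def)

lemma cable_frame:
  assumes "cable_ok c" "\<eta> \<in> {0..1}"
  shows "inner (deriv01 (curve c) \<eta>) (deriv01 (curve c) \<eta>) = (len c)\<^sup>2"
    "inner (kap1 c \<eta>) (kap1 c \<eta>) = 1" "inner (kap2 c \<eta>) (kap2 c \<eta>) = 1"
    "inner (deriv01 (curve c) \<eta>) (kap1 c \<eta>) = 0" "inner (deriv01 (curve c) \<eta>) (kap2 c \<eta>) = 0"
    "inner (kap1 c \<eta>) (kap2 c \<eta>) = 0"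
    "norm (deriv01 (deriv01 (curve c)) \<eta>) * radius c < (len c)\<^sup>2"
    "inner (deriv01 (curve c) \<eta>) (cross3 (kap1 c \<eta>) (kap2 c \<eta>)) = len c"
proof -
  have ok: "norm (deriv01 (curve c) \<eta>) = len c"
    "norm (deriv01 (deriv01 (curve c)) \<eta>) < (len c)\<^sup>2 / radius c"
    "norm (kap1 c \<eta>) = 1" "norm (kap2 c \<eta>) = 1"
    "inner (deriv01 (curve c) \<eta>) (kap1 c \<eta>) = 0" "inner (deriv01 (curve c) \<eta>) (kap2 c \<eta>) = 0"
    "inner (kap1 c \<eta>) (kap2 c \<eta>) = 0" "radius c > 0"
    "Determinants.det (Finite_Cartesian_Product.transpose
          (vector [deriv01 (curve c) \<eta>, kap1 c \<eta>, kap2 c \<eta>] :: real^3^3)) = len c"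
    using assms by (auto simp: cable_ok_def)
  then show "inner (deriv01 (curve c) \<eta>) (deriv01 (curve c) \<eta>) = (len c)\<^sup>2"
    "inner (kap1 c \<eta>) (kap1 c \<eta>) = 1" "inner (kap2 c \<eta>) (kap2 c \<eta>) = 1"
    "inner (deriv01 (curve c) \<eta>) (kap1 c \<eta>) = 0" "inner (deriv01 (curve c) \<eta>) (kap2 c \<eta>) = 0"
    "inner (kap1 c \<eta>) (kap2 c \<eta>) = 0"
    "norm (deriv01 (deriv01 (curve c)) \<eta>) * radius c < (len c)\<^sup>2"
    by (simp_all add: power2_norm_eq_inner[symmetric] field_simps)
  show "inner (deriv01 (curve c) \<eta>) (cross3 (kap1 c \<eta>) (kap2 c \<eta>)) = len c"
    using ok(9) by (simp add: dot_cross_det det_transpose)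
qed

lemma cable_frame_derivatives:
  assumes c: "cable_ok c" and \<eta>: "\<eta> \<in> {0<..<1}"
  defines "t \<equiv> deriv01 (curve c) \<eta>"
  shows "inner (deriv01 (kap1 c) \<eta>) (kap1 c \<eta>) = 0" "inner (deriv01 (kap2 c) \<eta>) (kap2 c \<eta>) = 0"
    "inner (deriv01 (kap1 c) \<eta>) (kap2 c \<eta>) + inner (deriv01 (kap2 c) \<eta>) (kap1 c \<eta>) = 0"
    "inner (deriv01 (kap1 c) \<eta>) t = - inner (kap1 c \<eta>) (deriv01 (deriv01 (curve c)) \<eta>)"
    "inner (deriv01 (kap2 c) \<eta>) t = - inner (kap2 c \<eta>) (deriv01 (deriv01 (curve c)) \<eta>)"
proof -
  note d = C1_on01_D(3)[OF cable_okD(4)[OF c] \<eta>] C1_on01_D(3)[OF cable_okD(5)[OF c] \<eta>]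
    C1_on01_D(3)[OF cable_okD(6)[OF c] \<eta>]
  note f = cable_frame[OF c]
  show "inner (deriv01 (kap1 c) \<eta>) (kap1 c \<eta>) = 0"
    using inner_deriv_const[OF d(2) d(2) f(2) \<eta>] by (simp add: inner_commute)
  show "inner (deriv01 (kap2 c) \<eta>) (kap2 c \<eta>) = 0"
    using inner_deriv_const[OF d(3) d(3) f(3) \<eta>] by (simp add: inner_commute)
  show "inner (deriv01 (kap1 c) \<eta>) (kap2 c \<eta>) + inner (deriv01 (kap2 c) \<eta>) (kap1 c \<eta>) = 0"
    using inner_deriv_const[OF d(2) d(3) f(6) \<eta>] by (simp add: inner_commute)
  show "inner (deriv01 (kap1 c) \<eta>) t = - inner (kap1 c \<eta>) (deriv01 (deriv01 (curve c)) \<eta>)"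
    using inner_deriv_const[OF d(1) d(2) f(4) \<eta>] by (simp add: inner_commute t_def)
  show "inner (deriv01 (kap2 c) \<eta>) t = - inner (kap2 c \<eta>) (deriv01 (deriv01 (curve c)) \<eta>)"
    using inner_deriv_const[OF d(1) d(3) f(5) \<eta>] by (simp add: inner_commute t_def)
qed

text \<open>
  The first claim is the curvature bound: moving along the cable advances every point of the closed
  disc. The second holds because \<open>kap1\<close> and \<open>kap2\<close> stay orthonormal, so the distance from the centre
  curve does not change along the cable.
\<close>

lemma axial_properties:
  assumes c: "cable_ok c" and \<eta>: "\<eta> \<in> {0<..<1}" and ab: "(a, b) \<in> disc c"
  shows "inner (axial c (\<eta>, a, b)) (deriv01 (curve c) \<eta>) > 0"
    and "inner (axial c (\<eta>, a, b)) (a *\<^sub>R kap1 c \<eta> + b *\<^sub>R kap2 c \<eta>) = 0"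
proof -
  have \<eta>': "\<eta> \<in> {0..1}" using \<eta> by auto
  note f = cable_frame[OF c \<eta>'] and d = cable_frame_derivatives[OF c \<eta>]
  let ?w = "a *\<^sub>R kap1 c \<eta> + b *\<^sub>R kap2 c \<eta>" and ?a2 = "deriv01 (deriv01 (curve c)) \<eta>"
  have "(norm ?w)\<^sup>2 = a\<^sup>2 + b\<^sup>2"
    unfolding power2_norm_eq_inner using f inner_commute[of "kap2 c \<eta>" "kap1 c \<eta>"]
    by (simp add: inner_add_left inner_add_right power2_eq_square)
  also have "\<dots> \<le> (radius c)\<^sup>2" using ab by (simp add: disc_def)
  finally have "norm ?w \<le> radius c"
    using cable_okD(1)[OF c] by (simp add: power2_le_iff_abs_le)
  have "inner ?w ?a2 \<le> norm ?w * norm ?a2" by (rule norm_cauchy_schwarz)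
  also have "\<dots> \<le> radius c * norm ?a2"
    by (intro mult_right_mono norm_ge_zero) fact
  also have "\<dots> < (len c)\<^sup>2" using f(7) by (simp add: mult.commute)
  finally have "inner ?w ?a2 < (len c)\<^sup>2" .
  then show "inner (axial c (\<eta>, a, b)) (deriv01 (curve c) \<eta>) > 0"
    using f(1) d(4,5) by (simp add: axial_def inner_add_left algebra_simps)
  have "inner (axial c (\<eta>, a, b)) ?w = a * b * (inner (deriv01 (kap1 c) \<eta>) (kap2 c \<eta>) + inner (deriv01 (kap2 c) \<eta>) (kap1 c \<eta>))"
    using f(4,5) d(1,2) by (simp add: axial_def inner_add_left inner_add_right algebra_simps)
  then show "inner (axial c (\<eta>, a, b)) ?w = 0" using d(3) by simp
qed

section \<open>The tubular map\<close>

definition tube_deriv :: "cable \<Rightarrow> real \<times> real \<times> real \<Rightarrow> real \<times> real \<times> real \<Rightarrow> real^3" where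
  "tube_deriv c p = (\<lambda>(s, x, y). s *\<^sub>R axial c p + x *\<^sub>R kap1 c (fst p) + y *\<^sub>R kap2 c (fst p))"

lemma tube_has_derivative:
  assumes c: "cable_ok c" and \<eta>: "fst p \<in> {0<..<1}"
  shows "(tube c has_derivative tube_deriv c p) (at p)"
proof -
  obtain \<eta> a b where p: "p = (\<eta>, a, b)" by (cases p)
  have d: "(f has_vector_derivative deriv01 f \<eta>) (at \<eta>)" if "f \<in> {curve c, kap1 c, kap2 c}" for f
    using that C1_on01_D(3)[of f \<eta>] cable_okD(3,5,6)[OF c] \<eta> p by auto
  have d': "((\<lambda>q. f (fst q)) has_derivative (\<lambda>q. fst q *\<^sub>R deriv01 f \<eta>)) (at p)"
    if "f \<in> {curve c, kap1 c, kap2 c}" for f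
    using has_derivative_compose[of fst fst p UNIV f "\<lambda>s. s *\<^sub>R deriv01 f \<eta>"] d[OF that] p
    by (simp add: has_vector_derivative_def has_derivative_fst[OF has_derivative_ident])
  have "tube c = (\<lambda>q. curve c (fst q) + fst (snd q) *\<^sub>R kap1 c (fst q) + snd (snd q) *\<^sub>R kap2 c (fst q))"
    by (auto simp: tube_def)
  moreover have "((\<lambda>q. curve c (fst q) + fst (snd q) *\<^sub>R kap1 c (fst q) + snd (snd q) *\<^sub>R kap2 c (fst q))
     has_derivative (\<lambda>q. fst q *\<^sub>R deriv01 (curve c) \<eta>
       + (fst (snd p) *\<^sub>R (fst q *\<^sub>R deriv01 (kap1 c) \<eta>) + fst (snd q) *\<^sub>R kap1 c (fst p))
       + (snd (snd p) *\<^sub>R (fst q *\<^sub>R deriv01 (kap2 c) \<eta>) + snd (snd q) *\<^sub>R kap2 c (fst p)))) (at p)"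
    by (intro has_derivative_add has_derivative_scaleR d' has_derivative_fst has_derivative_snd
        has_derivative_ident) auto
  moreover have "(\<lambda>q. fst q *\<^sub>R deriv01 (curve c) \<eta>
       + (fst (snd p) *\<^sub>R (fst q *\<^sub>R deriv01 (kap1 c) \<eta>) + fst (snd q) *\<^sub>R kap1 c (fst p))
       + (snd (snd p) *\<^sub>R (fst q *\<^sub>R deriv01 (kap2 c) \<eta>) + snd (snd q) *\<^sub>R kap2 c (fst p)))
     = tube_deriv c p"
    by (auto simp: tube_deriv_def axial_def p fun_eq_iff scaleR_add_right mult.commute)
  ultimately show ?thesis by simp
qed

text \<open>
  The right inverse is what the open mapping theorem of Sussmann asks for; injectivity gives the lower
  bound that controls coordinates by positions.
\<close>

lemma tube_deriv_bij:
  assumes c: "cable_ok c" and \<eta>: "fst p \<in> {0<..<1}" and p: "snd p \<in> disc c"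
  shows "linear (tube_deriv c p)" "inj (tube_deriv c p)"
    "\<exists>g. bounded_linear g \<and> tube_deriv c p \<circ> g = id"
proof -
  show lin: "linear (tube_deriv c p)"
    using has_derivative_linear[OF tube_has_derivative[OF c \<eta>]] .
  obtain \<eta> a b where pp: "p = (\<eta>, a, b)" by (cases p)
  then have \<eta>1: "\<eta> \<in> {0<..<1}" "\<eta> \<in> {0..1}" and ab: "(a, b) \<in> disc c" using \<eta> p by auto
  note f = cable_frame[OF c \<eta>1(2)]
  note f' = inner_commute[of "kap2 c \<eta>" "kap1 c \<eta>"] inner_commute[of "kap1 c \<eta>" "deriv01 (curve c) \<eta>"]
      inner_commute[of "kap2 c \<eta>" "deriv01 (curve c) \<eta>"]
  let ?T = "axial c p" and ?t = "deriv01 (curve c) \<eta>"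
  have T: "inner ?T ?t > 0" using axial_properties(1)[OF c \<eta>1(1) ab] pp by simp
  have ker: "v = 0" if "tube_deriv c p v = 0" for v
  proof -
    obtain s x y where v: "v = (s, x, y)" by (cases v)
    have z: "s *\<^sub>R ?T + x *\<^sub>R kap1 c \<eta> + y *\<^sub>R kap2 c \<eta> = 0"
      using that by (simp add: tube_deriv_def v pp)
    have "s * inner ?T ?t = 0"
      using arg_cong[OF z, of "\<lambda>w. inner w ?t"] f f' by (simp add: inner_add_left)
    then have s: "s = 0" using T by simp
    moreover have "x = 0" using arg_cong[OF z, of "\<lambda>w. inner w (kap1 c \<eta>)"] f f' s by (simp add: inner_add_left)
    moreover have "y = 0" using arg_cong[OF z, of "\<lambda>w. inner w (kap2 c \<eta>)"] f f' s by (simp add: inner_add_left)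
    ultimately show ?thesis by (simp add: v zero_prod_def)
  qed
  then show "inj (tube_deriv c p)" by (simp add: linear_injective_0[OF lin])
  then have inj: "inj (tube_deriv c p)" .
  have "dim (range (tube_deriv c p)) = DIM(real^3)"
    using dim_image_eq[OF lin, of UNIV] inj by (simp add: dim_UNIV)
  then have "span (range (tube_deriv c p)) = UNIV" by (simp only: dim_eq_full)
  then have "surj (tube_deriv c p)"
    using span_eq_iff[of "range (tube_deriv c p)"] linear_subspace_image[OF lin subspace_UNIV] by simp
  then show "\<exists>g. bounded_linear g \<and> tube_deriv c p \<circ> g = id"
    using linear_surjective_right_inverse[OF lin] by (auto simp: linear_conv_bounded_linear)
qed

section \<open>The body of a cable and the outer normal\<close>

lemma polar_disc:
  assumes "(a, b) \<in> disc c" "radius c > 0"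
  obtains \<delta> \<theta> where "\<delta> \<in> {0..1}" "\<theta> \<in> {-pi<..pi}" "a = \<delta> * (radius c * sin \<theta>)" "b = \<delta> * (radius c * cos \<theta>)"
    "a\<^sup>2 + b\<^sup>2 = (radius c)\<^sup>2 \<Longrightarrow> \<delta> = 1"
proof -
  define s where "s = sqrt (a\<^sup>2 + b\<^sup>2)"
  have s: "0 \<le> s" "s\<^sup>2 = a\<^sup>2 + b\<^sup>2" by (auto simp: s_def)
  have sr: "s \<le> radius c"
    using assms s by (auto simp: disc_def intro: power2_le_imp_le)
  obtain \<theta>0 where t0: "a = s * sin \<theta>0" "b = s * cos \<theta>0"
  proof (cases "s = 0")
    case True
    then show ?thesis using s that[of 0] by (simp add: sum_power2_eq_zero_iff)
  next
    case False
    have "(b / s)\<^sup>2 + (a / s)\<^sup>2 = (a\<^sup>2 + b\<^sup>2) / s\<^sup>2"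
      by (simp add: power_divide add_divide_distrib)
    also have "\<dots> = s\<^sup>2 / s\<^sup>2" by (simp only: s(2))
    also have "\<dots> = 1" using False by simp
    finally have "(b / s)\<^sup>2 + (a / s)\<^sup>2 = 1" .
    then obtain t where "b / s = cos t" "a / s = sin t" using sincos_total_2pi by metis
    then show ?thesis using False that[of t] by (simp add: field_simps)
  qed
  obtain \<theta> where t: "- pi < \<theta>" "\<theta> \<le> pi" "sin \<theta> = sin \<theta>0" "cos \<theta> = cos \<theta>0"
    using sincos_principal_value[of \<theta>0] by blast
  show ?thesis
  proof (rule that[of "s / radius c" \<theta>])
    assume "a\<^sup>2 + b\<^sup>2 = (radius c)\<^sup>2"
    then show "s / radius c = 1" using assms(2) by (simp add: s_def)
  qed (use t t0 s sr assms(2) in auto)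
qed

lemma beta_in_disc: "\<delta> \<in> {0..1} \<Longrightarrow> (\<delta> * (radius c * sin \<theta>), \<delta> * (radius c * cos \<theta>)) \<in> disc c"
proof -
  assume d: "\<delta> \<in> {0..1}"
  have "(\<delta> * (radius c * sin \<theta>))\<^sup>2 + (\<delta> * (radius c * cos \<theta>))\<^sup>2 = (\<delta> * radius c)\<^sup>2 * ((sin \<theta>)\<^sup>2 + (cos \<theta>)\<^sup>2)"
    unfolding power_mult_distrib by (simp only: distrib_left mult.assoc)
  also have "\<dots> \<le> (radius c)\<^sup>2"
    using d by (simp add: power_mult_distrib mult_left_le_one_le power_le_one)
  finally show ?thesis by (simp add: disc_def)
qed

lemma tube_scaled: "tube c (\<eta>, \<delta> * (radius c * sin \<theta>), \<delta> * (radius c * cos \<theta>)) = curve c \<eta> + \<delta> *\<^sub>R beta c \<eta> \<theta>"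
  by (simp add: tube_def beta_def scaleR_add_right add.assoc)

lemma body_tube: assumes "radius c > 0" shows "body c = tube c ` ({0..1} \<times> disc c)"
proof (intro equalityI subsetI)
  fix x assume "x \<in> body c"
  then obtain \<delta> \<eta> \<theta> where "x = curve c \<eta> + \<delta> *\<^sub>R beta c \<eta> \<theta>" "\<delta> \<in> {0..1}" "\<eta> \<in> {0..1}"
    by (auto simp: body_def)
  then show "x \<in> tube c ` ({0..1} \<times> disc c)"
    using beta_in_disc[of \<delta> c \<theta>] by (intro image_eqI[of _ _ "(\<eta>, \<delta> * (radius c * sin \<theta>), \<delta> * (radius c * cos \<theta>))"])
       (auto simp: tube_scaled)
next
  fix x assume "x \<in> tube c ` ({0..1} \<times> disc c)"
  then obtain \<eta> a b where x: "x = tube c (\<eta>, a, b)" "\<eta> \<in> {0..1}" "(a, b) \<in> disc c" by auto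
  obtain \<delta> \<theta> where "\<delta> \<in> {0..1}" "\<theta> \<in> {-pi<..pi}" "a = \<delta> * (radius c * sin \<theta>)" "b = \<delta> * (radius c * cos \<theta>)"
    using polar_disc[OF x(3) assms] by blast
  then show "x \<in> body c" using x unfolding body_def by (auto simp: tube_scaled)
qed

lemma end_surface_tube: assumes "radius c > 0" "\<eta> \<in> {0, 1}" "p \<in> disc c"
  shows "tube c (\<eta>, p) \<in> end_surface c"
proof -
  obtain a b where p: "p = (a, b)" by (cases p)
  obtain \<delta> \<theta> where "\<delta> \<in> {0..1}" "\<theta> \<in> {-pi<..pi}" "a = \<delta> * (radius c * sin \<theta>)" "b = \<delta> * (radius c * cos \<theta>)"
    using polar_disc[of a b] assms p by blast
  then show ?thesis using p assms(2) unfolding end_surface_def by (auto simp: tube_scaled)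
qed

lemma continuous_on_tube: assumes "cable_ok c" shows "continuous_on ({0..1} \<times> UNIV) (tube c)"
proof -
  have "continuous_on ({0..1} \<times> UNIV) (\<lambda>p. f (fst p))" if "f \<in> {curve c, kap1 c, kap2 c}" for f
    using that C1_on01_D(1)[of f] cable_okD(3,5,6)[OF assms]
    by (intro continuous_on_compose2[of "{0..1}" f _ fst] continuous_intros) auto
  then show ?thesis
    unfolding tube_def split_beta by (intro continuous_intros) auto
qed

lemma disc_closed: "closed (disc c)"
  unfolding disc_def split_beta' case_prod_beta'
  by (intro closed_Collect_le continuous_intros)

lemma disc_compact: "compact (disc c)"
proof -
  have "norm p \<le> \<bar>radius c\<bar>" if "p \<in> disc c" for p
    using that by (auto simp: disc_def norm_Pair intro!: real_le_lsqrt)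
  then have "bounded (disc c)" unfolding bounded_iff by blast
  then show ?thesis using disc_closed by (simp add: compact_eq_bounded_closed)
qed

lemma compact_body: assumes "cable_ok c" shows "compact (body c)"
  unfolding body_tube[OF cable_okD(1)[OF assms]]
  by (intro compact_continuous_image continuous_on_subset[OF continuous_on_tube[OF assms]]
      compact_Times disc_compact) auto

lemma closure_body: assumes "cable_ok c" shows "closure (body c) = body c"
  using compact_body[OF assms] by (simp add: compact_imp_closed closure_closed)

lemma lat_subset_body: "cable_ok c \<Longrightarrow> lat_surface c \<subseteq> body c"
  using cable_okD(8)[of c] frontier_subset_closed[OF compact_imp_closed[OF compact_body]] by blast

lemma norm_beta:
  assumes c: "cable_ok c" and \<eta>: "\<eta> \<in> {0..1}"
  shows "norm (beta c \<eta> \<theta>) = radius c"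
proof -
  note f = cable_frame[OF c \<eta>]
  have "(norm (beta c \<eta> \<theta>))\<^sup>2 = (radius c)\<^sup>2 * ((sin \<theta>)\<^sup>2 + (cos \<theta>)\<^sup>2)"
    unfolding power2_norm_eq_inner beta_def
    using f(2,3,6) inner_commute[of "kap2 c \<eta>" "kap1 c \<eta>"]
    by (simp add: inner_add_left inner_add_right power2_eq_square distrib_left mult_ac del: sin_cos_squared_add3)
  then show ?thesis using cable_okD(1)[OF c] by simp
qed

lemma Phi_in_lat:
  assumes "\<eta> \<in> {0<..<1}" shows "Phi c (\<eta>, \<theta>) \<in> lat_surface c"
proof -
  obtain \<theta>' where "- pi < \<theta>'" "\<theta>' \<le> pi" "sin \<theta>' = sin \<theta>" "cos \<theta>' = cos \<theta>"
    using sincos_principal_value[of \<theta>] by blast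
  then show ?thesis
    using assms unfolding lat_surface_def by (intro image_eqI[of _ _ "(\<eta>, \<theta>')"]) (auto simp: Phi_tube)
qed

lemma tube_interior:
  assumes c: "cable_ok c" and \<eta>: "\<eta> \<in> {0<..<1}" and ab: "a\<^sup>2 + b\<^sup>2 < (radius c)\<^sup>2"
  shows "tube c (\<eta>, a, b) \<in> interior (body c)"
proof -
  let ?S = "{0<..<1::real} \<times> (UNIV :: (real \<times> real) set)"
  let ?D = "{p :: real \<times> real. (fst p)\<^sup>2 + (snd p)\<^sup>2 < (radius c)\<^sup>2}"
  let ?T = "{0<..<1::real} \<times> ?D"
  have oT: "open ?T" by (intro open_Times open_Collect_less continuous_intros)
  have oS: "open ?S" by (intro open_Times) auto
  have cont: "continuous_on ?S (tube c)"
    by (rule continuous_on_subset[OF continuous_on_tube[OF c]]) auto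
  have "(\<eta>, a, b) \<in> ?T" using \<eta> ab by simp
  then have int: "(\<eta>, a, b) \<in> interior ?T" by (simp only: interior_open[OF oT])
  obtain g where "bounded_linear g" "tube_deriv c (\<eta>, a, b) \<circ> g = id"
    using tube_deriv_bij(3)[OF c, of "(\<eta>, a, b)"] \<eta> ab by (auto simp: disc_def)
  then have "tube c (\<eta>, a, b) \<in> interior (tube c ` ?T)"
    using \<eta> by (intro sussmann_open_mapping[OF oS cont _ tube_has_derivative[OF c] _ _ _ int]) auto
  moreover have "tube c ` ?T \<subseteq> body c"
    unfolding body_tube[OF cable_okD(1)[OF c]] by (intro image_mono) (auto simp: disc_def)
  ultimately show ?thesis using interior_mono by blast
qed

text \<open>
  Injectivity of \<open>\<Phi>\<close> speaks only of the lateral surface itself. That a lateral point is not also an inner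
  point or an end point of some distant piece of the cable follows from the description of the
  frontier of the body: points with smaller radius are interior by the open mapping theorem.
\<close>

lemma lat_point_preimage:
  assumes c: "cable_ok c" and \<eta>: "\<eta> \<in> {0<..<1}" and \<theta>: "\<theta> \<in> {-pi<..pi}"
    and p: "p \<in> {0..1} \<times> disc c" and eq: "tube c p = Phi c (\<eta>, \<theta>)"
  shows "p = (\<eta>, radius c * sin \<theta>, radius c * cos \<theta>)"
proof -
  obtain \<eta>' a b where pp: "p = (\<eta>', a, b)" by (cases p)
  have r: "radius c > 0" by (rule cable_okD(1)[OF c])
  have lat: "Phi c (\<eta>, \<theta>) \<in> lat_surface c" by (rule Phi_in_lat[OF \<eta>])
  then have fr: "Phi c (\<eta>, \<theta>) \<in> frontier (body c)" "Phi c (\<eta>, \<theta>) \<notin> end_surface c"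
    using cable_okD(8,9)[OF c] by auto
  have ab: "(a, b) \<in> disc c" and "\<eta>' \<in> {0..1}" using p pp by auto
  have "\<eta>' \<notin> {0, 1}" using end_surface_tube[OF r _ ab, of \<eta>'] eq fr(2) pp by auto
  then have \<eta>': "\<eta>' \<in> {0<..<1}" using \<open>\<eta>' \<in> {0..1}\<close> by auto
  have "\<not> a\<^sup>2 + b\<^sup>2 < (radius c)\<^sup>2"
    using tube_interior[OF c \<eta>', of a b] eq fr(1) pp by (auto simp: frontier_def)
  then have "a\<^sup>2 + b\<^sup>2 = (radius c)\<^sup>2" using ab by (auto simp: disc_def)
  then obtain \<theta>' where \<theta>': "\<theta>' \<in> {-pi<..pi}" "a = radius c * sin \<theta>'" "b = radius c * cos \<theta>'"
    using polar_disc[OF ab r] by (metis mult_1)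
  then have "Phi c (\<eta>', \<theta>') = Phi c (\<eta>, \<theta>)" using eq pp by (simp add: Phi_tube)
  then have "(\<eta>', \<theta>') = (\<eta>, \<theta>)"
    using cable_okD(7)[OF c] \<eta> \<eta>' \<theta> \<theta>' by (auto dest!: inj_onD)
  then show ?thesis using pp \<theta>' by simp
qed

text \<open>
  Near a lateral point the body is, to first order, the half-space \<open>\<beta> \<bullet> (x - \<xi>) \<le> 0\<close>. In the coordinates
  of \<^const>\<open>tube\<close> the quantity \<open>\<beta> \<bullet> (x - \<xi>)\<close> is the radial displacement up to \<open>o(\<parallel>x - \<xi>\<parallel>)\<close>, and the
  squared radius is \<open>r\<^sup>2\<close> plus twice the radial displacement up to a quadratic error. That nearby
  points have coordinates near those of \<open>\<xi>\<close> is the open mapping theorem; that nearby points of the body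
  have no others is compactness together with \<open>lat_point_preimage\<close>.
\<close>

lemma body_cone:
  assumes c: "cable_ok c" and \<eta>: "\<eta> \<in> {0<..<1}" and \<theta>: "\<theta> \<in> {-pi<..pi}" and \<epsilon>: "\<epsilon> > 0"
  defines "\<xi> \<equiv> Phi c (\<eta>, \<theta>)"
  shows "\<exists>\<delta>>0. \<forall>x \<in> ball \<xi> \<delta>.
    (inner (x - \<xi>) (beta c \<eta> \<theta>) < - \<epsilon> * norm (x - \<xi>) \<longrightarrow> x \<in> body c) \<and>
    (inner (x - \<xi>) (beta c \<eta> \<theta>) > \<epsilon> * norm (x - \<xi>) \<longrightarrow> x \<notin> body c)"
proof -
  define r where "r = radius c"
  have r: "r > 0" using cable_okD(1)[OF c] by (simp add: r_def)
  define a0 b0 where "a0 = r * sin \<theta>" "b0 = r * cos \<theta>"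
  define p0 where "p0 = (\<eta>, a0, b0)"
  have circ: "a0\<^sup>2 + b0\<^sup>2 = r\<^sup>2"
    by (simp add: a0_b0_def power_mult_distrib distrib_left[symmetric])
  have d0: "(a0, b0) \<in> disc c" using circ by (simp add: disc_def r_def)
  have \<xi>: "\<xi> = tube c p0" by (simp add: \<xi>_def p0_def a0_b0_def r_def Phi_tube)
  have \<eta>1: "\<eta> \<in> {0..1}" using \<eta> by auto
  let ?D = "tube_deriv c p0" and ?b = "beta c \<eta> \<theta>"
  have b: "?b = a0 *\<^sub>R kap1 c \<eta> + b0 *\<^sub>R kap2 c \<eta>"
    by (simp add: beta_def a0_b0_def r_def scaleR_add_right)
  have fp: "fst p0 \<in> {0<..<1}" "snd p0 \<in> disc c" using \<eta> d0 by (auto simp: p0_def)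
  note der = tube_has_derivative[OF c fp(1)] and bij = tube_deriv_bij[OF c fp]
  note f = cable_frame[OF c \<eta>1]
  have Db: "inner (?D (s, x, y)) ?b = a0 * x + b0 * y" for s x y
  proof -
    have "inner (?D (s, x, y)) ?b = s * inner (axial c p0) ?b + x * inner (kap1 c \<eta>) ?b + y * inner (kap2 c \<eta>) ?b"
      by (simp add: tube_deriv_def p0_def inner_add_left)
    also have "inner (axial c p0) ?b = 0"
      using axial_properties(2)[OF c \<eta> d0] by (simp add: p0_def b)
    finally show ?thesis
      using f(2,3,6) inner_commute[of "kap2 c \<eta>" "kap1 c \<eta>"] by (simp add: b inner_add_right)
  qed
  have nb: "norm ?b = r" using norm_beta[OF c \<eta>1] by (simp add: r_def)
  obtain B where B: "B > 0" "\<And>v. B * norm v \<le> norm (?D v)"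
    using linear_inj_bounded_below_pos[OF bij(1,2)] by auto
  \<comment> \<open>linearization error: \<open>B / 2\<close> keeps the lower bound of the derivative, the other term fits the cone\<close>
  define \<sigma> where "\<sigma> = min (B / 2) (\<epsilon> * B / (4 * r))"
  have \<sigma>: "\<sigma> > 0" "\<sigma> \<le> B / 2" "r * \<sigma> * (2 / B) \<le> \<epsilon> / 2"
  proof -
    show "\<sigma> > 0" "\<sigma> \<le> B / 2" using B(1) \<epsilon> r by (auto simp: \<sigma>_def)
    have "r * \<sigma> * (2 / B) \<le> r * (\<epsilon> * B / (4 * r)) * (2 / B)"
      using r B(1) by (intro mult_right_mono mult_left_mono) (auto simp: \<sigma>_def)
    then show "r * \<sigma> * (2 / B) \<le> \<epsilon> / 2" using r B(1) by simp
  qed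
  obtain d where d: "d > 0" "\<And>p. norm (p - p0) < d \<Longrightarrow>
      norm (tube c p - tube c p0 - ?D (p - p0)) \<le> \<sigma> * norm (p - p0)"
    using der \<sigma>(1) unfolding has_derivative_at_alt by blast
  have low: "norm (p - p0) \<le> (2 / B) * norm (tube c p - \<xi>)" if "norm (p - p0) < d" for p
  proof -
    have "B * norm (p - p0) \<le> norm (?D (p - p0))" by (rule B)
    also have "\<dots> \<le> norm (tube c p - \<xi>) + norm (tube c p - tube c p0 - ?D (p - p0))"
      using norm_triangle_ineq4[of "tube c p - \<xi>" "tube c p - tube c p0 - ?D (p - p0)"] by (simp add: \<xi>)
    also have "norm (tube c p - tube c p0 - ?D (p - p0)) \<le> \<sigma> * norm (p - p0)" by (rule d(2)[OF that])
    also have "\<sigma> * norm (p - p0) \<le> (B / 2) * norm (p - p0)" by (intro mult_right_mono \<sigma>) auto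
    finally show ?thesis using B(1) by (simp add: field_simps)
  qed
  have radial: "\<bar>inner (tube c (s, x, y) - \<xi>) ?b - (a0 * (x - a0) + b0 * (y - b0))\<bar> \<le> \<epsilon> / 2 * norm (tube c (s, x, y) - \<xi>)"
    if "norm ((s, x, y) - p0) < d" for s x y
  proof -
    let ?p = "(s, x, y)"
    have "inner (tube c ?p - \<xi>) ?b - (a0 * (x - a0) + b0 * (y - b0)) = inner (tube c ?p - tube c p0 - ?D (?p - p0)) ?b"
      using Db[of "s - \<eta>" "x - a0" "y - b0"] by (simp add: inner_diff_left \<xi> p0_def)
    then have "\<bar>inner (tube c ?p - \<xi>) ?b - (a0 * (x - a0) + b0 * (y - b0))\<bar> \<le> norm (tube c ?p - tube c p0 - ?D (?p - p0)) * r"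
      using Cauchy_Schwarz_ineq2[of "tube c ?p - tube c p0 - ?D (?p - p0)" ?b] nb by simp
    also have "\<dots> \<le> \<sigma> * norm (?p - p0) * r" using r by (intro mult_right_mono d(2) that) auto
    also have "\<dots> \<le> \<sigma> * ((2 / B) * norm (tube c ?p - \<xi>)) * r"
      using r \<sigma>(1) by (intro mult_right_mono mult_left_mono low that) auto
    also have "\<dots> = (r * \<sigma> * (2 / B)) * norm (tube c ?p - \<xi>)" by simp
    also have "\<dots> \<le> \<epsilon> / 2 * norm (tube c ?p - \<xi>)" by (intro mult_right_mono \<sigma>) auto
    finally show ?thesis .
  qed
  have quad: "x\<^sup>2 + y\<^sup>2 - r\<^sup>2 = 2 * (a0 * (x - a0) + b0 * (y - b0)) + ((x - a0)\<^sup>2 + (y - b0)\<^sup>2)" for x y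
    using circ by (simp add: power2_eq_square algebra_simps)
  \<comment> \<open>every point near \<open>\<xi>\<close> has tubular coordinates near \<open>p0\<close>\<close>
  let ?S = "{0<..<1::real} \<times> (UNIV :: (real \<times> real) set)"
  let ?T = "?S \<inter> ball p0 d"
  have oS: "open ?S" by (intro open_Times) auto
  then have oT: "open ?T" by (intro open_Int) auto
  have cont: "continuous_on ?S (tube c)"
    by (rule continuous_on_subset[OF continuous_on_tube[OF c]]) auto
  have "p0 \<in> ?T" using fp d(1) by (auto simp: p0_def)
  then have int: "p0 \<in> interior ?T" by (simp only: interior_open[OF oT])
  obtain g where "bounded_linear g" "?D \<circ> g = id" using bij(3) by auto
  then have "\<xi> \<in> interior (tube c ` ?T)"
    unfolding \<xi> using \<open>p0 \<in> ?T\<close>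
    by (intro sussmann_open_mapping[OF oS cont _ der _ _ _ int]) auto
  then obtain \<delta>1 where \<delta>1: "\<delta>1 > 0" "ball \<xi> \<delta>1 \<subseteq> tube c ` ?T"
    unfolding mem_interior by blast
  \<comment> \<open>and points of the body near \<open>\<xi>\<close> have no other coordinates\<close>
  let ?K = "({0..1} \<times> disc c) - ball p0 d"
  have "compact ?K" by (intro compact_diff compact_Times disc_compact) auto
  then have "compact (tube c ` ?K)"
    by (intro compact_continuous_image continuous_on_subset[OF continuous_on_tube[OF c]]) auto
  then have "open (- (tube c ` ?K))" using compact_imp_closed open_Compl by blast
  moreover have "\<xi> \<in> - (tube c ` ?K)"
    using lat_point_preimage[OF c \<eta> \<theta>] d(1) by (auto simp: \<xi>_def p0_def a0_b0_def r_def)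
  ultimately obtain \<delta>2 where \<delta>2: "\<delta>2 > 0" "ball \<xi> \<delta>2 \<subseteq> - (tube c ` ?K)"
    unfolding open_contains_ball by blast
  define \<delta> where "\<delta> = min (min \<delta>1 \<delta>2) (\<epsilon> * B\<^sup>2 / 4)"
  show ?thesis
  proof (intro exI[of _ \<delta>] conjI ballI impI)
    show "\<delta> > 0" using \<delta>1 \<delta>2 \<epsilon> B by (simp add: \<delta>_def)
  next
    fix z assume z: "z \<in> ball \<xi> \<delta>" and cone: "inner (z - \<xi>) ?b < - \<epsilon> * norm (z - \<xi>)"
    then obtain s x y where p: "z = tube c (s, x, y)" "s \<in> {0<..<1}" "norm ((s, x, y) - p0) < d"
      using \<delta>1(2) by (auto simp: \<delta>_def dist_norm norm_minus_commute subset_iff)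
    define N where "N = norm (z - \<xi>)"
    have N: "0 \<le> N" "N \<le> \<epsilon> * B\<^sup>2 / 4" using z by (auto simp: N_def \<delta>_def dist_norm norm_minus_commute)
    have 1: "2 * (a0 * (x - a0) + b0 * (y - b0)) \<le> - \<epsilon> * N"
    proof -
      define S where "S = a0 * (x - a0) + b0 * (y - b0)"
      have "S \<le> inner (z - \<xi>) ?b + (\<epsilon> * N) / 2"
        using radial[OF p(3)] unfolding p(1)[symmetric] N_def[symmetric] S_def[symmetric] abs_le_iff by simp
      moreover have "inner (z - \<xi>) ?b < - (\<epsilon> * N)" using cone by (simp add: N_def)
      ultimately show ?thesis unfolding S_def[symmetric] by simp
    qed
    have "(x - a0)\<^sup>2 + (y - b0)\<^sup>2 \<le> (norm ((s, x, y) - p0))\<^sup>2"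
      by (simp add: p0_def norm_Pair)
    also have "\<dots> \<le> ((2 / B) * N)\<^sup>2"
      using low[OF p(3)] unfolding p(1)[symmetric] N_def[symmetric] by (intro power_mono) auto
    also have "\<dots> = (4 / B\<^sup>2) * N * N" by (simp add: power2_eq_square)
    also have "\<dots> \<le> \<epsilon> * N"
    proof (intro mult_right_mono)
      have "(4 / B\<^sup>2) * N \<le> (4 / B\<^sup>2) * (\<epsilon> * B\<^sup>2 / 4)" using N by (intro mult_left_mono) auto
      then show "(4 / B\<^sup>2) * N \<le> \<epsilon>" using B by simp
    qed (rule N)
    finally have "x\<^sup>2 + y\<^sup>2 \<le> r\<^sup>2" using quad[of x y] 1 by linarith
    then have "(s, x, y) \<in> {0..1} \<times> disc c" using p(2) by (auto simp: disc_def r_def)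
    then show "z \<in> body c" unfolding body_tube[OF cable_okD(1)[OF c]] p(1) by (rule imageI)
  next
    fix z assume z: "z \<in> ball \<xi> \<delta>" and cone: "inner (z - \<xi>) ?b > \<epsilon> * norm (z - \<xi>)"
    show "z \<notin> body c"
    proof
      assume "z \<in> body c"
      then obtain s x y where p: "z = tube c (s, x, y)" "(s, x, y) \<in> {0..1} \<times> disc c"
        unfolding body_tube[OF cable_okD(1)[OF c]] by auto
      have "z \<notin> tube c ` ?K" using z \<delta>2(2) by (auto simp: \<delta>_def)
      then have pd: "norm ((s, x, y) - p0) < d" using p by (auto simp: dist_norm norm_minus_commute)
      have "x\<^sup>2 + y\<^sup>2 \<le> r\<^sup>2" using p(2) by (simp add: disc_def r_def)
      then have "2 * (a0 * (x - a0) + b0 * (y - b0)) \<le> 0"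
        using quad[of x y] zero_le_power2[of "x - a0"] zero_le_power2[of "y - b0"] by linarith
      have "inner (z - \<xi>) ?b \<le> \<epsilon> / 2 * norm (z - \<xi>)"
      proof -
        define S where "S = a0 * (x - a0) + b0 * (y - b0)"
        have "inner (z - \<xi>) ?b \<le> S + \<epsilon> / 2 * norm (z - \<xi>)"
          using radial[OF pd] unfolding p(1)[symmetric] S_def[symmetric] abs_le_iff by simp
        moreover have "S \<le> 0" using \<open>2 * (a0 * (x - a0) + b0 * (y - b0)) \<le> 0\<close> unfolding S_def[symmetric] by simp
        ultimately show ?thesis by linarith
      qed
      moreover have "\<epsilon> / 2 * norm (z - \<xi>) \<le> \<epsilon> * norm (z - \<xi>)"
        using \<epsilon> by (intro mult_right_mono) auto
      ultimately show False using cone by linarith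
    qed
  qed
qed

text \<open>
  The direction \<open>n' - n\<close> points into \<open>\<Omega>\<close> according to \<open>n\<close> and out of it according to \<open>n'\<close>.
\<close>

lemma is_outer_normal_unique:
  assumes "is_outer_normal \<Omega> \<xi> n" "is_outer_normal \<Omega> \<xi> n'" shows "n = n'"
proof (rule ccontr)
  assume ne: "n \<noteq> n'"
  have nn: "inner n n = 1" "inner n' n' = 1"
    using assms by (auto simp: is_outer_normal_def power2_norm_eq_inner[symmetric])
  define k where "k = inner n n'"
  have "inner (n' - n) (n' - n) > 0" using ne by simp
  then have k: "1 - k > 0" using nn by (simp add: inner_diff_left inner_diff_right k_def inner_commute)
  define v where "v = n' - n"
  have v: "inner v n = - (1 - k)" "inner v n' = 1 - k" "norm v > 0"
    using ne nn by (auto simp: v_def inner_diff_left k_def inner_commute[of n' n])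
  define e where "e = (1 - k) / (2 * norm v)"
  have e: "e > 0" "e * norm v < 1 - k" using k v by (auto simp: e_def)
  obtain d1 where d1: "d1 > 0" "\<And>x. x \<in> ball \<xi> d1 \<Longrightarrow> inner (x - \<xi>) n < - e * norm (x - \<xi>) \<Longrightarrow> x \<in> \<Omega>"
    using assms(1) e(1) unfolding is_outer_normal_def by blast
  obtain d2 where d2: "d2 > 0" "\<And>x. x \<in> ball \<xi> d2 \<Longrightarrow> inner (x - \<xi>) n' > e * norm (x - \<xi>) \<Longrightarrow> x \<notin> \<Omega>"
    using assms(2) e(1) unfolding is_outer_normal_def by blast
  define s where "s = min d1 d2 / (2 * norm v)"
  have s: "s > 0" using d1 d2 v by (simp add: s_def)
  have "s * norm v < d1" "s * norm v < d2" using d1 d2 v by (auto simp: s_def min_def)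
  then have b: "\<xi> + s *\<^sub>R v \<in> ball \<xi> d1" "\<xi> + s *\<^sub>R v \<in> ball \<xi> d2" using s by (auto simp: dist_norm)
  have "s * (e * norm v) < s * (1 - k)" using s e by simp
  then have "\<xi> + s *\<^sub>R v \<in> \<Omega>" "\<xi> + s *\<^sub>R v \<notin> \<Omega>"
    using d1(2)[OF b(1)] d2(2)[OF b(2)] v s by (auto simp: algebra_simps)
  then show False by simp
qed

lemma outer_region_eq:
  assumes "geometry \<Omega>0 c"
  shows "outer_region \<Omega>0 c = \<Omega>0 - (\<Union>i. body (c i))"
  using assms closure_body by (auto simp: outer_region_def geometry_def)

lemma disjoint_bodies:
  assumes "geometry \<Omega>0 c" "\<xi> \<in> body (c i)" "\<xi> \<in> body (c j)" shows "i = j"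
proof (rule ccontr)
  assume "i \<noteq> j"
  then have "closure (body (c i)) \<inter> closure (body (c j)) = {}" using assms(1) by (simp add: geometry_def)
  then show False using assms(2,3) closure_subset by blast
qed

lemma near_one_body:
  fixes c :: "'k::finite \<Rightarrow> cable"
  assumes g: "geometry \<Omega>0 c" and \<xi>: "\<xi> \<in> body (c i)"
  obtains W where "open W" "\<xi> \<in> W" "\<forall>x\<in>W. x \<in> outer_region \<Omega>0 c \<longleftrightarrow> x \<notin> body (c i)"
proof
  let ?W = "\<Omega>0 - (\<Union>j\<in>-{i}. body (c j))"
  show "open ?W"
    using g by (intro open_Diff closed_UN) (auto simp: geometry_def lipschitz_domain_def compact_body compact_imp_closed)
  have "body (c i) \<subseteq> \<Omega>0" using g closure_subset[of "body (c i)"] by (auto simp: geometry_def)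
  moreover have "\<xi> \<notin> body (c j)" if "j \<noteq> i" for j using disjoint_bodies[OF g \<xi>, of j] that by blast
  ultimately show "\<xi> \<in> ?W" using \<xi> by blast
  show "\<forall>x\<in>?W. x \<in> outer_region \<Omega>0 c \<longleftrightarrow> x \<notin> body (c i)"
    unfolding outer_region_eq[OF g] by (metis Compl_iff DiffD1 DiffD2 DiffI UN_E UN_I UNIV_I singletonD)
qed

text \<open>
  The normal points out of \<open>\<Omega>\<close>, that is into the cable, whence the sign.
\<close>

lemma outer_normal_lat:
  fixes c :: "'k::finite \<Rightarrow> cable"
  assumes g: "geometry \<Omega>0 c" and \<eta>: "\<eta> \<in> {0<..<1}" and \<theta>: "\<theta> \<in> {-pi<..pi}"
  shows "outer_normal (outer_region \<Omega>0 c) (Phi (c i) (\<eta>, \<theta>)) = - (1 / radius (c i)) *\<^sub>R beta (c i) \<eta> \<theta>"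
proof -
  have c: "cable_ok (c j)" for j using g by (simp add: geometry_def)
  have r: "radius (c i) > 0" by (rule cable_okD(1)[OF c])
  let ?\<Omega> = "outer_region \<Omega>0 c" and ?\<xi> = "Phi (c i) (\<eta>, \<theta>)" and ?b = "beta (c i) \<eta> \<theta>"
  let ?n = "- (1 / radius (c i)) *\<^sub>R ?b"
  have "\<eta> \<in> {0..1}" using \<eta> by auto
  then have nb: "norm ?b = radius (c i)" by (intro norm_beta c)
  have "?\<xi> \<in> body (c i)" using lat_subset_body[OF c] Phi_in_lat[OF \<eta>] by blast
  then obtain W where W: "open W" "?\<xi> \<in> W" "\<forall>x\<in>W. x \<in> ?\<Omega> \<longleftrightarrow> x \<notin> body (c i)"
    using near_one_body[OF g] by blast
  then obtain \<delta>0 where \<delta>0: "\<delta>0 > 0" "ball ?\<xi> \<delta>0 \<subseteq> W"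
    unfolding open_contains_ball by blast
  have \<Omega>: "x \<in> ?\<Omega> \<longleftrightarrow> x \<notin> body (c i)" if "x \<in> ball ?\<xi> \<delta>0" for x
    using W(3) subsetD[OF \<delta>0(2) that] by simp
  have N: "is_outer_normal ?\<Omega> ?\<xi> ?n"
    unfolding is_outer_normal_def
  proof (intro conjI allI impI)
    show "norm ?n = 1" using nb r by simp
    fix \<epsilon> :: real assume "\<epsilon> > 0"
    then have "\<epsilon> * radius (c i) > 0" using r by simp
    from body_cone[OF c[of i] \<eta> \<theta> this] obtain \<delta> where \<delta>: "\<delta> > 0"
      "\<forall>x\<in>ball ?\<xi> \<delta>. (inner (x - ?\<xi>) ?b < - (\<epsilon> * radius (c i)) * norm (x - ?\<xi>) \<longrightarrow> x \<in> body (c i)) \<and>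
        (inner (x - ?\<xi>) ?b > \<epsilon> * radius (c i) * norm (x - ?\<xi>) \<longrightarrow> x \<notin> body (c i))"
      by (elim exE conjE)
    show "\<exists>\<delta>>0. \<forall>x\<in>ball ?\<xi> \<delta>. (inner (x - ?\<xi>) ?n < - \<epsilon> * norm (x - ?\<xi>) \<longrightarrow> x \<in> ?\<Omega>) \<and>
        (inner (x - ?\<xi>) ?n > \<epsilon> * norm (x - ?\<xi>) \<longrightarrow> x \<notin> ?\<Omega>)"
    proof (intro exI[of _ "min \<delta> \<delta>0"] conjI ballI impI)
      fix x assume x: "x \<in> ball ?\<xi> (min \<delta> \<delta>0)"
      { assume "inner (x - ?\<xi>) ?n < - \<epsilon> * norm (x - ?\<xi>)"
        then have "inner (x - ?\<xi>) ?b > \<epsilon> * radius (c i) * norm (x - ?\<xi>)"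
          using r by (simp add: field_simps)
        then show "x \<in> ?\<Omega>" using bspec[OF \<delta>(2), of x] \<Omega>[of x] x by simp }
      { assume "inner (x - ?\<xi>) ?n > \<epsilon> * norm (x - ?\<xi>)"
        then have "inner (x - ?\<xi>) ?b < - (\<epsilon> * radius (c i)) * norm (x - ?\<xi>)"
          using r by (simp add: field_simps)
        then show "x \<notin> ?\<Omega>" using bspec[OF \<delta>(2), of x] \<Omega>[of x] x by simp }
    qed (use \<delta>(1) \<delta>0(1) in simp)
  qed
  show ?thesis
    unfolding outer_normal_def by (rule the_equality[where P="is_outer_normal ?\<Omega> ?\<xi>"]) (use N is_outer_normal_unique in blast)+
qed

section \<open>The pseudoinverse of the parametrization gradient\<close>

lemma cmat_mult: "cmat (A ** B) = cmat A ** cmat B"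
  by (simp add: cmat_def matrix_matrix_mult_def vec_eq_iff)

lemma adj_cmat: "adj (cmat A) = cmat (Finite_Cartesian_Product.transpose A)"
  by (simp add: cmat_def adj_def transpose_def vec_eq_iff)

lemma pinv_eqI:
  fixes A :: "complex^'n^'m"
  assumes X: "A ** X ** A = A" "X ** A ** X = X" "adj (A ** X) = A ** X" "adj (X ** A) = X ** A"
  shows "pinv A = X"
  unfolding pinv_def
proof (rule the_equality)
  fix Y assume "A ** Y ** A = A \<and> Y ** A ** Y = Y \<and> adj (A ** Y) = A ** Y \<and> adj (Y ** A) = Y ** A"
  then have Y: "A ** Y ** A = A" "Y ** A ** Y = Y" "adj (A ** Y) = A ** Y" "adj (Y ** A) = Y ** A" by auto
  have "A ** X = (A ** Y) ** (A ** X)" using Y(1) by (simp add: matrix_mul_assoc)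
  then have "A ** X = adj ((A ** Y) ** (A ** X))" using X(3) by simp
  also have "\<dots> = (A ** X) ** (A ** Y)" by (simp add: adj_matrix_mult[of "A ** Y" "A ** X"] X(3) Y(3))
  also have "\<dots> = A ** Y" using X(1) by (simp add: matrix_mul_assoc)
  finally have AX: "A ** X = A ** Y" .
  have "X ** A = (X ** A) ** (Y ** A)" using Y(1) by (metis matrix_mul_assoc)
  then have "X ** A = adj ((X ** A) ** (Y ** A))" using X(4) by simp
  also have "\<dots> = (Y ** A) ** (X ** A)" by (simp add: adj_matrix_mult[of "X ** A" "Y ** A"] X(4) Y(4))
  also have "\<dots> = Y ** A" using X(1) by (metis matrix_mul_assoc)
  finally have XA: "X ** A = Y ** A" .
  show "Y = X" by (metis AX XA X(2) Y(2) matrix_mul_assoc)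
qed (use X in auto)

text \<open>
  For independent rows \<open>a\<close>, \<open>b\<close> the columns of the pseudoinverse are the basis of the plane of \<open>a\<close> and
  \<open>b\<close> that is dual to \<open>(a, b)\<close>; the cross products below are this dual basis.
\<close>

lemma pinv_two_rows:
  fixes a b :: "real^3"
  defines "n \<equiv> cross3 a b"
  assumes "n \<noteq> 0"
  shows "pinv (cmat (vector [a, b] :: real^3^2)) *v vector [f, 0] =
    f *s cvec ((1 / inner n n) *\<^sub>R cross3 b n)"
proof -
  define A :: "real^3^2" where "A = vector [a, b]"
  define D where "D = inner n n"
  have D: "D \<noteq> 0" using assms(2) by (simp add: D_def)
  define X :: "real^2^3" where "X = Finite_Cartesian_Product.transpose (vector [(1 / D) *\<^sub>R cross3 b n, (1 / D) *\<^sub>R cross3 n a])"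
  have ip: "inner a (cross3 b n) = D" "inner b (cross3 n a) = D" "inner a (cross3 n a) = 0" "inner b (cross3 b n) = 0"
    by (simp_all add: D_def n_def cross3_def inner_vec_def sum_3 vector_3 algebra_simps)
  have AX: "A ** X = mat 1"
  proof -
    have "(A ** X) $ i $ j = inner (A $ i) (Finite_Cartesian_Product.transpose X $ j)" for i j
      by (simp add: matrix_matrix_mult_def inner_vec_def transpose_def)
    then show ?thesis
      using ip D by (simp add: vec_eq_iff mat_def forall_2 A_def X_def vector_2)
  qed
  have XA: "Finite_Cartesian_Product.transpose (X ** A) = X ** A"
  proof -
    have "cross3 b n $ i * a $ j + cross3 n a $ i * b $ j = cross3 b n $ j * a $ i + cross3 n a $ j * b $ i" for i j
      using exhaust_3[of i] exhaust_3[of j]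
      by (auto simp: n_def cross3_def vector_3 algebra_simps)
    moreover have "(X ** A) $ i $ j = (1 / D) * (cross3 b n $ i * a $ j + cross3 n a $ i * b $ j)" for i j
      by (simp add: matrix_matrix_mult_def sum_2 A_def X_def transpose_def vector_2 algebra_simps)
    ultimately show ?thesis by (simp add: transpose_def vec_eq_iff)
  qed
  have c1: "cmat (mat 1 :: real^2^2) = mat 1" by (simp add: cmat_def mat_def vec_eq_iff)
  have "pinv (cmat A) = cmat X"
    by (rule pinv_eqI)
       (simp_all add: cmat_mult[symmetric] adj_cmat AX XA c1[symmetric] transpose_mat matrix_mul_assoc[symmetric])
  moreover have "cmat X *v vector [f, 0] = f *s cvec ((1 / D) *\<^sub>R cross3 b n)"
    by (simp add: vec_eq_iff matrix_vector_mult_def sum_2 vector_2 cmat_def cvec_def X_def transpose_def)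
  ultimately show ?thesis by (simp add: A_def D_def)
qed

section \<open>The lateral parametrization\<close>

definition ring_pt :: "cable \<Rightarrow> real \<times> real \<Rightarrow> real \<times> real \<times> real" where
  "ring_pt c = (\<lambda>(\<eta>, \<theta>). (\<eta>, radius c * sin \<theta>, radius c * cos \<theta>))"

text \<open>
  This is the norm of the cross product of the two partial derivatives of \<^const>\<open>Phi\<close>, in a form that
  shows its positivity.
\<close>

definition area :: "cable \<Rightarrow> real \<times> real \<Rightarrow> real" where
  "area c x = radius c * (inner (axial c (ring_pt c x)) (deriv01 (curve c) (fst x)) / len c)"

lemma Phi_ring: "Phi c x = tube c (ring_pt c x)"
  by (cases x) (simp add: ring_pt_def Phi_tube)

lemma ring_pt_disc: "snd (ring_pt c x) \<in> disc c" "fst (ring_pt c x) = fst x"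
  using beta_in_disc[of 1 c "snd x"] by (auto simp: ring_pt_def split_beta)

lemma beta'_eq: "beta' c \<eta> \<theta> = radius c *\<^sub>R (cos \<theta> *\<^sub>R kap1 c \<eta> - sin \<theta> *\<^sub>R kap2 c \<eta>)"
  unfolding beta'_def beta_def
  by (rule vector_derivative_at) (auto intro!: derivative_eq_intros simp: algebra_simps)

lemma Phi_has_derivative:
  assumes c: "cable_ok c" and \<eta>: "fst x \<in> {0<..<1}"
  shows "(Phi c has_derivative (\<lambda>h. fst h *\<^sub>R axial c (ring_pt c x) + snd h *\<^sub>R beta' c (fst x) (snd x))) (at x)"
proof -
  have "(ring_pt c has_derivative (\<lambda>h. (fst h, snd h * (radius c * cos (snd x)), - (snd h * (radius c * sin (snd x)))))) (at x)"
    unfolding ring_pt_def split_beta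
    by (auto intro!: derivative_eq_intros simp: fun_eq_iff algebra_simps)
  from diff_chain_at[OF this, of "tube c" "tube_deriv c (ring_pt c x)"] tube_has_derivative[OF c, of "ring_pt c x"] \<eta>
  have "(tube c \<circ> ring_pt c has_derivative (tube_deriv c (ring_pt c x) \<circ>
     (\<lambda>h. (fst h, snd h * (radius c * cos (snd x)), - (snd h * (radius c * sin (snd x))))))) (at x)"
    by (simp add: ring_pt_disc)
  moreover have "tube c \<circ> ring_pt c = Phi c" by (auto simp: fun_eq_iff Phi_ring)
  moreover have "tube_deriv c (ring_pt c x) \<circ>
     (\<lambda>h. (fst h, snd h * (radius c * cos (snd x)), - (snd h * (radius c * sin (snd x)))))
    = (\<lambda>h. fst h *\<^sub>R axial c (ring_pt c x) + snd h *\<^sub>R beta' c (fst x) (snd x))"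
    by (auto simp: fun_eq_iff tube_deriv_def beta'_eq ring_pt_disc algebra_simps)
  ultimately show ?thesis by simp
qed

lemma area_pos:
  assumes c: "cable_ok c" and \<eta>: "fst x \<in> {0<..<1}"
  shows "area c x > 0"
proof -
  obtain a b where p: "ring_pt c x = (fst x, a, b)" "(a, b) \<in> disc c"
    using ring_pt_disc[of c x] by (cases "ring_pt c x") auto
  show ?thesis
    using axial_properties(1)[OF c \<eta> p(2)] cable_okD(1,2)[OF c] by (simp add: area_def p(1))
qed

text \<open>
  The axial derivative has no radial component, and its component along the circle is parallel to
  \<open>beta'\<close>. Only its tangential part \<open>T \<bullet> e\<close> contributes, and \<open>e \<times> beta' = beta\<close> by the orientation
  of the frame.
\<close>

lemma cross_axial:
  assumes c: "cable_ok c" and \<eta>: "\<eta> \<in> {0<..<1}"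
  shows "cross3 (axial c (ring_pt c (\<eta>, \<theta>))) (beta' c \<eta> \<theta>) = (area c (\<eta>, \<theta>) / radius c) *\<^sub>R beta c \<eta> \<theta>"
proof -
  have \<eta>': "\<eta> \<in> {0..1}" using \<eta> by auto
  note f = cable_frame[OF c \<eta>']
  define l where "l = len c"
  have l: "l > 0" using cable_okD(2)[OF c] by (simp add: l_def)
  have r: "radius c > 0" using cable_okD(1)[OF c] .
  define e where "e = (1 / l) *\<^sub>R deriv01 (curve c) \<eta>"
  define k1 k2 where "k1 = kap1 c \<eta>" "k2 = kap2 c \<eta>"
  define T where "T = axial c (ring_pt c (\<eta>, \<theta>))"
  have o: "inner e e = 1" "inner k1 k1 = 1" "inner k2 k2 = 1" "inner e k1 = 0" "inner e k2 = 0" "inner k1 k2 = 0"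
    "inner e (cross3 k1 k2) = 1"
    using f l by (auto simp: e_def k1_k2_def l_def power2_eq_square)
  note x = oriented_triple[OF o]
  have "(radius c * sin \<theta>, radius c * cos \<theta>) \<in> disc c" using ring_pt_disc(1)[of c "(\<eta>, \<theta>)"] by (simp add: ring_pt_def)
  from axial_properties(2)[OF c \<eta> this]
  have "radius c * (inner T k1 * sin \<theta> + inner T k2 * cos \<theta>) = 0"
    by (simp add: T_def ring_pt_def k1_k2_def inner_add_right algebra_simps)
  then have T0: "inner T k1 * sin \<theta> + inner T k2 * cos \<theta> = 0" using r by simp
  have cr: "cross3 k2 k1 = - e" using x(1) by (metis cross_skew)
  have "cross3 T (cos \<theta> *\<^sub>R k1 - sin \<theta> *\<^sub>R k2) =
      cross3 (inner T e *\<^sub>R e + inner T k1 *\<^sub>R k1 + inner T k2 *\<^sub>R k2) (cos \<theta> *\<^sub>R k1 - sin \<theta> *\<^sub>R k2)"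
    using orthonormal_triple[OF o(1-6), of T] by simp
  also have "\<dots> = inner T e *\<^sub>R (sin \<theta> *\<^sub>R k1 + cos \<theta> *\<^sub>R k2) - (inner T k1 * sin \<theta> + inner T k2 * cos \<theta>) *\<^sub>R e"
    by (simp add: cross_add_left Cross3.right_diff_distrib cross_mult_left cross_mult_right x cr algebra_simps)
  finally have *: "cross3 T (cos \<theta> *\<^sub>R k1 - sin \<theta> *\<^sub>R k2) = inner T e *\<^sub>R (sin \<theta> *\<^sub>R k1 + cos \<theta> *\<^sub>R k2)"
    using T0 by simp
  have "area c (\<eta>, \<theta>) / radius c = inner T e"
    using r by (simp add: area_def T_def e_def l_def)
  moreover have "beta c \<eta> \<theta> = radius c *\<^sub>R (sin \<theta> *\<^sub>R k1 + cos \<theta> *\<^sub>R k2)" by (simp add: beta_def k1_k2_def)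
  ultimately show ?thesis
    using * by (simp add: beta'_eq cross_mult_right k1_k2_def T_def)
qed

lemma area_elem_Phi:
  assumes c: "cable_ok c" and \<eta>: "fst x \<in> {0<..<1}"
  shows "area_elem (Phi c) x = area c x"
proof -
  obtain \<eta> \<theta> where x: "x = (\<eta>, \<theta>)" by (cases x)
  have "norm (beta c \<eta> \<theta>) = radius c" using norm_beta[OF c] \<eta> x by simp
  then show ?thesis
    unfolding area_elem_def frechet_derivative_at[OF Phi_has_derivative[OF c \<eta>], symmetric]
    using cross_axial[OF c, of \<eta> \<theta>] area_pos[OF c \<eta>] cable_okD(1)[OF c] \<eta> x by simp
qed

lemma grad_Phi_eq:
  assumes c: "cable_ok c" and \<eta>: "\<eta> \<in> {0<..<1}"
  shows "grad_Phi c (\<eta>, \<theta>) = vector [axial c (ring_pt c (\<eta>, \<theta>)), beta' c \<eta> \<theta>]"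
proof -
  have d: "(Phi c has_derivative (\<lambda>h. fst h *\<^sub>R axial c (ring_pt c (\<eta>, \<theta>)) + snd h *\<^sub>R beta' c \<eta> \<theta>)) (at (\<eta>, \<theta>))"
    using Phi_has_derivative[OF c, of "(\<eta>, \<theta>)"] \<eta> by simp
  have 1: "((\<lambda>s. (s, \<theta>)) has_derivative (\<lambda>h. (h, 0))) (at \<eta>)"
    and 2: "((\<lambda>s. (\<eta>, s)) has_derivative (\<lambda>h. (0, h))) (at \<theta>)"
    by (auto intro!: derivative_eq_intros)
  have "((\<lambda>s. Phi c (s, \<theta>)) has_vector_derivative axial c (ring_pt c (\<eta>, \<theta>))) (at \<eta>)"
    using has_derivative_compose[OF 1 d] by (simp add: has_vector_derivative_def)
  moreover have "((\<lambda>s. Phi c (\<eta>, s)) has_vector_derivative beta' c \<eta> \<theta>) (at \<theta>)"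
    using has_derivative_compose[OF 2 d] by (simp add: has_vector_derivative_def)
  ultimately show ?thesis by (simp add: grad_Phi_def vector_derivative_at)
qed

text \<open>
  The vector produced by the pseudoinverse is \<open>(f / J) (\<nu> \<times> beta')\<close>; the area element \<open>J\<close> cancels, and
  the triple product is cyclic.
\<close>

lemma coupling_pointwise:
  fixes f :: complex and h :: "complex^3" and \<eta> \<theta> :: real
  assumes c: "cable_ok c" and \<eta>: "\<eta> \<in> {0<..<1}"
  defines "\<nu> \<equiv> - (1 / radius c) *\<^sub>R beta c \<eta> \<theta>"
  shows "area c (\<eta>, \<theta>) *\<^sub>R cdot (pinv (cmat (grad_Phi c (\<eta>, \<theta>))) *v vector [f, 0]) h =
    cnj f * (\<Sum>j\<in>UNIV. ccross h (cvec \<nu>) $ j * of_real (beta' c \<eta> \<theta> $ j))"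
proof -
  define J where "J = area c (\<eta>, \<theta>)"
  have J: "J > 0" using area_pos[OF c, of "(\<eta>, \<theta>)"] \<eta> by (simp add: J_def)
  have r: "radius c > 0" using cable_okD(1)[OF c] .
  have "norm \<nu> = 1" using norm_beta[OF c, of \<eta> \<theta>] \<eta> r by (simp add: \<nu>_def)
  then have \<nu>: "inner \<nu> \<nu> = 1" by (simp add: power2_norm_eq_inner[symmetric])
  define n where "n = cross3 (axial c (ring_pt c (\<eta>, \<theta>))) (beta' c \<eta> \<theta>)"
  have n: "n = - J *\<^sub>R \<nu>"
    using cross_axial[OF c \<eta>, of \<theta>] by (simp add: n_def J_def \<nu>_def)
  have "\<nu> \<noteq> 0" using \<nu> by auto
  then have n0: "n \<noteq> 0" using J n by simp
  have nn: "inner n n = J * J" using \<nu> n by simp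
  define w where "w = cross3 \<nu> (beta' c \<eta> \<theta>)"
  have "cross3 (beta' c \<eta> \<theta>) n = J *\<^sub>R w"
    unfolding n w_def using cross_skew[of "beta' c \<eta> \<theta>" \<nu>] by (simp add: cross_mult_right)
  then have "pinv (cmat (grad_Phi c (\<eta>, \<theta>))) *v vector [f, 0] = f *s cvec ((1 / J) *\<^sub>R w)"
    unfolding grad_Phi_eq[OF c \<eta>]
    using pinv_two_rows[of "axial c (ring_pt c (\<eta>, \<theta>))" "beta' c \<eta> \<theta>" f] n0 nn J
    by (simp add: n_def[symmetric])
  moreover define v where "v = (1 / J) *\<^sub>R w"
  ultimately have p: "pinv (cmat (grad_Phi c (\<eta>, \<theta>))) *v vector [f, 0] = f *s cvec v" by simp
  have v: "cvec v $ j = of_real (w $ j) / of_real J" for j by (simp add: cvec_def v_def)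
  have "J *\<^sub>R cdot (pinv (cmat (grad_Phi c (\<eta>, \<theta>))) *v vector [f, 0]) h =
     cnj f * (\<Sum>j\<in>UNIV. of_real (w $ j) * h $ j)"
    unfolding p cdot_def using J by (simp add: v sum_distrib_left scaleR_conv_of_real mult_ac)
  also have "(\<Sum>j\<in>UNIV. of_real (w $ j) * h $ j) = (\<Sum>j\<in>UNIV. ccross h (cvec \<nu>) $ j * of_real (beta' c \<eta> \<theta> $ j))"
    by (simp add: w_def cross3_def ccross_def cvec_def sum_3 vector_3 algebra_simps)
  finally show ?thesis by (simp add: J_def)
qed

section \<open>Surface integrals over the lateral surface\<close>

text \<open>
  An open domain for \<^const>\<open>Phi\<close>, as the characterization of surface measure requires. It misses the line
  \<open>\<theta> = \<pi>\<close>.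
\<close>

definition chart :: "(real \<times> real) set" where
  "chart = {0<..<1} \<times> {-pi<..<pi}"

lemma open_chart: "open chart" unfolding chart_def by (intro open_Times) auto

lemma continuous_on_ring:
  assumes c: "cable_ok c"
  shows "continuous_on ({0..1} \<times> UNIV) (Phi c)" "continuous_on ({0..1} \<times> UNIV) (\<lambda>x. axial c (ring_pt c x))"
    "continuous_on ({0..1} \<times> UNIV) (area c)" "continuous_on ({0..1} \<times> UNIV) (\<lambda>x. beta c (fst x) (snd x))"
    "continuous_on ({0..1} \<times> UNIV) (\<lambda>x. beta' c (fst x) (snd x))"
proof -
  have f: "continuous_on ({0..1} \<times> UNIV) (\<lambda>p. f (fst p))"
    if "f \<in> {curve c, kap1 c, kap2 c, deriv01 (curve c), deriv01 (kap1 c), deriv01 (kap2 c)}" for f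
    using that C1_on01_D(1)[of "curve c"] C1_on01_D(1)[of "kap1 c"] C1_on01_D(1)[of "kap2 c"]
      C1_on01_D(2)[of "curve c"] C1_on01_D(2)[of "kap1 c"] C1_on01_D(2)[of "kap2 c"] cable_okD(3,5,6)[OF c]
    by (intro continuous_on_compose2[of "{0..1}" f _ fst] continuous_intros) auto
  show *: "continuous_on ({0..1} \<times> UNIV) (\<lambda>x. axial c (ring_pt c x))"
    unfolding axial_def ring_pt_def split_beta fst_conv snd_conv by (intro continuous_intros f) auto
  show "continuous_on ({0..1} \<times> UNIV) (area c)"
    unfolding area_def using cable_okD(2)[OF c] by (intro continuous_intros * f) auto
  show b: "continuous_on ({0..1} \<times> UNIV) (\<lambda>x. beta c (fst x) (snd x))"
    unfolding beta_def by (intro continuous_intros f) auto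
  show "continuous_on ({0..1} \<times> UNIV) (\<lambda>x. beta' c (fst x) (snd x))"
    unfolding beta'_eq by (intro continuous_intros f) auto
  show "continuous_on ({0..1} \<times> UNIV) (Phi c)"
    unfolding Phi_def split_beta' using b by (intro continuous_intros f) auto
qed

lemma Phi_lipschitz:
  assumes c: "cable_ok c"
  obtains K where "K-lipschitz_on ({0<..<1} \<times> {-pi<..<2 * pi}) (Phi c)"
proof -
  let ?K = "{0..1::real} \<times> {-pi..2 * pi}"
  have bdd: "\<exists>A. \<forall>x\<in>?K. norm (f x) \<le> A" if "continuous_on ({0..1} \<times> UNIV) f" for f :: "real \<times> real \<Rightarrow> real^3"
  proof -
    have "compact (f ` ?K)"
      by (intro compact_continuous_image continuous_on_subset[OF that] compact_Times) auto
    from compact_imp_bounded[OF this] show ?thesis unfolding bounded_iff by blast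
  qed
  obtain A where A: "\<forall>x\<in>?K. norm (axial c (ring_pt c x)) \<le> A"
    using bdd[OF continuous_on_ring(2)[OF c]] by blast
  obtain B where B: "\<forall>x\<in>?K. norm (beta' c (fst x) (snd x)) \<le> B"
    using bdd[OF continuous_on_ring(5)[OF c]] by blast
  have "(0, 0) \<in> ?K" using pi_gt_zero by auto
  then have AB: "0 \<le> A" "0 \<le> B" using A B norm_ge_zero order_trans by blast+
  have "(A + B)-lipschitz_on ({0<..<1} \<times> {-pi<..<2 * pi}) (Phi c)"
  proof (rule bounded_derivative_imp_lipschitz)
    fix x :: "real \<times> real" assume X: "x \<in> {0<..<1} \<times> {-pi<..<2 * pi}"
    then have x: "fst x \<in> {0<..<1}" "x \<in> ?K" by auto
    let ?D = "\<lambda>h. fst h *\<^sub>R axial c (ring_pt c x) + snd h *\<^sub>R beta' c (fst x) (snd x)"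
    show "(Phi c has_derivative ?D) (at x within {0<..<1} \<times> {-pi<..<2 * pi})"
      using Phi_has_derivative[OF c x(1)] by (rule has_derivative_at_withinI)
    show "onorm ?D \<le> A + B"
    proof (rule onorm_le)
      fix h :: "real \<times> real"
      have "norm (?D h) \<le> norm (fst h) * norm (axial c (ring_pt c x)) + norm (snd h) * norm (beta' c (fst x) (snd x))"
        by (intro order_trans[OF norm_triangle_ineq]) simp
      also have "\<dots> \<le> norm h * A + norm h * B"
        using norm_fst_le[of "fst h" "snd h"] norm_snd_le[of "snd h" "fst h"] A B x(2)
        by (intro add_mono mult_mono) auto
      finally show "norm (?D h) \<le> (A + B) * norm h" by (simp add: algebra_simps)
    qed
  qed (use AB in \<open>auto intro!: convex_Times\<close>)
  then show ?thesis by (rule that)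
qed

text \<open>
  The second domain is a shifted chart that contains the line missed by the first one.
\<close>

lemma Phi_inj:
  assumes c: "cable_ok c"
  shows "inj_on (Phi c) chart" "inj_on (Phi c) ({0<..<1} \<times> {0<..<2*pi})"
proof -
  note inj = cable_okD(7)[OF c]
  show "inj_on (Phi c) chart"
    by (rule inj_on_subset[OF inj]) (auto simp: chart_def)
  show "inj_on (Phi c) ({0<..<1} \<times> {0<..<2*pi})"
  proof (rule inj_onI)
    fix x y assume x: "x \<in> {0<..<1} \<times> {0<..<2*pi}" and y: "y \<in> {0<..<1} \<times> {0<..<2*pi}"
      and eq: "Phi c x = Phi c y"
    \<comment> \<open>reduce the angle to \<open>(-\<pi>, \<pi>]\<close>, where \<open>\<Phi>\<close> is injective\<close>
    define w where "w = (\<lambda>\<theta>::real. if \<theta> \<le> pi then \<theta> else \<theta> - 2 * pi)"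
    have P: "Phi c (\<eta>, w \<theta>) = Phi c (\<eta>, \<theta>)" for \<eta> \<theta>
      by (simp add: Phi_tube w_def sin_diff cos_diff)
    have "(fst x, w (snd x)) = (fst y, w (snd y))"
      using eq P[of "fst x" "snd x"] P[of "fst y" "snd y"] x y
      by (intro inj_onD[OF inj]) (auto simp: w_def)
    then show "x = y"
      using x y by (auto simp: w_def prod_eq_iff split: if_splits)
  qed
qed

lemma borel_image_sigma_compact:
  fixes f :: "'a::euclidean_space \<Rightarrow> 'b::euclidean_space"
  assumes "open U" "continuous_on U f" shows "f ` U \<in> sets borel"
proof -
  have "\<exists>C. (\<forall>n::nat. compact (C n) \<and> C n \<subseteq> U) \<and> \<Union>(range C) = U"
  proof (rule open_Union_compact_subsets[OF assms(1)])
    fix C :: "nat \<Rightarrow> 'a set" assume "\<And>n. compact (C n)" "\<And>n. C n \<subseteq> U" "\<Union>(range C) = U"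
    then show ?thesis by (intro exI[of _ C]) simp
  qed
  then obtain C :: "nat \<Rightarrow> 'a set" where C: "\<forall>n. compact (C n) \<and> C n \<subseteq> U" "\<Union>(range C) = U"
    by (elim exE conjE)
  have "f ` U = (\<Union>n. f ` C n)" using C(2) by auto
  moreover have "compact (f ` C n)" for n
    using C assms(2) by (intro compact_continuous_image) (auto intro: continuous_on_subset)
  ultimately show ?thesis by (simp add: sets.countable_UN image_subset_iff borel_closed compact_imp_closed)
qed

lemma surface_measure_Phi:
  assumes S: "surface_measure F S" and c: "cable_ok c" and lat: "lat_surface c \<subseteq> F"
    and U: "open U" "U \<subseteq> {0<..<1} \<times> {-pi<..<2 * pi}" "inj_on (Phi c) U" and A: "A \<in> sets borel" "A \<subseteq> U"
  shows "emeasure S (Phi c ` A) = (\<integral>\<^sup>+ x. ennreal (area c x) * indicator A x \<partial>lborel)"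
proof -
  obtain K where K: "K-lipschitz_on ({0<..<1} \<times> {-pi<..<2 * pi}) (Phi c)" using Phi_lipschitz[OF c] .
  then have "K-lipschitz_on U (Phi c)" using U(2) by (rule lipschitz_on_subset)
  moreover have "Phi c ` U \<subseteq> F"
  proof (rule image_subsetI)
    fix x assume "x \<in> U"
    then have "fst x \<in> {0<..<1}" using U(2) by (auto dest: subsetD)
    then have "Phi c (fst x, snd x) \<in> lat_surface c" by (rule Phi_in_lat)
    then show "Phi c x \<in> F" using lat by auto
  qed
  ultimately have pre: "open U \<and> inj_on (Phi c) U \<and> K-lipschitz_on U (Phi c) \<and> Phi c ` U \<subseteq> F"
    using U by simp
  have ax: "\<forall>U \<phi> K. open U \<and> inj_on \<phi> U \<and> K-lipschitz_on U \<phi> \<and> \<phi> ` U \<subseteq> F \<longrightarrow>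
        (\<forall>A \<in> sets borel. A \<subseteq> U \<longrightarrow>
           emeasure S (\<phi> ` A) = (\<integral>\<^sup>+ x. ennreal (area_elem \<phi> x) * indicator A x \<partial>lborel))"
    using S by (simp add: surface_measure_def)
  have "emeasure S (Phi c ` A) = (\<integral>\<^sup>+ x. ennreal (area_elem (Phi c) x) * indicator A x \<partial>lborel)"
    by (rule ax[rule_format, OF pre A])
  also have "\<dots> = (\<integral>\<^sup>+ x. ennreal (area c x) * indicator A x \<partial>lborel)"
  proof (rule nn_integral_cong)
    fix x show "ennreal (area_elem (Phi c) x) * indicator A x = ennreal (area c x) * indicator A x"
    proof (cases "x \<in> A")
      case True
      then have "x \<in> {0<..<1} \<times> {-pi<..<2 * pi}" using A(2) U(2) by (meson subsetD)
      then have "fst x \<in> {0<..<1}" by (rule mem_Times_iff[THEN iffD1, THEN conjunct1])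
      then show ?thesis using area_elem_Phi[OF c] by simp
    qed simp
  qed
  finally show ?thesis .
qed

lemma seam_null:
  assumes S: "surface_measure F S" and c: "cable_ok c" and lat: "lat_surface c \<subseteq> F"
  shows "AE \<xi> in S. \<xi> \<notin> Phi c ` ({0<..<1} \<times> {pi})"
proof (rule AE_not_in)
  let ?A = "{0<..<1::real} \<times> {pi}"
  have A: "?A \<in> sets borel"
    unfolding borel_prod[symmetric] by (intro pair_measureI) auto
  have "AE x in lborel. x \<notin> ?A"
  proof -
    have "?A \<in> null_sets (lborel \<Otimes>\<^sub>M lborel)"
      using A by (intro null_setsI) (auto simp: lborel.emeasure_pair_measure_Times borel_prod)
    then show ?thesis unfolding lborel_prod by (rule AE_not_in)
  qed
  then have "AE x in lborel. ennreal (area c x) * indicator ?A x = 0"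
    by eventually_elim (simp add: indicator_def)
  then have "(\<integral>\<^sup>+ x. ennreal (area c x) * indicator ?A x \<partial>lborel) = (\<integral>\<^sup>+ x. 0 \<partial>(lborel :: (real \<times> real) measure))"
    by (rule nn_integral_cong_AE)
  then have "(\<integral>\<^sup>+ x. ennreal (area c x) * indicator ?A x \<partial>lborel) = 0" by simp
  moreover have "emeasure S (Phi c ` ?A) = (\<integral>\<^sup>+ x. ennreal (area c x) * indicator ?A x \<partial>lborel)"
    by (rule surface_measure_Phi[OF S c lat, of "{0<..<1} \<times> {0<..<2*pi}"])
       (use A Phi_inj(2)[OF c] in \<open>auto intro!: open_Times\<close>)
  moreover have "Phi c ` ?A \<in> sets S"
  proof -
    have "(\<lambda>\<eta>. Phi c (\<eta>, pi)) ` {0<..<1} \<in> sets borel"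
      by (intro borel_image_sigma_compact continuous_on_compose2[OF continuous_on_ring(1)[OF c], where f="\<lambda>\<eta>. (\<eta>, pi)"]
          continuous_intros) auto
    moreover have "Phi c ` ?A = (\<lambda>\<eta>. Phi c (\<eta>, pi)) ` {0<..<1}" by auto
    ultimately show ?thesis using S by (simp add: surface_measure_def)
  qed
  ultimately show "Phi c ` ?A \<in> null_sets S" by auto
qed

text \<open>
  The cut-off makes the map Borel measurable on the whole plane.
\<close>

definition Phi0 :: "cable \<Rightarrow> real \<times> real \<Rightarrow> real^3" where
  "Phi0 c x = indicator chart x *\<^sub>R Phi c x"

lemma chart_subset: "chart \<subseteq> {0..1} \<times> UNIV" by (auto simp: chart_def)

lemma chart_measurable:
  fixes f :: "real \<times> real \<Rightarrow> 'b::real_normed_vector"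
  shows "continuous_on ({0..1} \<times> UNIV) f \<Longrightarrow> (\<lambda>x. indicator chart x *\<^sub>R f x) \<in> borel_measurable borel"
  by (rule borel_measurable_continuous_on_indicator)
     (auto intro: continuous_on_subset[OF _ chart_subset] simp: open_chart)

lemma Phi0_measurable: "cable_ok c \<Longrightarrow> Phi0 c \<in> borel_measurable borel"
  unfolding Phi0_def by (intro chart_measurable continuous_on_ring)

lemma area_measurable: "cable_ok c \<Longrightarrow> (\<lambda>x. indicator chart x * area c x) \<in> borel_measurable borel"
  using chart_measurable[OF continuous_on_ring(3)] by simp

lemma image_chart_borel: "cable_ok c \<Longrightarrow> Phi c ` chart \<in> sets borel"
  by (intro borel_image_sigma_compact open_chart continuous_on_subset[OF continuous_on_ring(1) chart_subset])

text \<open>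
  Surface measure is prescribed on images of Borel sets. As \<^const>\<open>Phi\<close> is injective on the chart, every
  Borel part of the image is such an image, so the prescription determines a push-forward measure.
\<close>

lemma surface_distr:
  assumes S: "surface_measure F S" and c: "cable_ok c" and lat: "lat_surface c \<subseteq> F"
  shows "density S (\<lambda>\<xi>. indicator (Phi c ` chart) \<xi>) =
    distr (density lborel (\<lambda>x. ennreal (indicator chart x * area c x))) borel (Phi0 c)"
proof (rule measure_eqI)
  have sS: "sets S = sets borel" using S by (simp add: surface_measure_def)
  then have mS: "f \<in> borel_measurable borel \<Longrightarrow> f \<in> borel_measurable S" for f :: "real^3 \<Rightarrow> ennreal"
    by (simp cong: measurable_cong_sets)
  show "sets (density S (\<lambda>\<xi>. indicator (Phi c ` chart) \<xi>)) =
    sets (distr (density lborel (\<lambda>x. ennreal (indicator chart x * area c x))) borel (Phi0 c))"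
    by (simp add: sS)
  fix B assume "B \<in> sets (density S (\<lambda>\<xi>. indicator (Phi c ` chart) \<xi>))"
  then have B: "B \<in> sets borel" by (simp add: sS)
  have im: "Phi c ` chart \<in> sets borel"
    by (rule image_chart_borel[OF c])
  have m0[measurable]: "Phi0 c \<in> borel_measurable borel" by (rule Phi0_measurable[OF c])
  have ma[measurable]: "(\<lambda>x. indicator chart x * area c x) \<in> borel_measurable borel" by (rule area_measurable[OF c])
  let ?A = "chart \<inter> (Phi0 c -` B)"
  have A: "?A \<in> sets borel"
    using measurable_sets[OF m0 B] open_chart by auto
  have "emeasure (density S (\<lambda>\<xi>. indicator (Phi c ` chart) \<xi>)) B = (\<integral>\<^sup>+ \<xi>. indicator (Phi c ` chart) \<xi> * indicator B \<xi> \<partial>S)"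
    using B im by (intro emeasure_density) (auto simp: sS intro!: mS)
  also have "\<dots> = (\<integral>\<^sup>+ \<xi>. indicator (Phi c ` ?A) \<xi> \<partial>S)"
    by (rule nn_integral_cong) (auto simp: indicator_def Phi0_def)
  also have "\<dots> = emeasure S (Phi c ` ?A)"
  proof (rule nn_integral_indicator)
    have "Phi c ` ?A = Phi c ` chart \<inter> B" by (auto simp: Phi0_def)
    then show "Phi c ` ?A \<in> sets S" using im B by (auto simp: sS)
  qed
  also have "\<dots> = (\<integral>\<^sup>+ x. ennreal (area c x) * indicator ?A x \<partial>lborel)"
    by (rule surface_measure_Phi[OF S c lat open_chart _ Phi_inj(1)[OF c] A]) (auto simp: chart_def)
  also have "\<dots> = (\<integral>\<^sup>+ x. ennreal (indicator chart x * area c x) * indicator (Phi0 c -` B \<inter> space lborel) x \<partial>lborel)"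
    by (rule nn_integral_cong) (auto simp: indicator_def)
  also have "\<dots> = emeasure (density lborel (\<lambda>x. ennreal (indicator chart x * area c x))) (Phi0 c -` B \<inter> space lborel)"
    using measurable_sets[OF m0 B] by (intro emeasure_density[symmetric]) auto
  also have "\<dots> = emeasure (distr (density lborel (\<lambda>x. ennreal (indicator chart x * area c x))) borel (Phi0 c)) B"
    using B by (subst emeasure_distr) auto
  finally show "emeasure (density S (\<lambda>\<xi>. indicator (Phi c ` chart) \<xi>)) B =
     emeasure (distr (density lborel (\<lambda>x. ennreal (indicator chart x * area c x))) borel (Phi0 c)) B" .
qed

lemma surface_integral_chart:
  fixes w :: "real^3 \<Rightarrow> 'b::{banach, second_countable_topology}"
  assumes S: "surface_measure F S" and c: "cable_ok c" and lat: "lat_surface c \<subseteq> F"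
    and w: "integrable S w"
  shows "integrable lborel (\<lambda>x. (indicator chart x * area c x) *\<^sub>R w (Phi0 c x))"
    and "(\<integral>\<xi>. indicator (Phi c ` chart) \<xi> *\<^sub>R w \<xi> \<partial>S) =
      (\<integral>x. (indicator chart x * area c x) *\<^sub>R w (Phi0 c x) \<partial>lborel)"
proof -
  have sS: "sets S = sets borel" using S by (simp add: surface_measure_def)
  have wS: "w \<in> borel_measurable S" using w by (rule borel_measurable_integrable)
  then have wb: "w \<in> borel_measurable borel" using sS by (simp cong: measurable_cong_sets)
  have im: "Phi c ` chart \<in> sets S" unfolding sS
    by (rule image_chart_borel[OF c])
  then have mi: "(\<lambda>\<xi>. indicator (Phi c ` chart) \<xi> :: real) \<in> borel_measurable S" by simp
  have m0: "Phi0 c \<in> borel_measurable borel" by (rule Phi0_measurable[OF c])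
  have ma: "(\<lambda>x. indicator chart x * area c x) \<in> borel_measurable borel" by (rule area_measurable[OF c])
  have nn: "AE x in lborel. 0 \<le> indicator chart x * area c x"
    by (rule AE_I2) (auto simp: indicator_def chart_def intro!: less_imp_le[OF area_pos[OF c]])
  have wm: "(\<lambda>x. w (Phi0 c x)) \<in> borel_measurable borel"
    using measurable_compose[OF m0 wb] .
  note eq = surface_distr[OF S c lat]
  \<comment> \<open>the indicator is \<open>ennreal\<close>-valued on the left, real-valued on the right\<close>
  have d: "density S (\<lambda>\<xi>. indicator (Phi c ` chart) \<xi>) = density S (\<lambda>\<xi>. ennreal (indicator (Phi c ` chart) \<xi>))"
    by (rule arg_cong[where f="density S"]) (auto simp: indicator_def)
  have "integrable S (\<lambda>\<xi>. indicator (Phi c ` chart) \<xi> *\<^sub>R w \<xi>)"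
    by (intro integrable_mult_indicator im w)
  then have "integrable (density S (\<lambda>\<xi>. indicator (Phi c ` chart) \<xi>)) w"
    unfolding d by (subst integrable_density[OF wS mi]) auto
  then have "integrable (density lborel (\<lambda>x. ennreal (indicator chart x * area c x))) (\<lambda>x. w (Phi0 c x))"
    unfolding eq using m0 wb by (subst (asm) integrable_distr_eq) auto
  then show "integrable lborel (\<lambda>x. (indicator chart x * area c x) *\<^sub>R w (Phi0 c x))"
    using wm ma nn by (subst (asm) integrable_density) auto
  have "(\<integral>\<xi>. indicator (Phi c ` chart) \<xi> *\<^sub>R w \<xi> \<partial>S) = (\<integral>\<xi>. w \<xi> \<partial>density S (\<lambda>\<xi>. indicator (Phi c ` chart) \<xi>))"
    unfolding d by (rule integral_density[symmetric, OF wS mi]) auto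
  also have "\<dots> = (\<integral>x. w (Phi0 c x) \<partial>density lborel (\<lambda>x. ennreal (indicator chart x * area c x)))"
    unfolding eq using m0 wb by (intro integral_distr) auto
  also have "\<dots> = (\<integral>x. (indicator chart x * area c x) *\<^sub>R w (Phi0 c x) \<partial>lborel)"
    using wm ma nn by (intro integral_density) auto
  finally show "(\<integral>\<xi>. indicator (Phi c ` chart) \<xi> *\<^sub>R w \<xi> \<partial>S) =
      (\<integral>x. (indicator chart x * area c x) *\<^sub>R w (Phi0 c x) \<partial>lborel)" .
qed

lemma surface_AE_chart:
  assumes S: "surface_measure F S" and c: "cable_ok c" and lat: "lat_surface c \<subseteq> F"
    and P: "AE \<xi> in S. P \<xi>"
  shows "AE x in lborel. x \<in> chart \<longrightarrow> P (Phi c x)"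
proof -
  have sS: "sets S = sets borel" using S by (simp add: surface_measure_def)
  have im: "Phi c ` chart \<in> sets S" unfolding sS
    by (rule image_chart_borel[OF c])
  have m0: "Phi0 c \<in> borel_measurable borel" by (rule Phi0_measurable[OF c])
  have ma: "(\<lambda>x. indicator chart x * area c x) \<in> borel_measurable borel" by (rule area_measurable[OF c])
  have "AE \<xi> in density S (\<lambda>\<xi>. indicator (Phi c ` chart) \<xi>). P \<xi>"
    using P im by (subst AE_density) (auto elim!: eventually_mono)
  then have "AE x in density lborel (\<lambda>x. ennreal (indicator chart x * area c x)). P (Phi0 c x)"
    unfolding surface_distr[OF S c lat] by (rule AE_distrD[rotated]) (use m0 in simp)
  then have "AE x in lborel. 0 < ennreal (indicator chart x * area c x) \<longrightarrow> P (Phi0 c x)"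
    using ma by (subst (asm) AE_density) auto
  then show ?thesis
  proof eventually_elim
    case (elim x)
    show ?case
    proof
      assume x: "x \<in> chart"
      then have "area c x > 0" by (intro area_pos[OF c]) (auto simp: chart_def)
      then show "P (Phi c x)" using elim x by (simp add: Phi0_def)
    qed
  qed
qed

section \<open>The coupling operators are adjoint on the boundary\<close>

text \<open>
  The scalar \<open>(h \<times> \<nu>) \<bullet> b\<close>.
\<close>

definition flux :: "complex^3 \<Rightarrow> real^3 \<Rightarrow> real^3 \<Rightarrow> complex" where
  "flux h \<nu> b = (\<Sum>j\<in>UNIV. ccross h (cvec \<nu>) $ j * of_real (b $ j))"

lemma flux_measurable:
  assumes "X \<in> borel_measurable M" "Y \<in> borel_measurable M" "Z \<in> borel_measurable M"
  shows "(\<lambda>x. flux (X x) (Y x) (Z x)) \<in> borel_measurable M"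
proof -
  have X: "(\<lambda>x. X x $ j) \<in> borel_measurable M" for j
    using assms(1) by (rule borel_measurable_continuous_on[where f="\<lambda>v. v $ j", rotated]) (intro continuous_intros)
  have Y: "(\<lambda>x. Y x $ j) \<in> borel_measurable M" for j
    using assms(2) by (rule borel_measurable_continuous_on[where f="\<lambda>v. v $ j", rotated]) (intro continuous_intros)
  have Z: "(\<lambda>x. Z x $ j) \<in> borel_measurable M" for j
    using assms(3) by (rule borel_measurable_continuous_on[where f="\<lambda>v. v $ j", rotated]) (intro continuous_intros)
  have R: "(\<lambda>x. complex_of_real (r x)) \<in> borel_measurable M" if "r \<in> borel_measurable M" for r
    using that by (rule borel_measurable_continuous_on[where f="of_real", rotated]) (intro continuous_intros)
  show ?thesis
    unfolding flux_def sum_3 ccross_def cvec_def vector_3 vec_lambda_beta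
    by (intro borel_measurable_add borel_measurable_times borel_measurable_diff X R Y Z)
qed

lemma flux_0 [simp]: "flux h \<nu> 0 = 0" by (simp add: flux_def)

text \<open>
  Functions on the unit interval are measurable for the completed measure only, whereas Fubini's
  theorem on the chart concerns the product of the Borel measures.
\<close>

lemma borel_representative:
  fixes f :: "real \<Rightarrow> complex"
  assumes "f \<in> borel_measurable unit_int"
  obtains e where "e \<in> borel_measurable borel" "AE \<eta> in lborel. \<eta> \<in> {0<..<1} \<longrightarrow> f \<eta> = e \<eta>"
proof -
  let ?f = "\<lambda>x. indicator {0<..<1} x *\<^sub>R f x"
  have "?f \<in> borel_measurable lebesgue"
    using assms by (simp add: borel_measurable_restrict_space_iff)
  then have R: "(\<lambda>x. Re (?f x)) \<in> borel_measurable lebesgue" and I: "(\<lambda>x. Im (?f x)) \<in> borel_measurable lebesgue"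
    by (rule borel_measurable_continuous_on[rotated], intro continuous_intros)+
  obtain a where a: "a \<in> borel_measurable lborel" "AE x in lborel. Re (?f x) = a x"
    using completion_ex_borel_measurable_real[OF R] by (elim bexE)
  obtain b where b: "b \<in> borel_measurable lborel" "AE x in lborel. Im (?f x) = b x"
    using completion_ex_borel_measurable_real[OF I] by (elim bexE)
  show ?thesis
  proof (rule that[of "\<lambda>x. Complex (a x) (b x)"])
    have "(\<lambda>x. complex_of_real (a x) + \<i> * complex_of_real (b x)) \<in> borel_measurable borel"
      using a(1) b(1) by (intro borel_measurable_add borel_measurable_times borel_measurable_const
          borel_measurable_continuous_on[where f="of_real"] continuous_intros) auto
    then show "(\<lambda>x. Complex (a x) (b x)) \<in> borel_measurable borel" by (simp add: Complex_eq)
    show "AE \<eta> in lborel. \<eta> \<in> {0<..<1} \<longrightarrow> f \<eta> = Complex (a \<eta>) (b \<eta>)"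
      using a(2) b(2) by eventually_elim (auto simp: complex_eq_iff)
  qed
qed

lemma unit_int_measurable_AE:
  fixes f g :: "real \<Rightarrow> 'b::euclidean_space"
  assumes f: "f \<in> borel_measurable unit_int" and ae: "AE x in unit_int. f x = g x"
  shows "g \<in> borel_measurable unit_int"
proof -
  have "(\<lambda>x. indicator {0<..<1} x *\<^sub>R f x) \<in> borel_measurable lebesgue"
    using f by (simp add: borel_measurable_restrict_space_iff)
  moreover have "AE x in lebesgue. indicator {0<..<1} x *\<^sub>R f x = indicator {0<..<1} x *\<^sub>R g x"
    using ae by (subst (asm) AE_restrict_space_iff) (auto elim!: eventually_mono simp: indicator_def)
  ultimately have "(\<lambda>x. indicator {0<..<1} x *\<^sub>R g x) \<in> borel_measurable lebesgue"
    by (rule borel_measurable_AE)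
  then show ?thesis by (simp add: borel_measurable_restrict_space_iff)
qed

lemma integral_unit_int_lborel:
  fixes f :: "real \<Rightarrow> 'b::{banach, second_countable_topology}"
  assumes "(\<lambda>x. indicator {0<..<1} x *\<^sub>R f x) \<in> borel_measurable borel"
  shows "(\<integral>x. f x \<partial>unit_int) = (\<integral>x. indicator {0<..<1} x *\<^sub>R f x \<partial>lborel)"
    and "integrable unit_int f \<longleftrightarrow> integrable lborel (\<lambda>x. indicator {0<..<1} x *\<^sub>R f x)"
  using assms by (simp_all add: integral_restrict_space integrable_restrict_space integral_completion integrable_completion)

lemma P_el_Phi:
  assumes g: "geometry \<Omega>0 c" and x: "\<eta> \<in> {0<..<1}" "\<theta> \<in> {-pi<..pi}"
  shows "P_el c f (Phi (c i) (\<eta>, \<theta>)) = pinv (cmat (grad_Phi (c i) (\<eta>, \<theta>))) *v vector [f \<eta> $ i, 0]"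
proof -
  have ok: "cable_ok (c j)" for j using g by (simp add: geometry_def)
  have "inj_on (Phi (c i)) ({0<..<1} \<times> {-pi<..pi})"
    by (rule inj_on_subset[OF cable_okD(7)[OF ok]]) auto
  then have "Psi (c i) (Phi (c i) (\<eta>, \<theta>)) = (\<eta>, \<theta>)"
    unfolding Psi_def using x by (intro inv_into_f_f) auto
  moreover have "(THE j. Phi (c i) (\<eta>, \<theta>) \<in> lat_surface (c j)) = i"
  proof (rule the_equality)
    show "Phi (c i) (\<eta>, \<theta>) \<in> lat_surface (c i)" by (rule Phi_in_lat[OF x(1)])
    then have "Phi (c i) (\<eta>, \<theta>) \<in> body (c i)" using lat_subset_body[OF ok] by blast
    then show "j = i" if "Phi (c i) (\<eta>, \<theta>) \<in> lat_surface (c j)" for j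
      using that lat_subset_body[OF ok[of j]] disjoint_bodies[OF g] by blast
  qed
  ultimately show ?thesis by (simp add: P_el_def)
qed

text \<open>
  The integrand of \<^const>\<open>P_mag\<close> on the chart, extended by \<open>0\<close>, with the normal written out.
\<close>

definition lat_flux :: "cable \<Rightarrow> (real^3 \<Rightarrow> complex^3) \<Rightarrow> real \<times> real \<Rightarrow> complex" where
  "lat_flux c h x = flux (h (Phi0 c x))
     (indicator chart x *\<^sub>R (- (1 / radius c) *\<^sub>R beta c (fst x) (snd x)))
     (indicator chart x *\<^sub>R beta' c (fst x) (snd x))"

lemma lat_flux_outside: "x \<notin> chart \<Longrightarrow> lat_flux c h x = 0"
  by (simp add: lat_flux_def)

lemma lat_flux_measurable:
  assumes c: "cable_ok c" and h: "h \<in> borel_measurable borel"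
  shows "lat_flux c h \<in> borel_measurable borel"
  unfolding lat_flux_def
  by (intro flux_measurable measurable_compose[OF Phi0_measurable[OF c] h] chart_measurable
      continuous_intros continuous_on_ring c)

text \<open>
  The two integrands agree except at \<open>\<theta> = \<plusminus>\<pi>\<close>, where the chart ends.
\<close>

lemma P_mag_lat_flux:
  fixes c :: "'k::finite \<Rightarrow> cable"
  assumes g: "geometry \<Omega>0 c" and h: "h \<in> borel_measurable borel" and \<eta>: "\<eta> \<in> {0<..<1}"
  shows "P_mag (outer_region \<Omega>0 c) c h \<eta> $ i = (\<integral>\<theta>. lat_flux (c i) h (\<eta>, \<theta>) \<partial>lborel)"
proof -
  have ok: "cable_ok (c i)" using g by (simp add: geometry_def)
  define f where "f \<theta> = indicator {-pi..pi} \<theta> *\<^sub>R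
    flux (h (Phi (c i) (\<eta>, \<theta>))) (outer_normal (outer_region \<Omega>0 c) (Phi (c i) (\<eta>, \<theta>))) (beta' (c i) \<eta> \<theta>)" for \<theta>
  have inside: "f \<theta> = lat_flux (c i) h (\<eta>, \<theta>)" if "\<theta> \<noteq> pi" "\<theta> \<noteq> - pi" for \<theta>
  proof (cases "\<theta> \<in> {-pi<..<pi}")
    case True
    then have "(\<eta>, \<theta>) \<in> chart" "\<theta> \<in> {-pi<..pi}" using \<eta> by (auto simp: chart_def)
    then show ?thesis
      using outer_normal_lat[OF g \<eta>, of \<theta> i] by (simp add: f_def lat_flux_def Phi0_def)
  next
    case False
    then have "(\<eta>, \<theta>) \<notin> chart" "\<theta> \<notin> {-pi..pi}" using that by (auto simp: chart_def)
    then show ?thesis by (simp add: f_def lat_flux_outside)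
  qed
  have "(\<lambda>\<theta>. (\<eta>, \<theta>)) \<in> borel_measurable borel" by (intro borel_measurable_continuous_onI continuous_intros)
  then have Km: "(\<lambda>\<theta>. lat_flux (c i) h (\<eta>, \<theta>)) \<in> borel_measurable borel"
    by (rule measurable_compose[OF _ lat_flux_measurable[OF ok h]])
  have "f = (\<lambda>\<theta>. lat_flux (c i) h (\<eta>, \<theta>) + indicator {pi} \<theta> *\<^sub>R f pi + indicator {- pi} \<theta> *\<^sub>R f (- pi))"
  proof
    fix \<theta>
    have "(\<eta>, pi) \<notin> chart" "(\<eta>, - pi) \<notin> chart" by (auto simp: chart_def)
    then show "f \<theta> = lat_flux (c i) h (\<eta>, \<theta>) + indicator {pi} \<theta> *\<^sub>R f pi + indicator {- pi} \<theta> *\<^sub>R f (- pi)"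
      using inside[of \<theta>] pi_gt_zero by (cases "\<theta> = pi"; cases "\<theta> = - pi") (auto simp: lat_flux_outside)
  qed
  moreover have "(\<lambda>\<theta>. lat_flux (c i) h (\<eta>, \<theta>) + indicator {pi} \<theta> *\<^sub>R f pi + indicator {- pi} \<theta> *\<^sub>R f (- pi))
      \<in> borel_measurable borel"
    by (intro borel_measurable_add Km borel_measurable_scaleR borel_measurable_indicator) auto
  ultimately have fm: "f \<in> borel_measurable borel" by simp
  have "P_mag (outer_region \<Omega>0 c) c h \<eta> $ i = (\<integral>\<theta>. f \<theta> \<partial>lborel)"
    by (simp add: P_mag_def set_lebesgue_integral_def f_def flux_def Let_def)
  also have "\<dots> = (\<integral>\<theta>. lat_flux (c i) h (\<eta>, \<theta>) \<partial>lborel)"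
  proof (rule integral_cong_AE)
    show "AE \<theta> in lborel. f \<theta> = lat_flux (c i) h (\<eta>, \<theta>)"
      using AE_lborel_singleton[of pi] AE_lborel_singleton[of "- pi"] by eventually_elim (rule inside)
  qed (use fm Km in auto)
  finally show ?thesis .
qed

lemma AE_lborel_fst:
  assumes "AE x in lborel. P x" shows "AE z in (lborel :: (real \<times> real) measure). P (fst z)"
proof -
  obtain N where N: "N \<in> null_sets lborel" "{x \<in> space lborel. \<not> P x} \<subseteq> N"
    using assms unfolding eventually_ae_filter by blast
  have "N \<times> UNIV \<in> null_sets (lborel \<Otimes>\<^sub>M (lborel :: real measure))"
  proof (rule null_setsI)
    have N': "emeasure lborel N = 0" "N \<in> sets lborel" using null_setsD1[OF N(1)] null_setsD2[OF N(1)] by auto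
    then show "N \<times> UNIV \<in> sets (lborel \<Otimes>\<^sub>M (lborel :: real measure))" by (intro pair_measureI) auto
    show "emeasure (lborel \<Otimes>\<^sub>M (lborel :: real measure)) (N \<times> UNIV) = 0"
      using lborel.emeasure_pair_measure_Times[of N lborel "UNIV :: real set"] N' by simp
  qed
  then have "AE z in lborel \<Otimes>\<^sub>M (lborel :: real measure). z \<notin> N \<times> UNIV" by (rule AE_not_in)
  then show ?thesis
    unfolding lborel_prod
  proof eventually_elim
    case (elim z)
    then have "fst z \<notin> N" by (simp add: mem_Times_iff)
    then show ?case using N(2) by auto
  qed
qed

lemma coupling_pullback:
  fixes c :: "'k::finite \<Rightarrow> cable"
  assumes g: "geometry \<Omega>0 c" and S: "surface_measure F S" and lat: "lat_surface (c i) \<subseteq> F"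
    and e: "AE \<eta> in lborel. \<eta> \<in> {0<..<1} \<longrightarrow> f \<eta> $ i = e \<eta>"
    and coupled: "AE \<xi> in S. \<xi> \<in> lat_surface (c i) \<longrightarrow> E \<xi> = P_el c f \<xi>"
  shows "AE x in lborel. (indicator chart x * area (c i) x) *\<^sub>R cdot (E (Phi0 (c i) x)) (h (Phi0 (c i) x)) =
    cnj (e (fst x)) * lat_flux (c i) h x"
proof -
  have ok: "cable_ok (c i)" using g by (simp add: geometry_def)
  show ?thesis
    using surface_AE_chart[OF S ok lat coupled] AE_lborel_fst[OF e]
  proof eventually_elim
    case (elim x)
    show ?case
    proof (cases "x \<in> chart")
      case True
      then obtain \<eta> \<theta> where x: "x = (\<eta>, \<theta>)" "\<eta> \<in> {0<..<1}" "\<theta> \<in> {-pi<..pi}"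
        by (auto simp: chart_def)
      have "E (Phi (c i) x) = P_el c f (Phi (c i) x)"
        using elim(1) True Phi_in_lat[OF x(2), of "c i" \<theta>] x(1) by simp
      also have "\<dots> = pinv (cmat (grad_Phi (c i) (\<eta>, \<theta>))) *v vector [e \<eta>, 0]"
        using P_el_Phi[OF g x(2,3), of f i] elim(2) x by simp
      finally show ?thesis
        using coupling_pointwise[OF ok x(2), of \<theta> "e \<eta>" "h (Phi (c i) x)"] True
        by (simp add: x(1) flux_def lat_flux_def Phi0_def)
    qed (simp add: lat_flux_outside)
  qed
qed

text \<open>
  The operators \<^const>\<open>P_el\<close> and \<^const>\<open>P_mag\<close> are adjoint on each cable: pull the surface integral back to the
  chart, replace the integrand pointwise, and integrate first over the circle.
\<close>

lemma coupling_integral_cable: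
  fixes c :: "'k::finite \<Rightarrow> cable"
  assumes g: "geometry \<Omega>0 c" and S: "surface_measure F S" and lat: "lat_surface (c i) \<subseteq> F"
    and E: "E \<in> L2 S" and h: "h \<in> L2 S"
    and f: "(\<lambda>\<eta>. f \<eta> $ i) \<in> borel_measurable unit_int"
    and coupled: "AE \<xi> in S. \<xi> \<in> lat_surface (c i) \<longrightarrow> E \<xi> = P_el c f \<xi>"
  shows "integrable unit_int (\<lambda>\<eta>. cnj (f \<eta> $ i) * (P_mag (outer_region \<Omega>0 c) c h \<eta> $ i))"
    and "(\<integral>\<xi>. indicator (Phi (c i) ` chart) \<xi> *\<^sub>R cdot (E \<xi>) (h \<xi>) \<partial>S) =
      (\<integral>\<eta>. cnj (f \<eta> $ i) * (P_mag (outer_region \<Omega>0 c) c h \<eta> $ i) \<partial>unit_int)"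
proof -
  have ok: "cable_ok (c i)" using g by (simp add: geometry_def)
  let ?c = "c i" and ?P = "\<lambda>\<eta>. P_mag (outer_region \<Omega>0 c) c h \<eta> $ i"
  let ?K = "lat_flux ?c h"
  have "sets S = sets borel" using S by (simp add: surface_measure_def)
  then have hb: "h \<in> borel_measurable borel" using L2_measurable[OF h] by (simp cong: measurable_cong_sets)
  note Km = lat_flux_measurable[OF ok hb]
  obtain e where e: "e \<in> borel_measurable borel" "AE \<eta> in lborel. \<eta> \<in> {0<..<1} \<longrightarrow> f \<eta> $ i = e \<eta>"
    using borel_representative[OF f] .
  note pull = surface_integral_chart[OF S ok lat integrable_L2_product[OF bounded_bilinear_cdot E h]]
  define Q where "Q x = cnj (e (fst x)) * ?K x" for x
  have "(\<lambda>x :: real \<times> real. e (fst x)) \<in> borel_measurable borel"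
    using e(1) by (rule measurable_compose[rotated]) (intro borel_measurable_continuous_onI continuous_intros)
  then have "(\<lambda>x :: real \<times> real. cnj (e (fst x))) \<in> borel_measurable borel"
    by (rule borel_measurable_continuous_on[where f=cnj, rotated]) (intro continuous_intros)
  then have Qm: "Q \<in> borel_measurable borel" unfolding Q_def by (intro borel_measurable_times Km)
  note ae = coupling_pullback[OF g S lat e(2) coupled, where h=h, folded Q_def]
  have Qi: "integrable lborel Q"
    using pull(1) by (rule Bochner_Integration.integrable_cong_AE[THEN iffD1, rotated -1])
      (use borel_measurable_integrable[OF pull(1)] Qm ae in auto)
  have "(\<integral>\<xi>. indicator (Phi ?c ` chart) \<xi> *\<^sub>R cdot (E \<xi>) (h \<xi>) \<partial>S) = (\<integral>x. Q x \<partial>lborel)"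
    unfolding pull(2)
    by (rule integral_cong_AE) (use borel_measurable_integrable[OF pull(1)] Qm ae in auto)
  also have "\<dots> = (\<integral>\<eta>. (\<integral>\<theta>. Q (\<eta>, \<theta>) \<partial>lborel) \<partial>lborel)"
    using Qi lborel_pair.integral_fst'[of Q] by (simp add: lborel_prod)
  finally have int1: "(\<integral>\<xi>. indicator (Phi ?c ` chart) \<xi> *\<^sub>R cdot (E \<xi>) (h \<xi>) \<partial>S) =
     (\<integral>\<eta>. (\<integral>\<theta>. Q (\<eta>, \<theta>) \<partial>lborel) \<partial>lborel)" .
  have int2: "integrable lborel (\<lambda>\<eta>. \<integral>\<theta>. Q (\<eta>, \<theta>) \<partial>lborel)"
    using Qi lborel_pair.integrable_fst'[of Q] by (simp add: lborel_prod)
  note P = P_mag_lat_flux[OF g hb, of _ i]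
  have "?K (\<eta>, \<theta>) = 0" if "\<eta> \<notin> {0<..<1}" for \<eta> \<theta>
    using that by (intro lat_flux_outside) (auto simp: chart_def)
  then have inner: "(\<integral>\<theta>. Q (\<eta>, \<theta>) \<partial>lborel) = indicator {0<..<1} \<eta> *\<^sub>R (cnj (e \<eta>) * ?P \<eta>)" for \<eta>
    by (cases "\<eta> \<in> {0<..<1}") (simp_all add: Q_def P)
  have meas: "(\<lambda>\<eta>. indicator {0<..<1} \<eta> *\<^sub>R (cnj (e \<eta>) * ?P \<eta>)) \<in> borel_measurable borel"
    using borel_measurable_integrable[OF int2] unfolding inner by simp
  have 1: "integrable unit_int (\<lambda>\<eta>. cnj (e \<eta>) * ?P \<eta>)"
    unfolding integral_unit_int_lborel(2)[OF meas] using int2 unfolding inner .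
  have 2: "(\<integral>\<xi>. indicator (Phi ?c ` chart) \<xi> *\<^sub>R cdot (E \<xi>) (h \<xi>) \<partial>S) = (\<integral>\<eta>. cnj (e \<eta>) * ?P \<eta> \<partial>unit_int)"
    unfolding integral_unit_int_lborel(1)[OF meas] int1 inner ..
  \<comment> \<open>\<open>unit_int\<close> is complete, so \<open>f\<close> can replace its Borel representative again\<close>
  have "AE \<eta> in unit_int. \<eta> \<in> {0<..<1} \<longrightarrow> f \<eta> $ i = e \<eta>" by (rule AE_unit_intI[OF e(2)])
  then have ae3: "AE \<eta> in unit_int. cnj (e \<eta>) * ?P \<eta> = cnj (f \<eta> $ i) * ?P \<eta>"
    using AE_space by eventually_elim simp
  have fm: "(\<lambda>\<eta>. cnj (f \<eta> $ i) * ?P \<eta>) \<in> borel_measurable unit_int"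
    by (rule unit_int_measurable_AE[OF borel_measurable_integrable[OF 1] ae3])
  show "integrable unit_int (\<lambda>\<eta>. cnj (f \<eta> $ i) * ?P \<eta>)"
    using 1 by (rule Bochner_Integration.integrable_cong_AE[THEN iffD1, rotated -1])
      (use borel_measurable_integrable[OF 1] fm ae3 in auto)
  show "(\<integral>\<xi>. indicator (Phi ?c ` chart) \<xi> *\<^sub>R cdot (E \<xi>) (h \<xi>) \<partial>S) = (\<integral>\<eta>. cnj (f \<eta> $ i) * ?P \<eta> \<partial>unit_int)"
    unfolding 2 by (rule integral_cong_AE) (use borel_measurable_integrable[OF 1] fm ae3 in auto)
qed

lemma frontier_outer_region:
  fixes c :: "'k::finite \<Rightarrow> cable"
  assumes g: "geometry \<Omega>0 c"
  shows "frontier (outer_region \<Omega>0 c) \<subseteq> frontier \<Omega>0 \<union> (\<Union>i. end_surface (c i)) \<union> (\<Union>i. lat_surface (c i))"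
    and "lat_surface (c i) \<subseteq> frontier (outer_region \<Omega>0 c)"
proof -
  have ok: "cable_ok (c j)" for j using g by (simp add: geometry_def)
  have cl: "closed (body (c j))" for j by (rule compact_imp_closed[OF compact_body[OF ok]])
  have o: "open \<Omega>0" "open (outer_region \<Omega>0 c)" using g by (auto simp: geometry_def lipschitz_domain_def)
  let ?\<Omega> = "outer_region \<Omega>0 c"
  note eq = outer_region_eq[OF g]
  have fr: "frontier (body (c j)) = lat_surface (c j) \<union> end_surface (c j)" for j by (rule cable_okD(8)[OF ok])
  show "frontier ?\<Omega> \<subseteq> frontier \<Omega>0 \<union> (\<Union>i. end_surface (c i)) \<union> (\<Union>i. lat_surface (c i))"
  proof
    fix \<xi> assume "\<xi> \<in> frontier ?\<Omega>"
    then have \<xi>: "\<xi> \<in> closure ?\<Omega>" "\<xi> \<notin> ?\<Omega>" using o(2) by (auto simp: frontier_def interior_open)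
    have "closure ?\<Omega> \<subseteq> closure \<Omega>0" by (rule closure_mono) (auto simp: eq)
    then have c0: "\<xi> \<in> closure \<Omega>0" using \<xi> by blast
    show "\<xi> \<in> frontier \<Omega>0 \<union> (\<Union>i. end_surface (c i)) \<union> (\<Union>i. lat_surface (c i))"
    proof (cases "\<xi> \<in> \<Omega>0")
      case False
      then show ?thesis using c0 o(1) by (auto simp: frontier_def interior_open)
    next
      case True
      then obtain j where j: "\<xi> \<in> body (c j)" using \<xi>(2) by (auto simp: eq)
      have "\<xi> \<notin> interior (body (c j))"
      proof
        assume "\<xi> \<in> interior (body (c j))"
        then have "interior (body (c j)) \<inter> ?\<Omega> \<noteq> {}"
          using \<xi>(1) open_Int_closure_eq_empty[OF open_interior, of "body (c j)" ?\<Omega>] by blast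
        then show False using interior_subset by (fastforce simp: eq)
      qed
      then have "\<xi> \<in> frontier (body (c j))" using j closure_subset by (auto simp: frontier_def)
      then show ?thesis using fr by blast
    qed
  qed
  show "lat_surface (c i) \<subseteq> frontier ?\<Omega>"
  proof
    fix \<xi> assume l: "\<xi> \<in> lat_surface (c i)"
    then have b: "\<xi> \<in> body (c i)" "\<xi> \<in> frontier (body (c i))" using lat_subset_body[OF ok] fr by blast+
    obtain W where W: "open W" "\<xi> \<in> W" "\<forall>x\<in>W. x \<in> ?\<Omega> \<longleftrightarrow> x \<notin> body (c i)"
      using near_one_body[OF g b(1)] by blast
    have "\<xi> \<in> closure ?\<Omega>"
      unfolding closure_iff_nhds_not_empty
    proof (intro allI impI)
      fix A V :: "(real^3) set" assume V: "V \<subseteq> A" "open V" "\<xi> \<in> V"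
      then have "open (V \<inter> W)" "\<xi> \<in> V \<inter> W" using W by auto
      then have "\<not> V \<inter> W \<subseteq> body (c i)"
        using b(2) interior_maximal[of "V \<inter> W" "body (c i)"] by (auto simp: frontier_def)
      then obtain z where "z \<in> V \<inter> W" "z \<notin> body (c i)" by blast
      then have "z \<in> ?\<Omega> \<inter> A" using V(1) W(3) by auto
      then show "?\<Omega> \<inter> A \<noteq> {}" by blast
    qed
    moreover have "\<xi> \<notin> ?\<Omega>" using b(1) by (auto simp: eq)
    ultimately show "\<xi> \<in> frontier ?\<Omega>" using o(2) by (simp add: frontier_def interior_open)
  qed
qed

text \<open>
  Almost every boundary point lies on the outer boundary or an end disc, where the integrand vanishes, or in
  the chart of exactly one cable.
\<close>

lemma boundary_power:
  fixes c :: "'k::finite \<Rightarrow> cable"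
  assumes g: "geometry \<Omega>0 c" and \<Omega>: "\<Omega> = outer_region \<Omega>0 c" and S: "surface_measure (frontier \<Omega>) S"
    and E: "E \<in> L2 S" and h: "h \<in> L2 S" and f: "f \<in> borel_measurable unit_int"
    and outer: "(AE \<xi> in S. \<xi> \<in> frontier \<Omega>0 \<longrightarrow> E \<xi> = 0) \<or> (AE \<xi> in S. \<xi> \<in> frontier \<Omega>0 \<longrightarrow> h \<xi> = 0)"
    and ends: "AE \<xi> in S. \<xi> \<in> (\<Union>i. end_surface (c i)) \<longrightarrow> E \<xi> = 0"
    and lat: "AE \<xi> in S. \<xi> \<in> (\<Union>i. lat_surface (c i)) \<longrightarrow> E \<xi> = P_el c f \<xi>"
  shows "integrable unit_int (\<lambda>\<eta>. cdot (f \<eta>) (P_mag \<Omega> c h \<eta>))"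
    and "(\<integral>\<xi>. cdot (E \<xi>) (h \<xi>) \<partial>S) = (\<integral>\<eta>. cdot (f \<eta>) (P_mag \<Omega> c h \<eta>) \<partial>unit_int)"
proof -
  have ok: "cable_ok (c j)" for j using g by (simp add: geometry_def)
  note fro = frontier_outer_region[OF g, folded \<Omega>]
  have sS: "sets S = sets borel" using S by (simp add: surface_measure_def)
  have ci: "integrable S (\<lambda>\<xi>. cdot (E \<xi>) (h \<xi>))"
    by (rule integrable_L2_product[OF bounded_bilinear_cdot E h])
  have fi: "(\<lambda>\<eta>. f \<eta> $ i) \<in> borel_measurable unit_int" for i
    using f by (rule borel_measurable_continuous_on[where f="\<lambda>v. v $ i", rotated]) (intro continuous_intros)
  have lati: "AE \<xi> in S. \<xi> \<in> lat_surface (c i) \<longrightarrow> E \<xi> = P_el c f \<xi>" for i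
    using lat by eventually_elim auto
  note cable = coupling_integral_cable[OF g S fro(2) E h fi lati, folded \<Omega>]
  let ?I = "\<lambda>i \<xi>. indicator (Phi (c i) ` chart) \<xi> *\<^sub>R cdot (E \<xi>) (h \<xi>)"
  have im: "Phi (c i) ` chart \<in> sets S" for i unfolding sS
    by (rule image_chart_borel[OF ok])
  have Ii: "integrable S (?I i)" for i by (intro integrable_mult_indicator im ci)
  have "AE \<xi> in S. \<xi> \<notin> - frontier \<Omega>"
  proof (rule AE_not_in)
    have "- frontier \<Omega> \<in> sets S" unfolding sS by (intro borel_open) (simp add: open_Compl)
    then show "- frontier \<Omega> \<in> null_sets S" using S by (auto simp: surface_measure_def)
  qed
  moreover have "AE \<xi> in S. \<forall>i\<in>UNIV. \<xi> \<notin> Phi (c i) ` ({0<..<1} \<times> {pi})"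
    by (intro AE_finite_allI seam_null[OF S ok fro(2)]) simp
  moreover have "AE \<xi> in S. \<xi> \<in> frontier \<Omega>0 \<longrightarrow> cdot (E \<xi>) (h \<xi>) = 0"
    using outer by (elim disjE) (auto elim!: eventually_mono simp: cdot.zero_left cdot.zero_right)
  ultimately have ae: "AE \<xi> in S. cdot (E \<xi>) (h \<xi>) = (\<Sum>i\<in>UNIV. ?I i \<xi>)"
    using ends
  proof eventually_elim
    case (elim \<xi>)
    have "\<xi> \<in> frontier \<Omega>0 \<union> (\<Union>i. end_surface (c i)) \<union> (\<Union>i. lat_surface (c i))"
      using elim(1) fro(1) by blast
    then consider "cdot (E \<xi>) (h \<xi>) = 0" | i where "\<xi> \<in> lat_surface (c i)"
      using elim(3,4) by (auto simp: cdot.zero_left)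
    then show ?case
    proof cases
      case 2
      have "lat_surface (c i) = Phi (c i) ` chart \<union> Phi (c i) ` ({0<..<1} \<times> {pi})"
        unfolding lat_surface_def chart_def image_Un[symmetric]
        by (rule arg_cong[where f="image _"]) auto
      then have i: "\<xi> \<in> Phi (c i) ` chart" using 2 elim(2) by blast
      have "\<xi> \<in> body (c i)" using 2 lat_subset_body[OF ok] by blast
      moreover have "Phi (c j) ` chart \<subseteq> body (c j)" for j
        using lat_subset_body[OF ok[of j]] Phi_in_lat[of _ "c j"] by (force simp: chart_def)
      ultimately have "\<xi> \<in> Phi (c j) ` chart \<longleftrightarrow> j = i" for j
        using i disjoint_bodies[OF g] by blast
      then have "?I j \<xi> = (if j = i then cdot (E \<xi>) (h \<xi>) else 0)" for j by simp
      then show ?thesis by (simp only: sum.delta finite UNIV_I if_True)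
    qed simp
  qed
  have "(\<integral>\<xi>. cdot (E \<xi>) (h \<xi>) \<partial>S) = (\<integral>\<xi>. (\<Sum>i\<in>UNIV. ?I i \<xi>) \<partial>S)"
  proof (rule integral_cong_AE)
    show "(\<lambda>\<xi>. \<Sum>i\<in>UNIV. ?I i \<xi>) \<in> borel_measurable S"
      by (intro borel_measurable_integrable Bochner_Integration.integrable_sum Ii)
  qed (fact borel_measurable_integrable[OF ci], fact ae)
  also have "\<dots> = (\<Sum>i\<in>UNIV. \<integral>\<xi>. ?I i \<xi> \<partial>S)" by (intro Bochner_Integration.integral_sum Ii)
  also have "\<dots> = (\<Sum>i\<in>UNIV. \<integral>\<eta>. cnj (f \<eta> $ i) * (P_mag \<Omega> c h \<eta> $ i) \<partial>unit_int)"
    by (simp only: cable(2))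
  also have "\<dots> = (\<integral>\<eta>. cdot (f \<eta>) (P_mag \<Omega> c h \<eta>) \<partial>unit_int)"
    unfolding cdot_def by (intro Bochner_Integration.integral_sum[symmetric] cable(1))
  finally show "(\<integral>\<xi>. cdot (E \<xi>) (h \<xi>) \<partial>S) = (\<integral>\<eta>. cdot (f \<eta>) (P_mag \<Omega> c h \<eta>) \<partial>unit_int)" .
  show "integrable unit_int (\<lambda>\<eta>. cdot (f \<eta>) (P_mag \<Omega> c h \<eta>))"
    unfolding cdot_def by (intro Bochner_Integration.integrable_sum cable(1))
qed

section \<open>Passivity of the ports\<close>

lemma mat_adjoint_index:
  assumes "A \<in> carrier_mat n m" shows "mat_adjoint A = Matrix.mat m n (\<lambda>(i, j). conjugate (A $$ (j, i)))"
  using assms unfolding mat_adjoint_def by (intro eq_matI) (auto simp: mat_of_rows_index)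

lemma scalar_prod_adjoint:
  fixes A :: "complex mat"
  assumes A: "A \<in> carrier_mat n m" and v: "v \<in> carrier_vec m" and z: "z \<in> carrier_vec n"
  shows "scalar_prod (conjugate v) (mat_adjoint A *\<^sub>v z) = scalar_prod (conjugate (A *\<^sub>v v)) z"
proof -
  have "scalar_prod (conjugate v) (mat_adjoint A *\<^sub>v z) =
      (\<Sum>i = 0..<m. conjugate (vec_index v i) * (\<Sum>j = 0..<n. conjugate (A $$ (j, i)) * vec_index z j))"
    using assms by (simp add: mat_adjoint_index[OF A] scalar_prod_def)
  also have "\<dots> = (\<Sum>j = 0..<n. (\<Sum>i = 0..<m. conjugate (A $$ (j, i)) * conjugate (vec_index v i)) * vec_index z j)"
    by (simp add: sum_distrib_left sum_distrib_right, subst sum.swap) (simp add: mult_ac)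
  also have "\<dots> = scalar_prod (conjugate (A *\<^sub>v v)) z"
    using assms by (simp add: scalar_prod_def cnj_sum)
  finally show ?thesis .
qed

lemma conjugate_append:
  fixes a b :: "complex Matrix.vec"
  assumes "a \<in> carrier_vec n" "b \<in> carrier_vec m"
  shows "conjugate (a @\<^sub>v b) = conjugate a @\<^sub>v conjugate b"
  using assms by (intro eq_vecI) auto

lemma scalar_prod_neg_diff:
  fixes q x z :: "complex Matrix.vec"
  assumes "q \<in> carrier_vec n" "x \<in> carrier_vec n" "z \<in> carrier_vec n"
  shows "scalar_prod q (- (x - z)) = scalar_prod q z - scalar_prod q x"
  using assms by (simp add: scalar_prod_def sum_subtractf[symmetric] right_diff_distrib)

lemma Jmat_carrier: "Jmat n \<in> carrier_mat (n + n) (n + n)"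
  unfolding Jmat_def by (intro four_block_carrier_mat) auto

lemma Jmat_form:
  assumes a: "a \<in> carrier_vec n" and b: "b \<in> carrier_vec n"
  shows "Re (scalar_prod (conjugate (a @\<^sub>v b)) (Jmat n *\<^sub>v (a @\<^sub>v b))) = 2 * Re (scalar_prod (conjugate a) b)"
proof -
  have J: "Jmat n *\<^sub>v (a @\<^sub>v b) = b @\<^sub>v a"
    unfolding Jmat_def using a b
    by (subst four_block_mat_mult_vec[of _ n n _ n _ n]) auto
  have "scalar_prod (conjugate (a @\<^sub>v b)) (b @\<^sub>v a) = scalar_prod (conjugate a) b + scalar_prod (conjugate b) a"
    unfolding conjugate_append[OF a b] using a b by (intro scalar_prod_append) auto
  moreover have "scalar_prod (conjugate b) a = cnj (scalar_prod (conjugate a) b)"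
    using a b by (simp add: scalar_prod_def mult.commute)
  ultimately show ?thesis by (simp add: J)
qed

text \<open>
  Evaluate the matrix inequality at \<open>p = (a, b)\<close>: the form of \<open>J\<close> at \<open>p\<close> is \<open>2 Re (a\<^sup>* b)\<close>, and at the image
  \<open>((u, 0), W\<^sub>C p)\<close> of \<open>p\<close> it is \<open>2 Re ((u, 0)\<^sup>* W\<^sub>C p)\<close>. The zeros of \<open>(u, 0)\<close> select the first \<open>m\<close>
  entries of \<open>W\<^sub>C p\<close>, which form \<open>y\<close>.
\<close>

lemma port_passivity:
  assumes inp: "passive_input k m Winp W0" and co: "co_located k m (Winp @\<^sub>r W0) Wout"
    and a: "a \<in> carrier_vec (2 * k)" and b: "b \<in> carrier_vec (2 * k)" and u: "u \<in> carrier_vec m"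
    and in_rel: "u @\<^sub>v 0\<^sub>v (2 * k - m) = (Winp @\<^sub>r W0) *\<^sub>v (a @\<^sub>v b)"
    and out_rel: "y = Wout *\<^sub>v (a @\<^sub>v b)"
  shows "Re (scalar_prod (conjugate a) b) \<le> Re (scalar_prod (conjugate u) y)"
proof -
  define p where "p = a @\<^sub>v b"
  have p: "p \<in> carrier_vec (4 * k)" using append_carrier_vec[OF a b] by (simp add: p_def)
  have m: "m \<le> 2 * k" and W: "Winp \<in> carrier_mat m (4 * k)" "W0 \<in> carrier_mat (2 * k - m) (4 * k)"
    using inp by (auto simp: passive_input_def)
  define WB where "WB = Winp @\<^sub>r W0"
  have WB: "WB \<in> carrier_mat (2 * k) (4 * k)"
    using carrier_append_rows[OF W] m by (simp add: WB_def)
  obtain WC where WC: "WC \<in> carrier_mat (2 * k) (4 * k)"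
    and Wout: "Wout = Matrix.mat m (2 * k) (\<lambda>(i, j). if i = j then 1 else 0) * WC"
    and nsd: "mat_nsd (4 * k) (Jmat (2 * k) - mat_adjoint (WB @\<^sub>r WC) * Jmat (2 * k) * (WB @\<^sub>r WC))"
    using co unfolding co_located_def WB_def by blast
  define W' where "W' = WB @\<^sub>r WC"
  let ?J = "Jmat (2 * k)"
  have W': "W' \<in> carrier_mat (4 * k) (4 * k)"
    using carrier_append_rows[OF WB WC] by (simp add: W'_def)
  have J: "?J \<in> carrier_mat (4 * k) (4 * k)" using Jmat_carrier[of "2 * k"] by simp
  have adj: "mat_adjoint W' \<in> carrier_mat (4 * k) (4 * k)"
    by (simp add: mat_adjoint_index[OF W'])
  define s where "s = WC *\<^sub>v p"
  have s: "s \<in> carrier_vec (2 * k)" using WC p by (simp add: s_def)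
  define u0 where "u0 = u @\<^sub>v 0\<^sub>v (2 * k - m)"
  have u0: "u0 \<in> carrier_vec (2 * k)"
    using append_carrier_vec[OF u zero_carrier_vec[of "2 * k - m"]] m by (simp add: u0_def)
  have W'p: "W' *\<^sub>v p = u0 @\<^sub>v s"
    unfolding W'_def mat_mult_append[OF WB WC p] s_def using in_rel by (simp add: u0_def WB_def p_def)
  have M: "mat_adjoint W' * ?J * W' \<in> carrier_mat (4 * k) (4 * k)" using adj J W' by (meson mult_carrier_mat)
  have "0 \<le> Re (scalar_prod (conjugate p) ((- (?J - mat_adjoint W' * ?J * W')) *\<^sub>v p))"
    using nsd p unfolding mat_nsd_def mat_psd_def W'_def by blast
  also have "(- (?J - mat_adjoint W' * ?J * W')) *\<^sub>v p = - (?J *\<^sub>v p - (mat_adjoint W' * ?J * W') *\<^sub>v p)"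
  proof -
    have "dim_vec p = dim_col (?J - mat_adjoint W' * ?J * W')"
      using carrier_matD[OF M] carrier_vecD[OF p] by simp
    then show ?thesis by (simp only: uminus_mult_mat_vec minus_mult_distrib_mat_vec[OF J M p])
  qed
  also have "(mat_adjoint W' * ?J * W') *\<^sub>v p = mat_adjoint W' *\<^sub>v (?J *\<^sub>v (u0 @\<^sub>v s))"
  proof -
    have "(mat_adjoint W' * ?J * W') *\<^sub>v p = (mat_adjoint W' * ?J) *\<^sub>v (W' *\<^sub>v p)"
      using adj J W' p by (intro assoc_mult_mat_vec) auto
    also have "\<dots> = mat_adjoint W' *\<^sub>v (?J *\<^sub>v (W' *\<^sub>v p))"
      using adj J W' p by (intro assoc_mult_mat_vec) auto
    finally show ?thesis by (simp add: W'p)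
  qed
  also have "scalar_prod (conjugate p) (- (?J *\<^sub>v p - mat_adjoint W' *\<^sub>v (?J *\<^sub>v (u0 @\<^sub>v s)))) =
     scalar_prod (conjugate p) (mat_adjoint W' *\<^sub>v (?J *\<^sub>v (u0 @\<^sub>v s))) - scalar_prod (conjugate p) (?J *\<^sub>v p)"
  proof -
    have x: "?J *\<^sub>v p \<in> carrier_vec (4 * k)" using J p by simp
    have us: "u0 @\<^sub>v s \<in> carrier_vec (4 * k)" using append_carrier_vec[OF u0 s] by simp
    have z: "mat_adjoint W' *\<^sub>v (?J *\<^sub>v (u0 @\<^sub>v s)) \<in> carrier_vec (4 * k)"
      by (rule mult_mat_vec_carrier[OF adj mult_mat_vec_carrier[OF J us]])
    show ?thesis
      by (rule scalar_prod_neg_diff[OF _ x z]) (use p in simp)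
  qed
  also have "scalar_prod (conjugate p) (mat_adjoint W' *\<^sub>v (?J *\<^sub>v (u0 @\<^sub>v s))) =
     scalar_prod (conjugate (u0 @\<^sub>v s)) (?J *\<^sub>v (u0 @\<^sub>v s))"
    using scalar_prod_adjoint[OF W' p, of "?J *\<^sub>v (u0 @\<^sub>v s)"] J append_carrier_vec[OF u0 s] by (simp add: W'p)
  finally have "Re (scalar_prod (conjugate a) b) \<le> Re (scalar_prod (conjugate u0) s)"
    using Jmat_form[OF a b] Jmat_form[OF u0 s] by (simp add: p_def)
  also have "scalar_prod (conjugate u0) s = scalar_prod (conjugate u) y"
  proof -
    let ?E = "Matrix.mat m (2 * k) (\<lambda>(i, j). if i = j then 1 else 0 :: complex)"
    have "y = ?E *\<^sub>v s"
      unfolding out_rel Wout s_def p_def[symmetric] using WC p by (intro assoc_mult_mat_vec) auto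
    then have y: "vec_index y i = vec_index s i" if "i < m" for i
      using that m s by (simp add: scalar_prod_def row_def if_distrib[of "\<lambda>x. x * _"] cong: if_cong)
    have dy: "dim_vec y = m" using \<open>y = ?E *\<^sub>v s\<close> by simp
    have "scalar_prod (conjugate u0) s = (\<Sum>i = 0..<2 * k. conjugate (vec_index u0 i) * vec_index s i)"
      using s u0 by (simp add: scalar_prod_def)
    also have "\<dots> = (\<Sum>i = 0..<m. conjugate (vec_index u0 i) * vec_index s i)"
      using m u by (intro sum.mono_neutral_right) (auto simp: u0_def)
    also have "\<dots> = (\<Sum>i = 0..<m. conjugate (vec_index u i) * vec_index y i)"
      using u m by (intro sum.cong) (auto simp: u0_def y)
    also have "\<dots> = scalar_prod (conjugate u) y"
      using u dy by (simp add: scalar_prod_def)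
    finally show ?thesis .
  qed
  finally show ?thesis .
qed

lemma coords_carrier: "coords (v :: complex^'k::finite) \<in> carrier_vec CARD('k)"
  by (simp add: coords_def)

lemma scalar_prod_coords:
  fixes v w :: "complex^'k::finite"
  shows "scalar_prod (conjugate (coords v)) (coords w) = cdot v w"
proof -
  have "bij_betw (from_nat_into (UNIV :: 'k set)) {..<CARD('k)} UNIV"
    by (rule bij_betw_from_nat_into_finite) simp
  then have "cdot v w = (\<Sum>j<CARD('k). cnj (v $ from_nat_into UNIV j) * w $ from_nat_into UNIV j)"
    unfolding cdot_def by (rule sum.reindex_bij_betw[symmetric])
  then show ?thesis by (simp add: scalar_prod_def coords_def atLeast0LessThan)
qed

lemma port_vec_passive:
  fixes V I :: "real \<Rightarrow> complex^'k::finite"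
  assumes k: "k = CARD('k)" and inp: "passive_input k m Winp W0" and co: "co_located k m (Winp @\<^sub>r W0) Wout"
    and u: "u \<in> carrier_vec m"
    and in_rel: "u @\<^sub>v 0\<^sub>v (2 * k - m) = (Winp @\<^sub>r W0) *\<^sub>v port_vec V I"
    and out_rel: "y = Wout *\<^sub>v port_vec V I"
  shows "inner (cont_rep V 0) (cont_rep I 0) - inner (cont_rep V 1) (cont_rep I 1) \<le> Re (scalar_prod (conjugate u) y)"
proof -
  let ?a = "coords (cont_rep V 0) @\<^sub>v coords (cont_rep V 1)"
  let ?b = "coords (cont_rep I 0) @\<^sub>v coords (- cont_rep I 1)"
  have c: "coords (v :: complex^'k) \<in> carrier_vec k" for v using coords_carrier[of v] k by simp
  have a: "?a \<in> carrier_vec (2 * k)" and b: "?b \<in> carrier_vec (2 * k)"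
    using append_carrier_vec[OF c c] by (simp_all add: mult_2)
  have p: "port_vec V I = ?a @\<^sub>v ?b"
    unfolding port_vec_def using c[THEN carrier_vecD] by (intro eq_vecI) auto
  have "scalar_prod (conjugate ?a) ?b = cdot (cont_rep V 0) (cont_rep I 0) + cdot (cont_rep V 1) (- cont_rep I 1)"
    unfolding conjugate_append[OF c c] scalar_prod_coords[symmetric]
    using c by (intro scalar_prod_append) auto
  then have "Re (scalar_prod (conjugate ?a) ?b) = inner (cont_rep V 0) (cont_rep I 0) - inner (cont_rep V 1) (cont_rep I 1)"
    by (simp add: Re_cdot)
  then show ?thesis
    using port_passivity[OF inp co a b u in_rel[unfolded p] out_rel[unfolded p]] by simp
qed

section \<open>The power balance\<close>

lemma has_L2_derivative_L2: "has_L2_derivative M f g t \<Longrightarrow> g \<in> L2 M"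
  by (simp add: has_L2_derivative_def)

lemma quadratic_energy_derivative:
  fixes A :: "'a \<Rightarrow> complex^'n^'n" and f :: "real \<Rightarrow> 'a \<Rightarrow> complex^'n"
  assumes inv: "ess_bounded M (\<lambda>x. matrix_inv (A x))" and pd: "AE x in M. pd (A x)"
    and f: "C1_L2 M f" and deriv: "has_L2_derivative M f g t" and t: "t \<ge> 0"
  shows "((\<lambda>s. \<integral>x. inner (f s x) (matrix_inv (A x) *v f s x) \<partial>M) has_real_derivative
          2 * (\<integral>x. inner (matrix_inv (A x) *v f t x) (g x) \<partial>M)) (at t within {0..})"
proof (rule L2_energy_derivative[OF inv _ _ deriv t])
  show "AE x in M. adj (matrix_inv (A x)) = matrix_inv (A x)"
    using pd by eventually_elim (rule adj_matrix_inv)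
  show "f s \<in> L2 M" if "s \<ge> 0" for s using f that by (simp add: C1_L2_def)
qed

lemma energy_split:
  assumes L: "ess_bounded unit_int (\<lambda>\<eta>. matrix_inv (L \<eta>))" and C: "ess_bounded unit_int (\<lambda>\<eta>. matrix_inv (C \<eta>))"
    and mu: "ess_bounded (lebesgue_on \<Omega>) (\<lambda>\<xi>. matrix_inv (mu \<xi>))"
    and eps: "ess_bounded (lebesgue_on \<Omega>) (\<lambda>\<xi>. matrix_inv (eps \<xi>))"
    and "\<psi> \<in> L2 unit_int" "q \<in> L2 unit_int" "B \<in> L2 (lebesgue_on \<Omega>)" "D \<in> L2 (lebesgue_on \<Omega>)"
  shows "energy \<Omega> C L eps mu \<psi> q B D =
    1/2 * ((\<integral>\<eta>. inner (\<psi> \<eta>) (matrix_inv (L \<eta>) *v \<psi> \<eta>) \<partial>unit_int) +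
           (\<integral>\<eta>. inner (q \<eta>) (matrix_inv (C \<eta>) *v q \<eta>) \<partial>unit_int) +
           (\<integral>\<xi>. inner (B \<xi>) (matrix_inv (mu \<xi>) *v B \<xi>) \<partial>lebesgue_on \<Omega>) +
           (\<integral>\<xi>. inner (D \<xi>) (matrix_inv (eps \<xi>) *v D \<xi>) \<partial>lebesgue_on \<Omega>))"
proof -
  have "integrable unit_int (\<lambda>\<eta>. inner (\<psi> \<eta>) (matrix_inv (L \<eta>) *v \<psi> \<eta>))"
    "integrable unit_int (\<lambda>\<eta>. inner (q \<eta>) (matrix_inv (C \<eta>) *v q \<eta>))"
    "integrable (lebesgue_on \<Omega>) (\<lambda>\<xi>. inner (B \<xi>) (matrix_inv (mu \<xi>) *v B \<xi>))"
    "integrable (lebesgue_on \<Omega>) (\<lambda>\<xi>. inner (D \<xi>) (matrix_inv (eps \<xi>) *v D \<xi>))"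
    by (intro integrable_inner_L2 L2_matvec assms)+
  then show ?thesis by (simp add: energy_def Re_cdot add_divide_distrib)
qed

lemma dissipation_nonneg:
  assumes "AE x in M. psd (A x + adj (A x))"
  shows "0 \<le> (\<integral>x. inner (v x) (A x *v v x) \<partial>M)"
  by (rule integral_nonneg_AE) (use assms in \<open>auto elim!: eventually_mono intro: psd_add_adj_nonneg\<close>)

lemma line_power:
  fixes V I :: "real \<Rightarrow> complex^'k"
  assumes V: "V \<in> H1" and I: "I \<in> H1" and Iext: "Iext \<in> L2 unit_int"
    and R: "ess_bounded unit_int R" "AE \<eta> in unit_int. psd (R \<eta> + adj (R \<eta>))"
    and G: "ess_bounded unit_int G" "AE \<eta> in unit_int. psd (G \<eta> + adj (G \<eta>))"
    and j: "\<And>\<eta>. j \<eta> = I \<eta> - Iext \<eta>"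
  shows "(\<integral>\<eta>. inner (j \<eta>) (- (R \<eta> *v j \<eta>) - wderiv V \<eta>) \<partial>unit_int) +
         (\<integral>\<eta>. inner (V \<eta>) (- (G \<eta> *v V \<eta>) - wderiv I \<eta>) \<partial>unit_int)
    \<le> inner (cont_rep V 0) (cont_rep I 0) - inner (cont_rep V 1) (cont_rep I 1)
      + (\<integral>\<eta>. inner (Iext \<eta>) (wderiv V \<eta>) \<partial>unit_int)"
proof -
  have L: "V \<in> L2 unit_int" "I \<in> L2 unit_int" "wderiv V \<in> L2 unit_int" "wderiv I \<in> L2 unit_int"
    using V I H1_representation(1)[OF V] H1_representation(1)[OF I] by (auto simp: H1_def)
  have jL: "j \<in> L2 unit_int" unfolding j[abs_def] by (intro L2_diff L Iext)
  have i: "integrable unit_int (\<lambda>\<eta>. inner (j \<eta>) (R \<eta> *v j \<eta>))" "integrable unit_int (\<lambda>\<eta>. inner (V \<eta>) (G \<eta> *v V \<eta>))"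
    "integrable unit_int (\<lambda>\<eta>. inner (I \<eta>) (wderiv V \<eta>))" "integrable unit_int (\<lambda>\<eta>. inner (Iext \<eta>) (wderiv V \<eta>))"
    "integrable unit_int (\<lambda>\<eta>. inner (V \<eta>) (wderiv I \<eta>))"
    by (intro integrable_inner_L2 L2_matvec L jL Iext R G)+
  have "(\<integral>\<eta>. inner (j \<eta>) (- (R \<eta> *v j \<eta>) - wderiv V \<eta>) \<partial>unit_int) =
     (\<integral>\<eta>. - inner (j \<eta>) (R \<eta> *v j \<eta>) - (inner (I \<eta>) (wderiv V \<eta>) - inner (Iext \<eta>) (wderiv V \<eta>)) \<partial>unit_int)"
    by (rule Bochner_Integration.integral_cong) (simp_all add: inner_diff_right inner_diff_left j[symmetric], simp add: j inner_diff_left)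
  also have "\<dots> = - (\<integral>\<eta>. inner (j \<eta>) (R \<eta> *v j \<eta>) \<partial>unit_int) - (\<integral>\<eta>. inner (I \<eta>) (wderiv V \<eta>) \<partial>unit_int)
      + (\<integral>\<eta>. inner (Iext \<eta>) (wderiv V \<eta>) \<partial>unit_int)"
    using i by simp
  finally have 1: "(\<integral>\<eta>. inner (j \<eta>) (- (R \<eta> *v j \<eta>) - wderiv V \<eta>) \<partial>unit_int) = \<dots>" .
  have 2: "(\<integral>\<eta>. inner (V \<eta>) (- (G \<eta> *v V \<eta>) - wderiv I \<eta>) \<partial>unit_int) =
     - (\<integral>\<eta>. inner (V \<eta>) (G \<eta> *v V \<eta>) \<partial>unit_int) - (\<integral>\<eta>. inner (V \<eta>) (wderiv I \<eta>) \<partial>unit_int)"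
    using i by (simp add: inner_diff_right)
  have 3: "(\<integral>\<eta>. inner (wderiv V \<eta>) (I \<eta>) \<partial>unit_int) = (\<integral>\<eta>. inner (I \<eta>) (wderiv V \<eta>) \<partial>unit_int)"
    by (simp add: inner_commute)
  show ?thesis
    unfolding 1 2
    using H1_integration_by_parts[OF V I, unfolded 3]
      dissipation_nonneg[OF R(2), of j] dissipation_nonneg[OF G(2), of V]
    by linarith
qed

lemma field_power:
  assumes E: "E \<in> L2 M" and H: "H \<in> L2 M" and rE: "rE \<in> L2 M" and rH: "(\<lambda>\<xi>. rH \<xi> - sig \<xi> *v E \<xi>) \<in> L2 M"
    and sig: "ess_bounded M sig" "AE \<xi> in M. psd (sig \<xi> + adj (sig \<xi>))"
  shows "(\<integral>\<xi>. inner (H \<xi>) (- rE \<xi>) \<partial>M) + (\<integral>\<xi>. inner (E \<xi>) (rH \<xi> - sig \<xi> *v E \<xi>) \<partial>M)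
    \<le> Re (\<integral>\<xi>. - cdot (rE \<xi>) (H \<xi>) + cdot (E \<xi>) (rH \<xi>) \<partial>M)"
proof -
  have sE: "(\<lambda>\<xi>. sig \<xi> *v E \<xi>) \<in> L2 M" by (intro L2_matvec sig E)
  have rH': "rH \<in> L2 M" using L2_add[OF rH sE] by simp
  have i: "integrable M (\<lambda>\<xi>. inner (H \<xi>) (rE \<xi>))" "integrable M (\<lambda>\<xi>. inner (E \<xi>) (rH \<xi>))"
    "integrable M (\<lambda>\<xi>. inner (E \<xi>) (sig \<xi> *v E \<xi>))"
    by (intro integrable_inner_L2 E H rE rH' sE)+
  have c: "integrable M (\<lambda>\<xi>. - cdot (rE \<xi>) (H \<xi>) + cdot (E \<xi>) (rH \<xi>))"
    by (intro Bochner_Integration.integrable_add Bochner_Integration.integrable_minus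
        integrable_L2_product[OF bounded_bilinear_cdot] E H rE rH')
  have "Re (\<integral>\<xi>. - cdot (rE \<xi>) (H \<xi>) + cdot (E \<xi>) (rH \<xi>) \<partial>M) =
      (\<integral>\<xi>. Re (- cdot (rE \<xi>) (H \<xi>) + cdot (E \<xi>) (rH \<xi>)) \<partial>M)"
    by (rule integral_bounded_linear[symmetric, OF bounded_linear_Re c])
  also have "\<dots> = (\<integral>\<xi>. - inner (H \<xi>) (rE \<xi>) + inner (E \<xi>) (rH \<xi>) \<partial>M)"
    by (simp add: Re_cdot inner_commute)
  also have "\<dots> = - (\<integral>\<xi>. inner (H \<xi>) (rE \<xi>) \<partial>M) + (\<integral>\<xi>. inner (E \<xi>) (rH \<xi>) \<partial>M)"
    using i by simp
  finally show ?thesis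
    using i dissipation_nonneg[OF sig(2), of E] by (simp add: inner_diff_right)
qed

theorem mainTheorem1:
  fixes c :: "'k::finite \<Rightarrow> cable" and \<Omega>0 \<Omega> :: "(real^3) set" and S :: "(real^3) measure"
    and C L R G :: "real \<Rightarrow> complex^'k^'k"
    and eps mu sig :: "real^3 \<Rightarrow> complex^3^3"
    and k m :: nat and Winp W0 Wout :: "complex mat"
    and \<psi> q Iext Eext V I :: "real \<Rightarrow> real \<Rightarrow> complex^'k"
    and B D E H :: "real \<Rightarrow> real^3 \<Rightarrow> complex^3"
    and u y :: "real \<Rightarrow> complex Matrix.vec"
  assumes k: "k = CARD('k)"
    and geometry: "geometry \<Omega>0 c"
    and \<Omega>: "\<Omega> = outer_region \<Omega>0 c"
    and S: "surface_measure (frontier \<Omega>) S"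
    and line: "line_params C L R G"
    and maxwell: "maxwell_params \<Omega> eps mu sig"
    and inputs: "passive_input k m Winp W0"
    and co_located: "co_located k m (Winp @\<^sub>r W0) Wout"
    \<comment> \<open>constitutive relations\<close>
    and V: "\<And>t \<eta>. V t \<eta> = matrix_inv (C \<eta>) *v q t \<eta>"
    and I: "\<And>t \<eta>. I t \<eta> = matrix_inv (L \<eta>) *v \<psi> t \<eta> + Iext t \<eta>"
    and H: "\<And>t \<xi>. H t \<xi> = matrix_inv (mu \<xi>) *v B t \<xi>"
    and E: "\<And>t \<xi>. E t \<xi> = matrix_inv (eps \<xi>) *v D t \<xi>"
    \<comment> \<open>regularity\<close>
    and reg_line: "C1_L2 unit_int \<psi>" "C1_L2 unit_int q"
    and reg_field: "C1_L2 (lebesgue_on \<Omega>) B" "C1_L2 (lebesgue_on \<Omega>) D"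
    and reg_Iext: "\<And>t. t \<ge> 0 \<Longrightarrow> Iext t \<in> L2 unit_int"
    and reg_VI: "\<And>t. t \<ge> 0 \<Longrightarrow> V t \<in> H1" "\<And>t. t \<ge> 0 \<Longrightarrow> I t \<in> H1"
    and reg_EH: "\<And>t. t \<ge> 0 \<Longrightarrow> E t \<in> Hrot \<Omega>" "\<And>t. t \<ge> 0 \<Longrightarrow> H t \<in> Hrot \<Omega>"
    and trace_E: "\<And>t. t \<ge> 0 \<Longrightarrow> \<exists>g. is_proj_trace \<Omega> S (E t) g"
    and trace_H: "\<And>t. t \<ge> 0 \<Longrightarrow> \<exists>h. is_cross_trace \<Omega> S (H t) h"
    and by_parts: "\<And>t. t \<ge> 0 \<Longrightarrow>
          (\<integral>\<xi>. - cdot (wrot \<Omega> (E t) \<xi>) (H t \<xi>) + cdot (E t \<xi>) (wrot \<Omega> (H t) \<xi>) \<partial>lebesgue_on \<Omega>) =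
          (\<integral>\<xi>. cdot (proj_trace \<Omega> S (E t) \<xi>) (cross_trace \<Omega> S (H t) \<xi>) \<partial>S)"
    \<comment> \<open>telegrapher's equations\<close>
    and tel_\<psi>: "\<And>t. t \<ge> 0 \<Longrightarrow> has_L2_derivative unit_int \<psi>
          (\<lambda>\<eta>. - (R \<eta> *v (matrix_inv (L \<eta>) *v \<psi> t \<eta>)) - wderiv (V t) \<eta>) t"
    and tel_q: "\<And>t. t \<ge> 0 \<Longrightarrow> has_L2_derivative unit_int q
          (\<lambda>\<eta>. - (G \<eta> *v (matrix_inv (C \<eta>) *v q t \<eta>)) - wderiv (I t) \<eta>) t"
    and tel_E: "\<And>t. t \<ge> 0 \<Longrightarrow> AE \<eta> in unit_int. Eext t \<eta> = wderiv (V t) \<eta>"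
    \<comment> \<open>input and output\<close>
    and u_dim: "\<And>t. t \<ge> 0 \<Longrightarrow> u t \<in> carrier_vec m"
    and in_rel: "\<And>t. t \<ge> 0 \<Longrightarrow>
          u t @\<^sub>v 0\<^sub>v (2 * k - m) = (Winp @\<^sub>r W0) *\<^sub>v port_vec (V t) (I t)"
    and out_rel: "\<And>t. t \<ge> 0 \<Longrightarrow> y t = Wout *\<^sub>v port_vec (V t) (I t)"
    \<comment> \<open>Maxwell's equations\<close>
    and max_B: "\<And>t. t \<ge> 0 \<Longrightarrow> has_L2_derivative (lebesgue_on \<Omega>) B
          (\<lambda>\<xi>. - wrot \<Omega> (E t) \<xi>) t"
    and max_D: "\<And>t. t \<ge> 0 \<Longrightarrow> has_L2_derivative (lebesgue_on \<Omega>) D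
          (\<lambda>\<xi>. wrot \<Omega> (H t) \<xi> - sig \<xi> *v E t \<xi>) t"
    \<comment> \<open>boundary conditions\<close>
    and bc_outer:
        "(\<forall>t\<ge>0. AE \<xi> in S. \<xi> \<in> frontier \<Omega>0 \<longrightarrow> proj_trace \<Omega> S (E t) \<xi> = 0) \<or>
         (\<forall>t\<ge>0. AE \<xi> in S. \<xi> \<in> frontier \<Omega>0 \<longrightarrow> cross_trace \<Omega> S (H t) \<xi> = 0)"
    and bc_end: "\<And>t. t \<ge> 0 \<Longrightarrow>
          AE \<xi> in S. \<xi> \<in> (\<Union>i. end_surface (c i)) \<longrightarrow> proj_trace \<Omega> S (E t) \<xi> = 0"
    \<comment> \<open>coupling conditions\<close>
    and coupling_I: "\<And>t. t \<ge> 0 \<Longrightarrow>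
          AE \<eta> in unit_int. - Iext t \<eta> = P_mag \<Omega> c (cross_trace \<Omega> S (H t)) \<eta>"
    and coupling_E: "\<And>t. t \<ge> 0 \<Longrightarrow>
          AE \<xi> in S. \<xi> \<in> (\<Union>i. lat_surface (c i)) \<longrightarrow>
            proj_trace \<Omega> S (E t) \<xi> = P_el c (Eext t) \<xi>"
    and t: "t \<ge> 0"
  shows "\<exists>d. ((\<lambda>s. energy \<Omega> C L eps mu (\<psi> s) (q s) (B s) (D s)) has_real_derivative d)
               (at t within {0..}) \<and>
             d \<le> Re (scalar_prod (conjugate (u t)) (y t))"
proof -
  let ?M = "lebesgue_on \<Omega>"
  have inv: "ess_bounded unit_int (\<lambda>\<eta>. matrix_inv (L \<eta>))" "ess_bounded unit_int (\<lambda>\<eta>. matrix_inv (C \<eta>))"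
    "ess_bounded ?M (\<lambda>\<xi>. matrix_inv (mu \<xi>))" "ess_bounded ?M (\<lambda>\<xi>. matrix_inv (eps \<xi>))"
    and bdd: "ess_bounded unit_int R" "ess_bounded unit_int G" "ess_bounded ?M sig"
    using line maxwell by (auto simp: line_params_def maxwell_params_def)
  have lineAE: "AE \<eta> in unit_int. pd (C \<eta>) \<and> pd (L \<eta>) \<and> psd (R \<eta> + adj (R \<eta>)) \<and> psd (G \<eta> + adj (G \<eta>))"
    and maxAE: "AE \<xi> in ?M. pd (eps \<xi>) \<and> pd (mu \<xi>) \<and> psd (sig \<xi> + adj (sig \<xi>))"
    using line maxwell by (auto simp: line_params_def maxwell_params_def)
  have pd: "AE \<eta> in unit_int. pd (L \<eta>)" "AE \<eta> in unit_int. pd (C \<eta>)"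
    "AE \<xi> in ?M. pd (mu \<xi>)" "AE \<xi> in ?M. pd (eps \<xi>)"
    and psd: "AE \<eta> in unit_int. psd (R \<eta> + adj (R \<eta>))" "AE \<eta> in unit_int. psd (G \<eta> + adj (G \<eta>))"
    "AE \<xi> in ?M. psd (sig \<xi> + adj (sig \<xi>))"
    using lineAE maxAE by (auto elim: eventually_mono)
  have L2s: "\<psi> s \<in> L2 unit_int" "q s \<in> L2 unit_int" "B s \<in> L2 ?M" "D s \<in> L2 ?M" if "s \<ge> 0" for s
    using that reg_line reg_field by (auto simp: C1_L2_def)
  define P1 where "P1 = (\<integral>\<eta>. inner (matrix_inv (L \<eta>) *v \<psi> t \<eta>) (- (R \<eta> *v (matrix_inv (L \<eta>) *v \<psi> t \<eta>)) - wderiv (V t) \<eta>) \<partial>unit_int)"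
  define P2 where "P2 = (\<integral>\<eta>. inner (matrix_inv (C \<eta>) *v q t \<eta>) (- (G \<eta> *v (matrix_inv (C \<eta>) *v q t \<eta>)) - wderiv (I t) \<eta>) \<partial>unit_int)"
  define P3 where "P3 = (\<integral>\<xi>. inner (matrix_inv (mu \<xi>) *v B t \<xi>) (- wrot \<Omega> (E t) \<xi>) \<partial>?M)"
  define P4 where "P4 = (\<integral>\<xi>. inner (matrix_inv (eps \<xi>) *v D t \<xi>) (wrot \<Omega> (H t) \<xi> - sig \<xi> *v E t \<xi>) \<partial>?M)"
  have "((\<lambda>s. 1/2 * ((\<integral>\<eta>. inner (\<psi> s \<eta>) (matrix_inv (L \<eta>) *v \<psi> s \<eta>) \<partial>unit_int) +
           (\<integral>\<eta>. inner (q s \<eta>) (matrix_inv (C \<eta>) *v q s \<eta>) \<partial>unit_int) +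
           (\<integral>\<xi>. inner (B s \<xi>) (matrix_inv (mu \<xi>) *v B s \<xi>) \<partial>?M) +
           (\<integral>\<xi>. inner (D s \<xi>) (matrix_inv (eps \<xi>) *v D s \<xi>) \<partial>?M)))
      has_real_derivative 1/2 * (2 * P1 + 2 * P2 + 2 * P3 + 2 * P4)) (at t within {0..})"
    unfolding P1_def P2_def P3_def P4_def
    by (intro DERIV_cmult DERIV_add quadratic_energy_derivative inv pd reg_line reg_field
        tel_\<psi> tel_q max_B max_D t)
  then have "((\<lambda>s. energy \<Omega> C L eps mu (\<psi> s) (q s) (B s) (D s)) has_real_derivative
       1/2 * (2 * P1 + 2 * P2 + 2 * P3 + 2 * P4)) (at t within {0..})"
    by (rule has_field_derivative_transform_within[of _ _ _ _ 1])
       (use t in \<open>auto simp: energy_split[OF inv L2s]\<close>)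
  moreover have "1/2 * (2 * P1 + 2 * P2 + 2 * P3 + 2 * P4) = P1 + P2 + P3 + P4" by simp
  ultimately have deriv: "((\<lambda>s. energy \<Omega> C L eps mu (\<psi> s) (q s) (B s) (D s)) has_real_derivative
       P1 + P2 + P3 + P4) (at t within {0..})" by metis
  have "P1 + P2 \<le> inner (cont_rep (V t) 0) (cont_rep (I t) 0) - inner (cont_rep (V t) 1) (cont_rep (I t) 1)
      + (\<integral>\<eta>. inner (Iext t \<eta>) (wderiv (V t) \<eta>) \<partial>unit_int)"
    unfolding P1_def P2_def V[symmetric]
    by (rule line_power[OF reg_VI(1)[OF t] reg_VI(2)[OF t] reg_Iext[OF t] bdd(1) psd(1) bdd(2) psd(2)])
       (simp add: I)
  moreover
  define g where "g = proj_trace \<Omega> S (E t)"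
  define h where "h = cross_trace \<Omega> S (H t)"
  have "is_proj_trace \<Omega> S (E t) g" unfolding g_def proj_trace_def by (rule someI_ex[OF trace_E[OF t]])
  then have gL: "g \<in> L2 S" by (simp add: is_proj_trace_def)
  have "is_cross_trace \<Omega> S (H t) h" unfolding h_def cross_trace_def by (rule someI_ex[OF trace_H[OF t]])
  then have hL: "h \<in> L2 S" by (simp add: is_cross_trace_def)
  have EH: "E t \<in> L2 ?M" "H t \<in> L2 ?M" using reg_EH[OF t] by (auto simp: Hrot_def)
  have rE: "wrot \<Omega> (E t) \<in> L2 ?M" using L2_uminus[OF has_L2_derivative_L2[OF max_B[OF t]]] by simp
  have "P3 + P4 \<le> Re (\<integral>\<xi>. cdot (g \<xi>) (h \<xi>) \<partial>S)"
    unfolding P3_def P4_def H[symmetric] E[symmetric] g_def h_def by_parts[OF t, symmetric]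
    by (rule field_power[OF EH rE has_L2_derivative_L2[OF max_D[OF t]] bdd(3) psd(3)])
  moreover
  \<comment> \<open>the coupling exchanges power without loss\<close>
  have "Re (\<integral>\<xi>. cdot (g \<xi>) (h \<xi>) \<partial>S) = - (\<integral>\<eta>. inner (Iext t \<eta>) (wderiv (V t) \<eta>) \<partial>unit_int)"
  proof -
    have VL: "wderiv (V t) \<in> L2 unit_int" by (rule H1_representation(1)[OF reg_VI(1)[OF t]])
    have Em: "Eext t \<in> borel_measurable unit_int"
      by (rule unit_int_measurable_AE[OF L2_measurable[OF VL]]) (use tel_E[OF t] in \<open>auto elim!: eventually_mono\<close>)
    have outer: "(AE \<xi> in S. \<xi> \<in> frontier \<Omega>0 \<longrightarrow> g \<xi> = 0) \<or> (AE \<xi> in S. \<xi> \<in> frontier \<Omega>0 \<longrightarrow> h \<xi> = 0)"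
      using bc_outer t by (auto simp: g_def h_def)
    note bp = boundary_power[OF geometry \<Omega> S gL hL Em outer bc_end[OF t, folded g_def] coupling_E[OF t, folded g_def]]
    have i: "integrable unit_int (\<lambda>\<eta>. inner (Iext t \<eta>) (wderiv (V t) \<eta>))"
      by (intro integrable_inner_L2 reg_Iext[OF t] VL)
    have "Re (\<integral>\<xi>. cdot (g \<xi>) (h \<xi>) \<partial>S) = (\<integral>\<eta>. Re (cdot (Eext t \<eta>) (P_mag \<Omega> c h \<eta>)) \<partial>unit_int)"
      unfolding bp(2) by (rule integral_bounded_linear[symmetric, OF bounded_linear_Re bp(1)])
    also have "\<dots> = (\<integral>\<eta>. - inner (Iext t \<eta>) (wderiv (V t) \<eta>) \<partial>unit_int)"
    proof (rule integral_cong_AE)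
      show "(\<lambda>\<eta>. Re (cdot (Eext t \<eta>) (P_mag \<Omega> c h \<eta>))) \<in> borel_measurable unit_int"
        by (intro borel_measurable_integrable integrable_bounded_linear[OF bounded_linear_Re bp(1)])
      show "(\<lambda>\<eta>. - inner (Iext t \<eta>) (wderiv (V t) \<eta>)) \<in> borel_measurable unit_int"
        using i by (intro borel_measurable_integrable) simp
      show "AE \<eta> in unit_int. Re (cdot (Eext t \<eta>) (P_mag \<Omega> c h \<eta>)) = - inner (Iext t \<eta>) (wderiv (V t) \<eta>)"
        using tel_E[OF t] coupling_I[OF t, folded h_def]
      proof eventually_elim
        case (elim \<eta>)
        show ?case by (simp add: elim(1) elim(2)[symmetric] Re_cdot inner_commute)
      qed
    qed
    finally show ?thesis by simp
  qed
  moreover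
  have "inner (cont_rep (V t) 0) (cont_rep (I t) 0) - inner (cont_rep (V t) 1) (cont_rep (I t) 1)
      \<le> Re (scalar_prod (conjugate (u t)) (y t))"
    by (rule port_vec_passive[OF k inputs co_located u_dim[OF t] in_rel[OF t] out_rel[OF t]])
  ultimately have "P1 + P2 + P3 + P4 \<le> Re (scalar_prod (conjugate (u t)) (y t))"
    by linarith
  with deriv show ?thesis by blast
qed

end
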